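(* Let $n\geq 2$ be an integer, $\rho>1$, and let $(p_r)_{r\geq1}$ satisfy $p_r>0$, $\sum_{r\geq1}p_r=1$ and $C_1\rho^{-r}\leq p_r\leq C_2\rho^{-r}$ for some constants $C_1,C_2>0$. Assume the spectral dimension $\mathrm{d}=2\frac{\log n}{\log\rho}$ satisfies $\mathrm{d}<1$. Let $e\in\mathbb{R}$ be such that $\eta(e)>0$ and such that for every $z\in\mathbb{C}$ with $\mathrm{Im}\, z>0$, $$\lim_{\varepsilon\downarrow0}\int_{\mathbb{R}}\mathrm{Im}\,(t-e-\varepsilon z)^{-1}\eta(t)\,dt=\pi\eta(e).$$ Then the rescaled eigenvalue point process $\xi_k^{\omega,e}=\sum_{i=1}^{|B_k|}\delta\big(|B_k|(e_i^{\omega,k}-e)\big)$ converges, as $k\to\infty$, to a Poisson point process on $\mathbb{R}$ with intensity $\eta(e)\mathcal{L}$, where $\mathcal{L}$ is Lebesgue measure. That is, for any disjoint bounded Borel sets $A_1,\dots,A_m\subset\mathbb{R}$ and any $r_1,\dots,r_m\in\{0,1,2,\dots\}$, $$\lim_{k\to\infty}\mathbb{P}\{\xi_k^{\omega,e}(A_1)=r_1,\dots,\xi_k^{\omega,e}(A_m)=r_m\}=\prod_{s=1}^m e^{-\eta(e)\mathcal{L}(A_s)}\frac{(\eta(e)\mathcal{L}(A_s))^{r_s}}{r_s!}.$$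
   Context: Hierarchical Anderson model. Let $\mathbb{X}=\{0,1,2,\dots\}$. For $x\in\mathbb{X}$ and $r\geq0$ let $q(x,n^r)$ be the quotient of the division of $x$ by $n^r$, and define the metric $d(x,y)=\min\{r: q(x,n^r)=q(y,n^r)\}$; closed balls are $B(x,r)=\{y: d(x,y)\leq r\}$ (each has $n^r$ points). For $r\geq1$ let $E_r$ be the operator on $\ell^2(\mathbb{X})$ given by $(E_r\psi)(x)=n^{-r}\sum_{d(y,x)\leq r}\psi(y)$ (orthogonal projection onto functions constant on balls of radius $r$). The hierarchical Laplacian is $\Delta=\sum_{r\geq1}p_rE_r$. Let $(\omega(x))_{x\in\mathbb{X}}$ be i.i.d. real random variables with a bounded probability density $\gamma$, on the product probability space $(\Omega,\mathcal{F},\mathbb{P})$, and let $V_\omega$ be multiplication by $\omega(x)$. Set $H_\omega=\Delta+V_\omega$ (self-adjoint on $\{\psi:\sum_x|\psi(x)|^2(1+|\omega(x)|^2)<\infty\}$). Fix $x_0\in\mathbb{X}$, let $B_k=B(x_0,k)$, so $|B_k|=n^k$, and let $H_k^\omega=\sum_{s=1}^kp_sE_s+V_\omega$; the subspace $\ell^2(B_k)$ of functions vanishing outside $B_k$ is invariant under $H_k^\omega$, and $e_1^{\omega,k}\leq\dots\leq e^{\omega,k}_{|B_k|}$ denote the eigenvalues of $H_k^\omega$ restricted to $\ell^2(B_k)$. The averaged spectral measure $\mu^{av}$ is the Borel probability measure with $\int f\,d\mu^{av}=\mathbb{E}\langle\delta_{x_0},f(H_\omega)\delta_{x_0}\rangle$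 for continuous $f$ vanishing at infinity; it is absolutely continuous with respect to Lebesgue measure with a bounded density $\eta$ ($\|\eta\|_\infty\leq\|\gamma\|_\infty$). *)

theory Defs
  imports "HOL-Probability.Probability" "HOL-Computational_Algebra.Polynomial_Factorial"
    "Jordan_Normal_Form.Char_Poly"
begin

text \<open>Hierarchical structure on X = nat with branching number n.
  d(x,y) <= r  iff  x div n^r = y div n^r, so the closed ball is:\<close>
definition hball :: "nat \<Rightarrow> nat \<Rightarrow> nat \<Rightarrow> nat set" where
  "hball n x r = {y. y div n ^ r = x div n ^ r}"

definition hE :: "nat \<Rightarrow> nat \<Rightarrow> (nat \<Rightarrow> complex) \<Rightarrow> nat \<Rightarrow> complex" where
  "hE n r \<psi> x = (\<Sum>y\<in>hball n x r. \<psi> y) / of_nat (n ^ r)"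

definition hH :: "nat \<Rightarrow> (nat \<Rightarrow> real) \<Rightarrow> (nat \<Rightarrow> real) \<Rightarrow> (nat \<Rightarrow> complex) \<Rightarrow> nat \<Rightarrow> complex" where
  "hH n p \<omega> \<psi> x = (\<Sum>r. complex_of_real (p (Suc r)) * hE n (Suc r) \<psi> x) + complex_of_real (\<omega> x) * \<psi> x"

definition hdom :: "(nat \<Rightarrow> real) \<Rightarrow> (nat \<Rightarrow> complex) set" where
  "hdom \<omega> = {\<psi>. summable (\<lambda>x. (cmod (\<psi> x))\<^sup>2 * (1 + (\<omega> x)\<^sup>2))}"

text \<open>Diagonal resolvent matrix element  < delta_x0, (H_omega - z)^{-1} delta_x0 >,
  i.e. psi(x0) where psi is the (unique) element of the domain with (H_omega - z) psi = delta_x0.\<close>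
definition hresolvent :: "nat \<Rightarrow> (nat \<Rightarrow> real) \<Rightarrow> nat \<Rightarrow> (nat \<Rightarrow> real) \<Rightarrow> complex \<Rightarrow> complex" where
  "hresolvent n p x0 \<omega> z = (THE c. \<exists>\<psi>\<in>hdom \<omega>.
      (\<forall>x. hH n p \<omega> \<psi> x - z * \<psi> x = (if x = x0 then 1 else 0)) \<and> c = \<psi> x0)"

text \<open>Matrix of H_k^omega restricted to l^2(B_k), B_k = B(x0,k) = {c n^k + i | i < n^k},
  c = x0 div n^k; row/column index i corresponds to the point c n^k + i.\<close>
definition hHk_mat :: "nat \<Rightarrow> (nat \<Rightarrow> real) \<Rightarrow> nat \<Rightarrow> nat \<Rightarrow> (nat \<Rightarrow> real) \<Rightarrow> real mat" where
  "hHk_mat n p x0 k \<omega> = (let c = x0 div n ^ k in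
     mat (n ^ k) (n ^ k) (\<lambda>(i, j).
       (\<Sum>s\<in>{1..k}. p s / real n ^ s *
          (if (c * n ^ k + i) div n ^ s = (c * n ^ k + j) div n ^ s then 1 else 0))
       + (if i = j then \<omega> (c * n ^ k + i) else 0)))"

definition hxi :: "nat \<Rightarrow> (nat \<Rightarrow> real) \<Rightarrow> nat \<Rightarrow> real \<Rightarrow> nat \<Rightarrow> (nat \<Rightarrow> real) \<Rightarrow> real set \<Rightarrow> nat" where
  "hxi n p x0 e k \<omega> A =
     size (filter_mset (\<lambda>t. real (n ^ k) * (t - e) \<in> A) (proots (char_poly (hHk_mat n p x0 k \<omega>))))"

end

theory Submission
  imports Defs
begin

text \<open>
  Keep only the levels \<open>s \<le> l\<close> of the hierarchical Laplacian on \<open>B\<^sub>k\<close>, where \<open>l = \<lceil>\<alpha> k\<rceil>\<close>.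
  The operator splits into independent, identically distributed blocks of size \<open>n\<^sup>l\<close>, and it differs
  from the full one by a perturbation of norm \<open>O(\<rho>\<^sup>-\<^sup>l)\<close>. Since \<open>n\<^sup>2 < \<rho>\<close>, \<open>\<alpha> < 1\<close> can be chosen so
  that this is \<open>o(|B\<^sub>k|\<^sup>-\<^sup>2)\<close>. By Weyl's inequality and the Wegner estimate the two rescaled counting
  functions of an interval are then close in \<open>L\<^sup>1\<close>, and approximation extends this to Borel sets.

  A block contributes to a bounded window with probability \<open>O(1/b)\<close>, \<open>b\<close> being the number of blocks,
  and contributes twice with probability \<open>O(1/b\<^sup>2)\<close> by Minami's estimate. Hence the law of a block agrees
  with that of a Poisson vector of intensity \<open>1/b\<close> up to \<open>o(1/b)\<close>, and Le Cam's replacement argument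
  gives the Poisson limit once the expected counts converge. The Poisson transform of the density of
  states of \<open>H\<^sub>k\<close> differs from that of \<open>\<eta>\<close> by a resolvent comparison error that vanishes even at the
  scale \<open>1/|B\<^sub>k|\<close>. The hypothesis at \<open>e\<close> thus identifies the limiting Poisson transform as the constant
  \<open>\<pi> \<eta>(e)\<close>, and inverting it shows that the expected counts converge to \<open>\<eta>(e) \<L>(A)\<close>.
\<close>

section \<open>Resolvents and eigenvalue counts of finite symmetric operators\<close>

text \<open>The hypothesis at \<open>e\<close> speaks of one averaged resolvent entry of the
  infinite operator, the conclusion of root multisets of finite characteristic polynomials. Three
  constructions join them. Digitwise addition \<open>dadd\<close> preserves the metric and moves the
  origin to any site, so under an i.i.d. potential all sites of a block share the same averaged
  diagonal entry, and the normalised trace becomes the entry at \<open>x0\<close>. The bookkeeping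
  of eigenvalues rests on one dimension count, which yields Weyl's inequality and rank-one
  interlacing together. Measurability of the counts comes from their semicontinuity on closed
  intervals.

  The threshold \<open>n^2 < \<rho>\<close> stems from the resolvent comparison: its error is the
  discarded mass divided by \<open>(Im z)^2\<close>, and \<open>Im z\<close> is of order
  \<open>n^(-k)\<close>. This is the assumption \<open>l_tail\<close>; the comparison of counts uses
  the smaller quantity with a single factor \<open>n^k\<close>. The expected counts are taken for
  the decoupled operator, since its blocks are what Le Cam's argument sees, so resolvents are
  compared at level \<open>l k\<close>.\<close>

lemma homogeneous_system_nontrivial:
  fixes m :: "'t \<Rightarrow> 'i \<Rightarrow> 'a::field"
  assumes "finite T" "finite S" "card T < card S"
  shows "\<exists>c. (\<exists>i\<in>S. c i \<noteq> 0) \<and> (\<forall>i. i \<notin> S \<longrightarrow> c i = 0) \<and> (\<forall>t\<in>T. (\<Sum>i\<in>S. m t i * c i) = 0)"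
  using assms
proof (induction T arbitrary: S m rule: finite_induct)
  case empty
  then obtain j where "j \<in> S" by fastforce
  then show ?case by (intro exI[of _ "\<lambda>i. if i = j then 1 else 0"]) auto
next
  case (insert t T)
  show ?case
  proof (cases "\<forall>i\<in>S. m t i = 0")
    case True
    have "card T < card S" using insert by simp
    from insert.IH[OF insert.prems(1) this, of m] obtain c where
      "\<exists>i\<in>S. c i \<noteq> 0" "\<forall>i. i \<notin> S \<longrightarrow> c i = 0" "\<forall>t\<in>T. (\<Sum>i\<in>S. m t i * c i) = 0" by blast
    then show ?thesis using True by (intro exI[of _ c]) auto
  next
    case False
    then obtain j where j: "j \<in> S" "m t j \<noteq> 0" by blast
    \<comment> \<open>Gaussian elimination: equation \<open>t\<close> is solved for the unknown at
      \<open>j\<close>, and \<open>m'\<close> is the system left for the other unknowns.\<close>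
    define m' where "m' = (\<lambda>t' i. m t' i - m t' j * m t i / m t j)"
    have "card T < card (S - {j})" using insert j by simp
    from insert.IH[OF _ this, of m'] insert.prems(1) obtain c where
      c: "\<exists>i\<in>S - {j}. c i \<noteq> 0" "\<forall>i. i \<notin> S - {j} \<longrightarrow> c i = 0"
        "\<forall>t'\<in>T. (\<Sum>i\<in>S - {j}. m' t' i * c i) = 0" by blast
    define s where "s = (\<Sum>i\<in>S - {j}. m t i * c i)"
    define d where "d = c(j := - s / m t j)"
    have sums: "(\<Sum>i\<in>S. m t' i * d i) = (\<Sum>i\<in>S - {j}. m t' i * c i) - m t' j * s / m t j" for t'
    proof -
      have "(\<Sum>i\<in>S. m t' i * d i) = m t' j * d j + (\<Sum>i\<in>S - {j}. m t' i * d i)"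
        using j insert.prems by (simp add: sum.remove)
      also have "(\<Sum>i\<in>S - {j}. m t' i * d i) = (\<Sum>i\<in>S - {j}. m t' i * c i)"
        by (intro sum.cong) (auto simp: d_def)
      finally show ?thesis by (simp add: d_def)
    qed
    have "(\<Sum>i\<in>S. m t' i * d i) = 0" if "t' \<in> T" for t'
    proof -
      have "(\<Sum>i\<in>S - {j}. m' t' i * c i) = (\<Sum>i\<in>S - {j}. m t' i * c i) - m t' j * s / m t j"
        unfolding m'_def s_def
        by (simp add: algebra_simps sum_subtractf sum_distrib_left sum_divide_distrib)
      then show ?thesis using sums c(3) that by auto
    qed
    moreover have "(\<Sum>i\<in>S. m t i * d i) = 0" using sums[of t] j by (simp add: s_def)
    moreover have "\<exists>i\<in>S. d i \<noteq> 0" using c(1) by (auto simp: d_def)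
    moreover have "\<forall>i. i \<notin> S \<longrightarrow> d i = 0" using c(2) j by (auto simp: d_def)
    ultimately show ?thesis by blast
  qed
qed

section \<open>Square-sum norms over finite sets and Schur's test\<close>

definition l2 :: "nat set \<Rightarrow> (nat \<Rightarrow> complex) \<Rightarrow> real" where
  "l2 S \<psi> = L2_set (\<lambda>x. cmod (\<psi> x)) S"

lemma l2_nonneg [simp]: "l2 S \<psi> \<ge> 0"
  by (simp add: l2_def)

lemma l2_power2: "(l2 S \<psi>)\<^sup>2 = (\<Sum>x\<in>S. (cmod (\<psi> x))\<^sup>2)"
  by (simp add: l2_def L2_set_def sum_nonneg)

lemma l2_cong: "(\<And>x. x \<in> S \<Longrightarrow> cmod (\<psi> x) = cmod (\<phi> x)) \<Longrightarrow> l2 S \<psi> = l2 S \<phi>"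
  unfolding l2_def by (rule L2_set_cong) auto

lemma l2_triangle: "l2 S (\<lambda>x. \<psi> x + \<phi> x) \<le> l2 S \<psi> + l2 S \<phi>"
proof -
  have "l2 S (\<lambda>x. \<psi> x + \<phi> x) \<le> L2_set (\<lambda>x. cmod (\<psi> x) + cmod (\<phi> x)) S"
    unfolding l2_def by (rule L2_set_mono) (auto simp: norm_triangle_ineq)
  also have "\<dots> \<le> l2 S \<psi> + l2 S \<phi>" unfolding l2_def by (rule L2_set_triangle_ineq)
  finally show ?thesis .
qed

lemma l2_scale: "l2 S (\<lambda>x. c * \<psi> x) = cmod c * l2 S \<psi>"
  unfolding l2_def by (simp add: norm_mult L2_set_right_distrib)

lemma norm_le_l2: "finite S \<Longrightarrow> x \<in> S \<Longrightarrow> cmod (\<psi> x) \<le> l2 S \<psi>"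
  unfolding l2_def by (rule member_le_L2_set)

lemma l2_mono_set: "finite S \<Longrightarrow> T \<subseteq> S \<Longrightarrow> l2 T \<psi> \<le> l2 S \<psi>"
  unfolding l2_def L2_set_def by (auto intro: sum_mono2)

lemma l2_le_bound:
  assumes "\<And>x. x \<in> S \<Longrightarrow> cmod (\<psi> x) \<le> c * cmod (\<phi> x)" "c \<ge> 0"
  shows "l2 S \<psi> \<le> c * l2 S \<phi>"
proof -
  have "l2 S \<psi> \<le> L2_set (\<lambda>x. c * cmod (\<phi> x)) S"
    unfolding l2_def using assms by (intro L2_set_mono) auto
  then show ?thesis using assms(2) by (simp add: l2_def L2_set_right_distrib)
qed

lemma l2_eq_0: "finite S \<Longrightarrow> l2 S \<psi> \<le> 0 \<Longrightarrow> x \<in> S \<Longrightarrow> \<psi> x = 0"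
  using norm_le_l2[of S x \<psi>] by (metis norm_le_zero_iff order.trans)

lemma l2_delta: "finite S \<Longrightarrow> x \<in> S \<Longrightarrow> l2 S (\<lambda>y. if y = x then c else 0) = cmod c"
proof -
  assume "finite S" "x \<in> S"
  have "(\<Sum>y\<in>S. (cmod (if y = x then c else 0))\<^sup>2) = (\<Sum>y\<in>S. if y = x then (cmod c)\<^sup>2 else 0)"
    by (intro sum.cong) auto
  then show ?thesis using \<open>finite S\<close> \<open>x \<in> S\<close> by (simp add: l2_def L2_set_def)
qed

text \<open>Cauchy-Schwarz with each weight split into two square roots: one factor collects a row
  sum, the other, after exchanging the sums, a column sum, which by symmetry is again a row sum.
  This converts row sum bounds into operator norm bounds.\<close>

lemma schur_test:
  fixes b :: "nat \<Rightarrow> nat \<Rightarrow> real"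
  assumes fin: "finite S" and nn: "\<And>x y. x \<in> S \<Longrightarrow> y \<in> S \<Longrightarrow> b x y \<ge> 0"
    and sym: "\<And>x y. x \<in> S \<Longrightarrow> y \<in> S \<Longrightarrow> b x y = b y x"
    and row: "\<And>x. x \<in> S \<Longrightarrow> (\<Sum>y\<in>S. b x y) \<le> d" and d: "d \<ge> 0"
  shows "l2 S (\<lambda>x. \<Sum>y\<in>S. of_real (b x y) * \<psi> y) \<le> d * l2 S \<psi>"
proof -
  have "(cmod (\<Sum>y\<in>S. of_real (b x y) * \<psi> y))\<^sup>2 \<le> d * (\<Sum>y\<in>S. b x y * (cmod (\<psi> y))\<^sup>2)"
    if x: "x \<in> S" for x
  proof -
    have "cmod (\<Sum>y\<in>S. of_real (b x y) * \<psi> y) \<le> (\<Sum>y\<in>S. \<bar>sqrt (b x y)\<bar> * \<bar>sqrt (b x y) * cmod (\<psi> y)\<bar>)"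
    proof (rule order.trans[OF norm_sum], rule sum_mono)
      fix y assume y: "y \<in> S"
      have "sqrt (b x y) * sqrt (b x y) = b x y" using nn[OF x y] by simp
      then show "cmod (of_real (b x y) * \<psi> y) \<le> \<bar>sqrt (b x y)\<bar> * \<bar>sqrt (b x y) * cmod (\<psi> y)\<bar>"
        using nn[OF x y] by (simp add: norm_mult abs_mult flip: mult.assoc)
    qed
    also have "\<dots> \<le> L2_set (\<lambda>y. sqrt (b x y)) S * L2_set (\<lambda>y. sqrt (b x y) * cmod (\<psi> y)) S"
      by (rule L2_set_mult_ineq)
    finally have "(cmod (\<Sum>y\<in>S. of_real (b x y) * \<psi> y))\<^sup>2 \<le>
      (L2_set (\<lambda>y. sqrt (b x y)) S * L2_set (\<lambda>y. sqrt (b x y) * cmod (\<psi> y)) S)\<^sup>2"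
      by (rule power_mono) simp
    also have "\<dots> = (\<Sum>y\<in>S. (sqrt (b x y))\<^sup>2) * (\<Sum>y\<in>S. (sqrt (b x y) * cmod (\<psi> y))\<^sup>2)"
      by (simp add: power_mult_distrib L2_set_def sum_nonneg)
    also have "\<dots> = (\<Sum>y\<in>S. b x y) * (\<Sum>y\<in>S. b x y * (cmod (\<psi> y))\<^sup>2)"
      using nn[OF x] by (simp add: power_mult_distrib)
    also have "\<dots> \<le> d * (\<Sum>y\<in>S. b x y * (cmod (\<psi> y))\<^sup>2)"
      using row[OF x] nn[OF x] by (intro mult_right_mono sum_nonneg) auto
    finally show ?thesis .
  qed
  then have "(l2 S (\<lambda>x. \<Sum>y\<in>S. of_real (b x y) * \<psi> y))\<^sup>2 \<le>
      (\<Sum>x\<in>S. d * (\<Sum>y\<in>S. b x y * (cmod (\<psi> y))\<^sup>2))"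
    unfolding l2_power2 by (rule sum_mono)
  also have "\<dots> = d * (\<Sum>y\<in>S. (\<Sum>x\<in>S. b x y) * (cmod (\<psi> y))\<^sup>2)"
    by (simp add: sum_distrib_left sum_distrib_right mult.assoc) (rule sum.swap)
  also have "\<dots> \<le> d * (\<Sum>y\<in>S. d * (cmod (\<psi> y))\<^sup>2)"
  proof (intro mult_left_mono sum_mono mult_right_mono)
    fix y assume y: "y \<in> S"
    have "(\<Sum>x\<in>S. b x y) = (\<Sum>x\<in>S. b y x)" using sym[OF _ y] by simp
    then show "(\<Sum>x\<in>S. b x y) \<le> d" using row[OF y] by simp
  qed (use d in auto)
  also have "\<dots> = (d * l2 S \<psi>)\<^sup>2"
    unfolding power_mult_distrib l2_power2 sum_distrib_left by (simp add: power2_eq_square mult.assoc)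
  finally show ?thesis using d by (simp add: power2_le_iff_abs_le)
qed

section \<open>Green's functions of a finite symmetric kernel with a potential\<close>

definition hop :: "nat set \<Rightarrow> (nat \<Rightarrow> nat \<Rightarrow> real) \<Rightarrow> (nat \<Rightarrow> real) \<Rightarrow> (nat \<Rightarrow> complex) \<Rightarrow> nat \<Rightarrow> complex" where
  "hop S a w \<psi> x = (\<Sum>y\<in>S. of_real (a x y) * \<psi> y) + of_real (w x) * \<psi> x"

text \<open>A column of the resolvent, fixed by its equation instead of a matrix inverse, so that
  perturbations can be compared on the level of equations. For \<open>Im z > 0\<close> and
  \<open>x\<close> in \<open>S\<close> the choice is legitimate by \<open>green_exists\<close>. The
  value zero outside \<open>S\<close> lets columns for different balls be compared as functions on
  the whole space.\<close>

definition green :: "nat set \<Rightarrow> (nat \<Rightarrow> nat \<Rightarrow> real) \<Rightarrow> (nat \<Rightarrow> real) \<Rightarrow> complex \<Rightarrow> nat \<Rightarrow> nat \<Rightarrow> complex" where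
  "green S a w z x = (SOME \<psi>. (\<forall>y\<in>S. hop S a w \<psi> y - z * \<psi> y = (if y = x then 1 else 0)) \<and>
     (\<forall>y. y \<notin> S \<longrightarrow> \<psi> y = 0))"

lemma hop_diff: "hop S a w (\<lambda>y. \<psi> y - \<phi> y) x = hop S a w \<psi> x - hop S a w \<phi> x"
  by (simp add: hop_def algebra_simps sum_subtractf)

lemma hop_add: "hop S a w (\<lambda>y. \<psi> y + \<phi> y) x = hop S a w \<psi> x + hop S a w \<phi> x"
  by (simp add: hop_def algebra_simps sum.distrib)

lemma hop_scale: "hop S a w (\<lambda>y. c * \<psi> y) x = c * hop S a w \<psi> x"
  by (simp add: hop_def algebra_simps sum_distrib_left)

locale symker =
  fixes S :: "nat set" and a :: "nat \<Rightarrow> nat \<Rightarrow> real"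
  assumes fin: "finite S" and sym: "x \<in> S \<Longrightarrow> y \<in> S \<Longrightarrow> a x y = a y x"
begin

text \<open>The quadratic form of a real symmetric kernel plus a real potential is real, so only the
  spectral parameter reaches the imaginary part. All resolvent bounds below descend from this
  identity.\<close>

lemma Im_form:
  "Im (\<Sum>x\<in>S. cnj (\<psi> x) * (hop S a w \<psi> x - z * \<psi> x)) = - Im z * (l2 S \<psi>)\<^sup>2"
proof -
  define Q where "Q = (\<Sum>x\<in>S. \<Sum>y\<in>S. cnj (\<psi> x) * (of_real (a x y) * \<psi> y))"
  have "cnj Q = (\<Sum>x\<in>S. \<Sum>y\<in>S. cnj (\<psi> y) * (of_real (a y x) * \<psi> x))"
    unfolding Q_def using sym by (auto simp: ac_simps intro!: sum.cong)
  also have "\<dots> = Q" unfolding Q_def by (rule sum.swap)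
  finally have Q: "Im Q = 0" by (metis Reals_cnj_iff complex_is_Real_iff)
  have sq: "cnj u * (c * u) = c * of_real ((cmod u)\<^sup>2)" for u c
    unfolding complex_norm_square by (simp add: ac_simps)
  have "(\<Sum>x\<in>S. cnj (\<psi> x) * (hop S a w \<psi> x - z * \<psi> x)) =
      Q + (\<Sum>x\<in>S. (of_real (w x) - z) * of_real ((cmod (\<psi> x))\<^sup>2))"
    unfolding Q_def hop_def
    by (simp add: ring_distribs sum.distrib sum_subtractf sum_distrib_left sq left_diff_distrib)
  then show ?thesis using Q by (simp add: l2_power2 sum_distrib_left)
qed

text \<open>Cauchy-Schwarz applied to \<open>Im_form\<close>, divided by the norm of
  \<open>\<psi>\<close>: quantitative injectivity of the operator minus \<open>z\<close>.\<close>

lemma l2_lower: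
  assumes "Im z > 0"
  shows "Im z * l2 S \<psi> \<le> l2 S (\<lambda>x. hop S a w \<psi> x - z * \<psi> x)"
proof -
  let ?p = "\<lambda>x. hop S a w \<psi> x - z * \<psi> x"
  have "Im z * (l2 S \<psi>)\<^sup>2 \<le> cmod (\<Sum>x\<in>S. cnj (\<psi> x) * ?p x)"
    using abs_Im_le_cmod[of "\<Sum>x\<in>S. cnj (\<psi> x) * ?p x"] unfolding Im_form by simp
  also have "\<dots> \<le> (\<Sum>x\<in>S. \<bar>cmod (\<psi> x)\<bar> * \<bar>cmod (?p x)\<bar>)"
    by (rule order.trans[OF norm_sum]) (simp add: norm_mult)
  also have "\<dots> \<le> l2 S \<psi> * l2 S ?p" unfolding l2_def by (rule L2_set_mult_ineq)
  finally have "l2 S \<psi> * (Im z * l2 S \<psi>) \<le> l2 S \<psi> * l2 S ?p" by (simp add: power2_eq_square ac_simps)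
  then show ?thesis by (cases "l2 S \<psi> = 0") (auto simp: mult_le_cancel_left l2_nonneg less_le)
qed

text \<open>The coefficient of the source is made an additional unknown, indexed by
  \<open>None\<close>, so that the homogeneous system has one unknown more than equations.
  \<open>l2_lower\<close> forbids this coefficient to vanish in a nontrivial solution, and dividing
  by it normalises the source.\<close>

lemma green_exists:
  assumes z: "Im z > 0" and x: "x \<in> S"
  shows "\<exists>\<psi>. (\<forall>y\<in>S. hop S a w \<psi> y - z * \<psi> y = (if y = x then 1 else 0)) \<and> (\<forall>y. y \<notin> S \<longrightarrow> \<psi> y = 0)"
proof -
  define m :: "nat \<Rightarrow> nat option \<Rightarrow> complex" where
    "m = (\<lambda>y i. case i of None \<Rightarrow> (if y = x then -1 else 0)
       | Some v \<Rightarrow> of_real (a y v) + (if v = y then of_real (w y) - z else 0))"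
  have "card S < card (insert None (Some ` S))"
    using fin by (simp add: card_image)
  then obtain c where c: "\<exists>i\<in>insert None (Some ` S). c i \<noteq> 0" 
    "\<And>t. t \<in> S \<Longrightarrow> (\<Sum>i\<in>insert None (Some ` S). m t i * c i) = 0"
    using homogeneous_system_nontrivial[of S "insert None (Some ` S)" m] fin by auto
  define \<phi> where "\<phi> = (\<lambda>y. if y \<in> S then c (Some y) else 0)"
  have eq: "hop S a w \<phi> y - z * \<phi> y = (if y = x then c None else 0)" if y: "y \<in> S" for y
  proof -
    have "0 = m y None * c None + (\<Sum>v\<in>S. m y (Some v) * c (Some v))"
      using c(2)[OF y] fin by (simp add: sum.reindex)
    also have "(\<Sum>v\<in>S. m y (Some v) * c (Some v)) =
       (\<Sum>v\<in>S. of_real (a y v) * \<phi> v) + (\<Sum>v\<in>S. if v = y then (of_real (w y) - z) * \<phi> y else 0)"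
      unfolding sum.distrib[symmetric] by (intro sum.cong) (auto simp: m_def \<phi>_def algebra_simps)
    also have "\<dots> = hop S a w \<phi> y - z * \<phi> y" using y fin by (simp add: hop_def algebra_simps)
    finally show ?thesis by (auto simp: m_def split: if_splits)
  qed
  have "c None \<noteq> 0"
  proof
    assume n: "c None = 0"
    have "l2 S (\<lambda>y. hop S a w \<phi> y - z * \<phi> y) = l2 S (\<lambda>y. 0)"
      using eq n by (intro l2_cong) auto
    also have "\<dots> = 0" by (simp add: l2_def L2_set_def)
    finally have "Im z * l2 S \<phi> \<le> 0" using l2_lower[OF z, of \<phi> w] by simp
    then have "l2 S \<phi> \<le> 0" using z by (simp add: mult_le_0_iff)
    then have "\<phi> y = 0" if "y \<in> S" for y using l2_eq_0[OF fin _ that] by blast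
    then show False using c(1) n by (auto simp: \<phi>_def)
  qed
  then show ?thesis using hop_scale[of S a w "1 / c None" \<phi>] eq
    by (intro exI[of _ "\<lambda>y. 1 / c None * \<phi> y"]) (auto simp: \<phi>_def field_simps)
qed

lemma green_eq:
  assumes "Im z > 0" "x \<in> S"
  shows "y \<in> S \<Longrightarrow> hop S a w (green S a w z x) y - z * green S a w z x y = (if y = x then 1 else 0)"
    and "y \<notin> S \<Longrightarrow> green S a w z x y = 0"
  using someI_ex[OF green_exists[OF assms, of w], folded green_def] by auto

text \<open>The error solves the equation with the defect \<open>r\<close> as source, and the
  resolvent has norm at most \<open>1 / Im z\<close>. Uniqueness and the comparisons between
  potentials and between truncation levels are instances.\<close>

lemma green_stability:
  assumes "Im z > 0" "x \<in> S"
    and eq: "\<And>y. y \<in> S \<Longrightarrow> hop S a w \<psi> y - z * \<psi> y = (if y = x then 1 else 0) + r y"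
  shows "l2 S (\<lambda>y. \<psi> y - green S a w z x y) \<le> l2 S r / Im z"
proof -
  let ?d = "\<lambda>y. \<psi> y - green S a w z x y"
  have "Im z * l2 S ?d \<le> l2 S (\<lambda>y. hop S a w ?d y - z * ?d y)" by (rule l2_lower) fact
  also have "\<dots> = l2 S r"
  proof (rule l2_cong)
    fix y assume y: "y \<in> S"
    have "hop S a w ?d y - z * ?d y = r y"
      using eq[OF y] green_eq(1)[OF assms(1,2) y, of w] by (simp add: hop_diff algebra_simps)
    then show "cmod (hop S a w ?d y - z * ?d y) = cmod (r y)" by simp
  qed
  finally show ?thesis using assms(1) by (simp add: field_simps)
qed

lemma green_unique:
  assumes "Im z > 0" "x \<in> S" "y \<in> S"
    and eq: "\<And>y. y \<in> S \<Longrightarrow> hop S a w \<psi> y - z * \<psi> y = (if y = x then 1 else 0)"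
  shows "green S a w z x y = \<psi> y"
proof -
  have "l2 S (\<lambda>y. \<psi> y - green S a w z x y) \<le> l2 S (\<lambda>_. 0) / Im z"
    using assms by (intro green_stability) auto
  then have "l2 S (\<lambda>y. \<psi> y - green S a w z x y) \<le> 0" by (simp add: l2_def L2_set_def)
  from l2_eq_0[OF fin this assms(3)] show ?thesis by simp
qed

lemma l2_green_le:
  assumes "Im z > 0" "x \<in> S"
  shows "l2 S (green S a w z x) \<le> 1 / Im z"
proof -
  have "Im z * l2 S (green S a w z x) \<le>
      l2 S (\<lambda>y. hop S a w (green S a w z x) y - z * green S a w z x y)"
    by (rule l2_lower) fact
  also have "\<dots> = l2 S (\<lambda>y. if y = x then 1 else 0)"
    using green_eq(1)[OF assms] by (intro l2_cong) auto
  also have "\<dots> = 1" using l2_delta[OF fin assms(2), of 1] by simp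
  finally show ?thesis using assms(1) by (simp add: field_simps)
qed

lemma norm_green_le:
  assumes "Im z > 0" "x \<in> S"
  shows "cmod (green S a w z x y) \<le> 1 / Im z"
proof (cases "y \<in> S")
  case True
  then show ?thesis using norm_le_l2[OF fin True] l2_green_le[OF assms] order.trans by blast
next
  case False
  then show ?thesis using green_eq(2)[OF assms False] assms by simp
qed

text \<open>The resolvent identity: the column for \<open>w\<close> solves the equation for
  \<open>w'\<close> up to the defect \<open>(w' - w)\<close> times itself. One factor
  \<open>1 / Im z\<close> comes from stability, the other from the size of the column.\<close>

lemma green_lipschitz:
  assumes z: "Im z > 0" and x: "x \<in> S" and y: "y \<in> S" and d: "\<And>v. v \<in> S \<Longrightarrow> \<bar>w v - w' v\<bar> \<le> d"
  shows "cmod (green S a w z x y - green S a w' z x y) \<le> d / (Im z)\<^sup>2"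
proof -
  let ?g = "green S a w z x"
  have d0: "d \<ge> 0" using d[OF x] by linarith
  have "l2 S (\<lambda>y. ?g y - green S a w' z x y) \<le> l2 S (\<lambda>y. of_real (w' y - w y) * ?g y) / Im z"
  proof (rule green_stability[OF z x])
    fix v assume v: "v \<in> S"
    show "hop S a w' ?g v - z * ?g v = (if v = x then 1 else 0) + of_real (w' v - w v) * ?g v"
      using green_eq(1)[OF z x v, of w] by (simp add: hop_def algebra_simps)
  qed
  also have "\<dots> \<le> (d * l2 S ?g) / Im z"
  proof (intro divide_right_mono l2_le_bound)
    fix v assume v: "v \<in> S"
    have "\<bar>w' v - w v\<bar> \<le> d" using d[OF v] by (simp add: abs_minus_commute)
    then show "cmod (of_real (w' v - w v) * ?g v) \<le> d * cmod (?g v)"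
      by (simp add: norm_mult mult_right_mono del: of_real_diff)
  qed (use z d0 in auto)
  also have "\<dots> \<le> (d * (1 / Im z)) / Im z"
    using z d0 l2_green_le[OF z x] by (intro divide_right_mono mult_left_mono) auto
  finally show ?thesis using norm_le_l2[OF fin y, of "\<lambda>y. ?g y - green S a w' z x y"]
    by (simp add: power2_eq_square)
qed

text \<open>Pairing the resolvent equation with its own solution gives \<open>Im z\<close> times the
  squared norm of the column, and the column is nonzero because its source is.\<close>

lemma Im_green_pos:
  assumes z: "Im z > 0" and x: "x \<in> S"
  shows "Im (green S a w z x x) > 0"
proof -
  let ?g = "green S a w z x"
  have "(\<Sum>y\<in>S. cnj (?g y) * (hop S a w ?g y - z * ?g y)) = (\<Sum>y\<in>S. if y = x then cnj (?g x) else 0)"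
    using green_eq(1)[OF z x] by (intro sum.cong) auto
  also have "\<dots> = cnj (?g x)" using fin x by simp
  finally have eq: "Im (?g x) = Im z * (l2 S ?g)\<^sup>2" using Im_form[of ?g w z] by simp
  have "l2 S ?g \<noteq> 0"
  proof
    assume "l2 S ?g = 0"
    then have "?g v = 0" if "v \<in> S" for v using l2_eq_0[OF fin _ that] by simp
    then have "hop S a w ?g x - z * ?g x = 0" using x by (simp add: hop_def)
    then show False using green_eq(1)[OF z x x, of w] by simp
  qed
  then show ?thesis using eq z by simp
qed

text \<open>Krein's formula: moving the term with the potential at \<open>x\<close> to the
  right-hand side only changes the strength \<open>c\<close> of the source, so the column is
  \<open>c\<close> times the one without that term. As a function of \<open>v\<close> the diagonal
  entry is therefore a Moebius transform with coefficients that do not depend on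
  \<open>v\<close>.\<close>

lemma green_rank_one:
  assumes z: "Im z > 0" and x: "x \<in> S"
  shows "green S a (w(x := v)) z x x = 1 / (of_real v + 1 / green S a (w(x := 0)) z x x)"
proof -
  let ?g = "green S a (w(x := v)) z x" and ?h = "green S a (w(x := 0)) z x"
  have h0: "?h x \<noteq> 0" using Im_green_pos[OF z x, of "w(x := 0)"] by (metis less_irrefl zero_complex.sel(2))
  have g0: "?g x \<noteq> 0" using Im_green_pos[OF z x, of "w(x := v)"] by (metis less_irrefl zero_complex.sel(2))
  define c where "c = 1 - of_real v * ?g x"
  have eq: "hop S a (w(x := 0)) ?g y - z * ?g y = (if y = x then c else 0)" if "y \<in> S" for y
    using green_eq(1)[OF z x that, of "w(x := v)"] by (auto simp: hop_def c_def algebra_simps)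
  have c: "?g y = c * ?h y" if y: "y \<in> S" for y
  proof -
    let ?d = "\<lambda>y. ?g y - c * ?h y"
    have "Im z * l2 S ?d \<le> l2 S (\<lambda>y. hop S a (w(x := 0)) ?d y - z * ?d y)" by (rule l2_lower) fact
    also have "\<dots> = l2 S (\<lambda>_. 0)"
    proof (rule l2_cong)
      fix y assume y: "y \<in> S"
      have "hop S a (w(x := 0)) ?d y - z * ?d y =
          (hop S a (w(x := 0)) ?g y - z * ?g y) - c * (hop S a (w(x := 0)) ?h y - z * ?h y)"
        by (simp add: hop_diff hop_scale algebra_simps)
      also have "\<dots> = 0" using eq[OF y] green_eq(1)[OF z x y, of "w(x := 0)"] by simp
      finally show "cmod (hop S a (w(x := 0)) ?d y - z * ?d y) = cmod 0" by simp
    qed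
    finally have "l2 S ?d \<le> 0" using z by (simp add: l2_def L2_set_def mult_le_0_iff)
    from l2_eq_0[OF fin this y] show ?thesis by simp
  qed
  have "?g x * (of_real v + 1 / ?h x) = 1"
  proof -
    have "?g x / ?h x = c" using c[OF x] h0 by (simp add: field_simps)
    then show ?thesis by (simp add: c_def algebra_simps)
  qed
  then show ?thesis
    by (metis mult_zero_right nonzero_eq_divide_eq zero_neq_one)
qed

end

section \<open>Spectral theorem for real symmetric matrices, multiplicities included\<close>

definition rop :: "nat set \<Rightarrow> (nat \<Rightarrow> nat \<Rightarrow> real) \<Rightarrow> (nat \<Rightarrow> real) \<Rightarrow> (nat \<Rightarrow> real) \<Rightarrow> nat \<Rightarrow> real" where
  "rop S a w v x = (\<Sum>y\<in>S. a x y * v y) + w x * v x"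

lemma (in symker) rop_self_adjoint: "(\<Sum>x\<in>S. v x * rop S a w u x) = (\<Sum>x\<in>S. rop S a w v x * u x)"
proof -
  have "(\<Sum>x\<in>S. v x * (\<Sum>y\<in>S. a x y * u y)) = (\<Sum>x\<in>S. \<Sum>y\<in>S. v x * a x y * u y)"
    by (simp add: sum_distrib_left ac_simps)
  also have "\<dots> = (\<Sum>y\<in>S. \<Sum>x\<in>S. v x * a x y * u y)" by (rule sum.swap)
  also have "\<dots> = (\<Sum>y\<in>S. (\<Sum>x\<in>S. a y x * v x) * u y)"
    unfolding sum_distrib_right by (intro sum.cong refl) (use sym in \<open>simp add: mult.commute\<close>)
  finally show ?thesis by (simp add: rop_def ring_distribs sum.distrib ac_simps)
qed

text \<open>Maximise the quadratic form on the unit sphere of the orthogonal complement of the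
  eigenvectors found so far. Self-adjointness keeps the complement invariant, so the residual
  \<open>r\<close> of the maximiser is an admissible direction, and the first variation along it
  forces \<open>r\<close> to vanish.\<close>

lemma (in symker) new_eigenvector:
  assumes T: "finite T" "card T < card S"
    and eig: "\<And>i x. i \<in> T \<Longrightarrow> x \<in> S \<Longrightarrow> rop S a w (u i) x = e i * u i x"
  shows "\<exists>v l. (\<Sum>x\<in>S. v x * v x) = 1 \<and> (\<forall>i\<in>T. (\<Sum>x\<in>S. u i x * v x) = 0) \<and>
    (\<forall>x\<in>S. rop S a w v x = l * v x)"
proof -
  \<comment> \<open>By Tychonoff, the functions with values in \<open>[-1, 1]\<close> that vanish
    off \<open>S\<close> form a compact set in the product topology; it contains the unit
    sphere.\<close>
  define K where "K = PiE UNIV (\<lambda>x. if x \<in> S then {-1..1::real} else {0})"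
  have "compact K"
  proof -
    have "compactin (product_topology (\<lambda>_. euclidean) UNIV) K"
      unfolding K_def compactin_PiE by auto
    then show ?thesis by (simp add: euclidean_product_topology)
  qed
  define C where "C = {v. (\<Sum>x\<in>S. v x * v x) = 1 \<and> (\<forall>i\<in>T. (\<Sum>x\<in>S. u i x * v x) = 0)}"
  have "closed C"
    unfolding C_def Ball_def
    by (intro closed_Collect_conj closed_Collect_all closed_Collect_imp closed_Collect_eq)
      (auto intro!: continuous_intros continuous_on_subset[OF continuous_on_product_coordinates])
  then have comp: "compact (K \<inter> C)" using \<open>compact K\<close> by (simp add: compact_Int_closed)
  define W where "W = {v. (\<forall>x. x \<notin> S \<longrightarrow> v x = 0) \<and> (\<forall>i\<in>T. (\<Sum>x\<in>S. u i x * v x) = 0)}"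
  have norm: "(\<lambda>x. v x / sqrt (\<Sum>x\<in>S. v x * v x)) \<in> K \<inter> C" if v: "v \<in> W" "(\<Sum>x\<in>S. v x * v x) > 0" for v
  proof -
    define s where "s = sqrt (\<Sum>x\<in>S. v x * v x)"
    have s: "s > 0" "s * s = (\<Sum>x\<in>S. v x * v x)" using v by (auto simp: s_def)
    have "\<bar>v x\<bar> \<le> s" if "x \<in> S" for x
    proof -
      have "v x * v x \<le> (\<Sum>x\<in>S. v x * v x)" using that fin by (intro member_le_sum) auto
      then have "sqrt (v x * v x) \<le> s" unfolding s_def by (rule real_sqrt_le_mono)
      then show ?thesis by simp
    qed
    then have "(\<lambda>x. v x / s) \<in> K" using s v by (auto simp: K_def W_def field_simps PiE_iff abs_le_iff minus_le_iff)
    moreover have "(\<Sum>x\<in>S. v x / s * (v x / s)) = 1"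
      using s v(2) by (simp add: sum_divide_distrib[symmetric])
    moreover have "(\<Sum>x\<in>S. u i x * (v x / s)) = 0" if "i \<in> T" for i
      using that v by (simp add: sum_divide_distrib[symmetric] W_def)
    ultimately show ?thesis by (auto simp: C_def s_def)
  qed
  obtain c where c: "\<exists>i\<in>S. c i \<noteq> 0" "\<forall>i. i \<notin> S \<longrightarrow> c i = 0" "\<forall>t\<in>T. (\<Sum>i\<in>S. u t i * c i) = 0"
    using homogeneous_system_nontrivial[OF T(1) fin T(2), of u] by blast
  then have "c \<in> W" by (auto simp: W_def)
  moreover have "(\<Sum>x\<in>S. c x * c x) > 0"
  proof -
    obtain j where j: "j \<in> S" "c j \<noteq> 0" using c(1) by blast
    have "0 < c j * c j" using j by (auto simp: zero_less_mult_iff)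
    also have "\<dots> \<le> (\<Sum>x\<in>S. c x * c x)" using j fin by (intro member_le_sum) auto
    finally show ?thesis .
  qed
  ultimately have "K \<inter> C \<noteq> {}" using norm by blast
  define Q where "Q = (\<lambda>v. \<Sum>x\<in>S. v x * rop S a w v x)"
  have "continuous_on (K \<inter> C) Q"
    unfolding Q_def rop_def
    by (auto intro!: continuous_intros continuous_on_subset[OF continuous_on_product_coordinates])
  from continuous_attains_sup[OF comp \<open>K \<inter> C \<noteq> {}\<close> this] obtain v where
    v: "v \<in> K" "v \<in> C" and max: "\<And>y. y \<in> K \<inter> C \<Longrightarrow> Q y \<le> Q v" by blast
  have v0: "v x = 0" if "x \<notin> S" for x using v(1) that by (auto simp: K_def PiE_iff dest: spec[of _ x])
  define l where "l = Q v"
  have Qle: "Q y \<le> l * (\<Sum>x\<in>S. y x * y x)" if y: "y \<in> W" for y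
  proof (cases "(\<Sum>x\<in>S. y x * y x) > 0")
    case True
    define s where "s = sqrt (\<Sum>x\<in>S. y x * y x)"
    have s: "s > 0" "s * s = (\<Sum>x\<in>S. y x * y x)" using True by (auto simp: s_def)
    have "Q (\<lambda>x. y x / s) \<le> l" unfolding l_def s_def by (rule max) (use norm[OF y True] in simp)
    moreover have "Q (\<lambda>x. y x / s) = Q y / (s * s)"
      unfolding Q_def rop_def
      by (simp add: sum_divide_distrib[symmetric] add_divide_distrib[symmetric])
    ultimately show ?thesis using s True by (simp add: field_simps)
  next
    case False
    then have "(\<Sum>x\<in>S. y x * y x) = 0" using sum_nonneg[of S "\<lambda>x. y x * y x"] by auto
    then have "\<forall>x\<in>S. y x = 0" using fin by (simp add: sum_nonneg_eq_0_iff)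
    then show ?thesis by (simp add: Q_def)
  qed
  define r where "r = (\<lambda>x. if x \<in> S then rop S a w v x - l * v x else 0)"
  have rW: "r \<in> W"
  proof -
    have "(\<Sum>x\<in>S. u i x * r x) = 0" if i: "i \<in> T" for i
    proof -
      have o: "(\<Sum>x\<in>S. u i x * v x) = 0" using v(2) i by (simp add: C_def)
      have "(\<Sum>x\<in>S. u i x * r x) = (\<Sum>x\<in>S. u i x * rop S a w v x) - l * (\<Sum>x\<in>S. u i x * v x)"
        by (simp add: r_def algebra_simps sum_subtractf sum_distrib_left)
      also have "\<dots> = (\<Sum>x\<in>S. e i * (u i x * v x))"
        using eig[OF i] o by (simp add: rop_self_adjoint mult.assoc)
      also have "\<dots> = 0" using o by (simp add: sum_distrib_left[symmetric])
      finally show ?thesis .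
    qed
    then show ?thesis by (auto simp: W_def r_def)
  qed
  define R where "R = (\<Sum>x\<in>S. r x * r x)"
  define P where "P = Q r - l * R"
  \<comment> \<open>Comparing the form at \<open>v + t * r\<close> with its maximum, the terms with
    the inner product of \<open>r\<close> and \<open>v\<close> cancel; there remains a quadratic in
    \<open>t\<close> whose linear coefficient is twice the squared norm of \<open>r\<close>.\<close>
  have key: "2 * t * R + t * t * P \<le> 0" for t
  proof -
    let ?y = "\<lambda>x. v x + t * r x"
    have "?y \<in> W" using rW v v0
      by (auto simp: W_def C_def ring_distribs sum.distrib mult.left_commute[of _ t] sum_distrib_left[symmetric])
    then have *: "Q ?y \<le> l * (\<Sum>x\<in>S. ?y x * ?y x)" by (rule Qle)
    have sq: "(\<Sum>x\<in>S. ?y x * ?y x) = 1 + 2 * t * (\<Sum>x\<in>S. r x * v x) + t * t * R"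
    proof -
      have "(\<Sum>x\<in>S. ?y x * ?y x) = (\<Sum>x\<in>S. v x * v x) + 2 * t * (\<Sum>x\<in>S. r x * v x) + t * t * R"
        unfolding R_def by (simp add: algebra_simps sum.distrib sum_distrib_left)
      then show ?thesis using v(2) by (simp add: C_def)
    qed
    have rl: "rop S a w ?y x = rop S a w v x + t * rop S a w r x" for x
      by (simp add: rop_def algebra_simps sum.distrib sum_distrib_left)
    have "Q ?y = Q v + t * (\<Sum>x\<in>S. r x * rop S a w v x) + t * (\<Sum>x\<in>S. v x * rop S a w r x) + t * t * Q r"
      unfolding Q_def rl by (simp add: algebra_simps sum.distrib sum_distrib_left)
    also have "(\<Sum>x\<in>S. v x * rop S a w r x) = (\<Sum>x\<in>S. r x * rop S a w v x)"
      by (subst rop_self_adjoint) (simp add: mult.commute)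
    also have "(\<Sum>x\<in>S. r x * rop S a w v x) = R + l * (\<Sum>x\<in>S. r x * v x)"
      unfolding R_def sum_distrib_left sum.distrib[symmetric]
      by (intro sum.cong) (auto simp: r_def algebra_simps)
    finally show ?thesis using * unfolding sq P_def l_def[symmetric] by (simp add: algebra_simps)
  qed
  have "R = 0"
  proof (rule ccontr)
    assume "R \<noteq> 0"
    moreover have "R \<ge> 0" unfolding R_def by (intro sum_nonneg) simp
    ultimately have R: "R > 0" by simp
    \<comment> \<open>Small enough for \<open>t * \<bar>P\<bar>\<close> to stay below
      \<open>R\<close>, so the quadratic term cannot outweigh \<open>2 * t * R\<close>.\<close>
    define t where "t = R / (\<bar>P\<bar> + 1)"
    have t: "t > 0" using R by (simp add: t_def)
    have "t * (2 * R + t * P) \<le> 0" using key[of t] by (simp add: algebra_simps)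
    then have "2 * R + t * P \<le> 0" using t by (simp add: mult_le_0_iff)
    moreover have "- (t * P) \<le> R"
    proof -
      have "- (t * P) \<le> t * \<bar>P\<bar>" using t by (metis abs_ge_minus_self abs_mult abs_of_pos)
      also have "\<dots> \<le> t * (\<bar>P\<bar> + 1)" using t by simp
      also have "\<dots> = R" by (simp add: t_def)
      finally show ?thesis .
    qed
    ultimately show False using R by linarith
  qed
  then have "\<forall>x\<in>S. r x = 0" using fin by (simp add: R_def sum_nonneg_eq_0_iff)
  then have "\<forall>x\<in>S. rop S a w v x = l * v x" by (auto simp: r_def)
  then show ?thesis using v(2) by (auto simp: C_def intro!: exI[of _ v] exI[of _ l])
qed

lemma (in symker) orthonormal_eigensystem:
  "m \<le> card S \<Longrightarrow> \<exists>u e. (\<forall>i<m. \<forall>j<m. (\<Sum>x\<in>S. u i x * u j x) = (if i = j then 1 else 0)) \<and>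
     (\<forall>i<m. \<forall>x\<in>S. rop S a w (u i) x = e i * u i x)"
proof (induction m)
  case 0
  then show ?case by simp
next
  case (Suc m)
  then obtain u e where "(\<forall>i<m. \<forall>j<m. (\<Sum>x\<in>S. u i x * u j x) = (if i = j then 1 else 0)) \<and>
     (\<forall>i<m. \<forall>x\<in>S. rop S a w (u i) x = e i * u i x)" using Suc_leD by blast
  then have ue: "\<And>i j. i < m \<Longrightarrow> j < m \<Longrightarrow> (\<Sum>x\<in>S. u i x * u j x) = (if i = j then 1 else 0)"
     "\<And>i x. i < m \<Longrightarrow> x \<in> S \<Longrightarrow> rop S a w (u i) x = e i * u i x" by auto
  have "\<exists>v l. (\<Sum>x\<in>S. v x * v x) = 1 \<and> (\<forall>i\<in>{..<m}. (\<Sum>x\<in>S. u i x * v x) = 0) \<and>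
    (\<forall>x\<in>S. rop S a w v x = l * v x)"
    using Suc.prems ue(2) by (intro new_eigenvector[of _ w u e]) auto
  then obtain v l where "(\<Sum>x\<in>S. v x * v x) = 1 \<and> (\<forall>i\<in>{..<m}. (\<Sum>x\<in>S. u i x * v x) = 0) \<and>
    (\<forall>x\<in>S. rop S a w v x = l * v x)" by blast
  then have v: "(\<Sum>x\<in>S. v x * v x) = 1" "\<And>i. i < m \<Longrightarrow> (\<Sum>x\<in>S. u i x * v x) = 0"
      "\<And>x. x \<in> S \<Longrightarrow> rop S a w v x = l * v x" by auto
  have v': "(\<Sum>x\<in>S. v x * u i x) = 0" if "i < m" for i using v(2)[OF that] by (simp add: mult.commute)
  show ?case
    using ue v v' by (intro exI[of _ "u(m := v)"] exI[of _ "e(m := l)"]) (auto simp: less_Suc_eq)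
qed

definition Hm :: "nat \<Rightarrow> (nat \<Rightarrow> nat \<Rightarrow> real) \<Rightarrow> (nat \<Rightarrow> real) \<Rightarrow> real mat" where
  "Hm N a w = mat N N (\<lambda>(i, j). a i j + (if i = j then w i else 0))"

lemma Hm_carrier [simp]: "Hm N a w \<in> carrier_mat N N"
  and Hm_dim [simp]: "dim_row (Hm N a w) = N" "dim_col (Hm N a w) = N"
  by (simp_all add: Hm_def)

text \<open>Orthonormality serves norms, completeness serves expansions. The last clause ties the
  indexed eigenvalues to the multiset of roots through which the counts are defined, so
  multiplicities agree.\<close>

definition eigensystem where
  "eigensystem N a w u e \<longleftrightarrow>
    (\<forall>i<N. \<forall>j<N. (\<Sum>x<N. u i x * u j x) = (if i = j then 1 else 0)) \<and>
    (\<forall>x<N. \<forall>y<N. (\<Sum>i<N. u i x * u i y) = (if x = y then 1 else 0)) \<and>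
    (\<forall>i<N. \<forall>x<N. rop {..<N} a w (u i) x = e i * u i x) \<and>
    proots (char_poly (Hm N a w)) = image_mset e (mset_set {..<N})"

text \<open>A one-sided inverse of a square matrix is two-sided, so orthonormal rows of
  \<open>U\<close> are complete. Similarity to the diagonal matrix then identifies the
  characteristic polynomial.\<close>

theorem spectral_theorem:
  assumes "\<And>x y. x < N \<Longrightarrow> y < N \<Longrightarrow> a x y = a y x"
  shows "\<exists>u e. eigensystem N a w u e"
proof -
  interpret symker "{..<N}" a using assms by unfold_locales auto
  obtain u e where "(\<forall>i<N. \<forall>j<N. (\<Sum>x<N. u i x * u j x) = (if i = j then 1 else 0)) \<and>
     (\<forall>i<N. \<forall>x\<in>{..<N}. rop {..<N} a w (u i) x = e i * u i x)"
    using orthonormal_eigensystem[of N w, unfolded card_lessThan, OF order_refl] by blast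
  then have on: "\<And>i j. i < N \<Longrightarrow> j < N \<Longrightarrow> (\<Sum>x<N. u i x * u j x) = (if i = j then 1 else 0)"
     and eig: "\<And>i x. i < N \<Longrightarrow> x < N \<Longrightarrow> rop {..<N} a w (u i) x = e i * u i x" by auto
  define U where "U = mat N N (\<lambda>(i, x). u i x)"
  define D where "D = mat N N (\<lambda>(i, j). if i = j then e i else 0)"
  have U: "U \<in> carrier_mat N N" "transpose_mat U \<in> carrier_mat N N" by (auto simp: U_def)
  have D: "D \<in> carrier_mat N N" by (auto simp: D_def)
  have UU: "U * transpose_mat U = 1\<^sub>m N"
    by (rule eq_matI) (auto simp: U_def scalar_prod_def on atLeast0LessThan)
  then have UU': "transpose_mat U * U = 1\<^sub>m N"
    using mat_mult_left_right_inverse U by blast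
  have complete: "(\<Sum>i<N. u i x * u i y) = (if x = y then 1 else 0)" if "x < N" "y < N" for x y
  proof -
    have "(transpose_mat U * U) $$ (x, y) = (\<Sum>i<N. u i x * u i y)"
      using that by (auto simp: U_def scalar_prod_def atLeast0LessThan)
    then show ?thesis using UU' that by simp
  qed
  have AU: "Hm N a w * transpose_mat U = transpose_mat U * D"
  proof (rule eq_matI)
    fix x i assume "x < dim_row (transpose_mat U * D)" "i < dim_col (transpose_mat U * D)"
    then have xi: "x < N" "i < N" using U D by auto
    have "(Hm N a w * transpose_mat U) $$ (x, i) = (\<Sum>y<N. (a x y + (if x = y then w x else 0)) * u i y)"
      using xi by (simp add: Hm_def U_def scalar_prod_def atLeast0LessThan)
    also have "\<dots> = (\<Sum>y<N. a x y * u i y) + (\<Sum>y<N. if x = y then w x * u i x else 0)"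
      unfolding sum.distrib[symmetric] by (intro sum.cong) (auto simp: algebra_simps)
    also have "\<dots> = rop {..<N} a w (u i) x" using xi by (simp add: rop_def)
    also have "\<dots> = u i x * e i" using eig xi by simp
    also have "\<dots> = (\<Sum>j<N. if j = i then u j x * e i else 0)" using xi by simp
    also have "\<dots> = (\<Sum>j<N. u j x * (if j = i then e j else 0))" by (intro sum.cong) auto
    also have "\<dots> = (transpose_mat U * D) $$ (x, i)"
      using xi by (simp add: D_def U_def scalar_prod_def atLeast0LessThan)
    finally show "(Hm N a w * transpose_mat U) $$ (x, i) = (transpose_mat U * D) $$ (x, i)" .
  qed (use U D in auto)
  have "Hm N a w = Hm N a w * (transpose_mat U * U)" unfolding UU' by simp
  also have "\<dots> = transpose_mat U * D * U"
    using assoc_mult_mat[OF Hm_carrier U(2) U(1)] AU by metis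
  finally have "similar_mat_wit (Hm N a w) D (transpose_mat U) U"
    using U D UU UU' by (intro similar_mat_witI) auto
  then have "char_poly (Hm N a w) = char_poly D"
    by (intro char_poly_similar) (auto simp: similar_mat_def)
  also have "\<dots> = (\<Prod>a\<leftarrow>diag_mat D. [:- a, 1:])"
    by (rule char_poly_upper_triangular[OF D]) (auto simp: D_def)
  also have "diag_mat D = map e [0..<N]" by (auto simp: diag_mat_def D_def)
  also have "(\<Prod>a\<leftarrow>map e [0..<N]. [:- a, 1:]) = (\<Prod>i<N. [:- e i, 1:])"
    by (simp add: prod.distinct_set_conv_list[symmetric] comp_def atLeast0LessThan)
  finally have "proots (char_poly (Hm N a w)) = (\<Sum>i<N. {#e i#})"
    by (simp add: proots_prod)
  also have "\<dots> = image_mset e (mset_set {..<N})"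
    by (induction N) (simp_all add: lessThan_Suc)
  finally show ?thesis unfolding eigensystem_def using on eig complete by blast
qed

section \<open>Eigenvalue counts: Weyl's inequality and rank-one interlacing\<close>

definition cnt :: "nat \<Rightarrow> (nat \<Rightarrow> nat \<Rightarrow> real) \<Rightarrow> (nat \<Rightarrow> real) \<Rightarrow> real set \<Rightarrow> nat" where
  "cnt N a w A = size (filter_mset (\<lambda>t. t \<in> A) (proots (char_poly (Hm N a w))))"

lemma eigensystemD:
  assumes "eigensystem N a w u e"
  shows "i < N \<Longrightarrow> j < N \<Longrightarrow> (\<Sum>x<N. u i x * u j x) = (if i = j then 1 else 0)"
    and "x < N \<Longrightarrow> y < N \<Longrightarrow> (\<Sum>i<N. u i x * u i y) = (if x = y then 1 else 0)"
    and "i < N \<Longrightarrow> x < N \<Longrightarrow> rop {..<N} a w (u i) x = e i * u i x"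
    and "proots (char_poly (Hm N a w)) = image_mset e (mset_set {..<N})"
  using assms unfolding eigensystem_def by blast+

lemma cnt_eigensystem:
  assumes "eigensystem N a w u e"
  shows "cnt N a w A = card {i. i < N \<and> e i \<in> A}"
proof -
  have "cnt N a w A = size (filter_mset (\<lambda>i. e i \<in> A) (mset_set {..<N}))"
    unfolding cnt_def eigensystemD(4)[OF assms] by (simp add: filter_mset_image_mset)
  also have "\<dots> = card {i \<in> {..<N}. e i \<in> A}" by simp
  finally show ?thesis by simp
qed

lemma parseval:
  assumes "eigensystem N a w u e"
  shows "(\<Sum>x<N. (\<Sum>i<N. c i * u i x)\<^sup>2) = (\<Sum>i<N. (c i)\<^sup>2)"
proof -
  have "(\<Sum>x<N. (\<Sum>i<N. c i * u i x)\<^sup>2) = (\<Sum>x<N. \<Sum>i<N. \<Sum>j<N. c i * c j * (u i x * u j x))"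
    by (simp add: power2_eq_square sum_product ac_simps)
  also have "\<dots> = (\<Sum>i<N. \<Sum>x<N. \<Sum>j<N. c i * c j * (u i x * u j x))" by (rule sum.swap)
  also have "\<dots> = (\<Sum>i<N. \<Sum>j<N. \<Sum>x<N. c i * c j * (u i x * u j x))"
    by (intro sum.cong refl sum.swap)
  also have "\<dots> = (\<Sum>i<N. \<Sum>j<N. c i * c j * (\<Sum>x<N. u i x * u j x))"
    by (simp add: sum_distrib_left)
  also have "\<dots> = (\<Sum>i<N. \<Sum>j<N. if j = i then c i * c i else 0)"
    by (intro sum.cong refl) (auto simp: eigensystemD(1)[OF assms])
  also have "\<dots> = (\<Sum>i<N. (c i)\<^sup>2)" by (simp add: power2_eq_square)
  finally show ?thesis .
qed

lemma eigen_expansion: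
  assumes "eigensystem N a w u e" "x < N"
  shows "v x = (\<Sum>i<N. (\<Sum>y<N. u i y * v y) * u i x)"
proof -
  have "(\<Sum>i<N. (\<Sum>y<N. u i y * v y) * u i x) = (\<Sum>i<N. \<Sum>y<N. v y * (u i x * u i y))"
    unfolding sum_distrib_right by (intro sum.cong refl) (simp add: ac_simps)
  also have "\<dots> = (\<Sum>y<N. \<Sum>i<N. v y * (u i x * u i y))" by (rule sum.swap)
  also have "\<dots> = (\<Sum>y<N. v y * (\<Sum>i<N. u i x * u i y))" by (simp add: sum_distrib_left)
  also have "\<dots> = (\<Sum>y<N. if y = x then v y else 0)"
    by (intro sum.cong refl) (auto simp: eigensystemD(2)[OF assms(1) assms(2)])
  also have "\<dots> = v x" using assms(2) by simp
  finally show ?thesis by simp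
qed

lemma rop_sum: "rop S a w (\<lambda>x. \<Sum>i\<in>I. c i * u i x) x = (\<Sum>i\<in>I. c i * rop S a w (u i) x)"
proof -
  have "(\<Sum>y\<in>S. a x y * (\<Sum>i\<in>I. c i * u i y)) = (\<Sum>y\<in>S. \<Sum>i\<in>I. c i * (a x y * u i y))"
    by (simp add: sum_distrib_left ac_simps)
  also have "\<dots> = (\<Sum>i\<in>I. \<Sum>y\<in>S. c i * (a x y * u i y))" by (rule sum.swap)
  finally show ?thesis
    by (simp add: rop_def sum.distrib ring_distribs sum_distrib_left ac_simps)
qed

lemma rop_cong: "(\<And>y. y \<in> S \<Longrightarrow> v y = v' y) \<Longrightarrow> x \<in> S \<Longrightarrow> rop S a w v x = rop S a w v' x"
  by (simp add: rop_def cong: sum.cong)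

text \<open>A spectral subspace of the first operator larger than that of the second one, even after
  imposing the constraints, contains a vector on which the two operators contradict each other.\<close>
lemma cnt_compare:
  fixes c :: "'t \<Rightarrow> nat \<Rightarrow> real"
  assumes sym: "\<And>x y. x < N \<Longrightarrow> y < N \<Longrightarrow> a x y = a y x" "\<And>x y. x < N \<Longrightarrow> y < N \<Longrightarrow> a' x y = a' y x"
    and T: "finite T" and r: "r \<ge> 0" and d: "d \<ge> 0"
    and close: "\<And>v. (\<forall>t\<in>T. (\<Sum>x<N. c t x * v x) = 0) \<Longrightarrow>
        L2_set (\<lambda>x. rop {..<N} a' w' v x - rop {..<N} a w v x) {..<N} \<le> d * L2_set v {..<N}"
  shows "cnt N a w {E - r..E + r} \<le> cnt N a' w' {E - r - d..E + r + d} + card T"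
proof (rule ccontr)
  obtain u e where ue: "eigensystem N a w u e" using spectral_theorem[of N a w] sym(1) by blast
  obtain u' e' where ue': "eigensystem N a' w' u' e'" using spectral_theorem[of N a' w'] sym(2) by blast
  define I where "I = {i. i < N \<and> e i \<in> {E - r..E + r}}"
  define I' where "I' = {i. i < N \<and> e' i \<in> {E - r - d..E + r + d}}"
  have fin: "finite I" "finite I'" "I \<subseteq> {..<N}" "I' \<subseteq> {..<N}" by (auto simp: I_def I'_def)
  assume "\<not> ?thesis"
  then have card: "card I' + card T < card I"
    unfolding cnt_eigensystem[OF ue] cnt_eigensystem[OF ue'] I_def I'_def by simp
  \<comment> \<open>The unknowns are coefficients of \<open>v\<close> in the eigenvectors indexed by
    \<open>I\<close>; the equations ask for orthogonality to the second operator's eigenvectors in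
    \<open>I'\<close> and for the constraints in \<open>T\<close>.\<close>
  define m where "m = (\<lambda>k i. case k of Inl j \<Rightarrow> (\<Sum>x<N. u' j x * u i x) | Inr t \<Rightarrow> (\<Sum>x<N. c t x * u i x))"
  have "card (I' <+> T) < card I" using card fin T by (simp add: card_Plus)
  moreover have "finite (I' <+> T)" using fin T by simp
  ultimately obtain b where b0: "(\<exists>i\<in>I. b i \<noteq> 0) \<and> (\<forall>i. i \<notin> I \<longrightarrow> b i = 0) \<and>
    (\<forall>k \<in> I' <+> T. (\<Sum>i\<in>I. m k i * b i) = 0)"
    using homogeneous_system_nontrivial[of "I' <+> T" I m] fin by blast
  then have b: "\<exists>i\<in>I. b i \<noteq> 0" "\<forall>i. i \<notin> I \<longrightarrow> b i = 0"
    "\<And>k. k \<in> I' <+> T \<Longrightarrow> (\<Sum>i\<in>I. m k i * b i) = 0" by blast+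
  have bI: "(\<Sum>i\<in>I. f i * b i) = (\<Sum>i<N. f i * b i)" for f :: "nat \<Rightarrow> real"
    using b(2) fin by (intro sum.mono_neutral_left) auto
  define v where "v = (\<lambda>x. \<Sum>i<N. b i * u i x)"
  have pair: "(\<Sum>i\<in>I. (\<Sum>x<N. f x * u i x) * b i) = (\<Sum>x<N. f x * v x)" for f
  proof -
    have "(\<Sum>i\<in>I. (\<Sum>x<N. f x * u i x) * b i) = (\<Sum>i<N. (\<Sum>x<N. f x * u i x) * b i)" by (rule bI)
    also have "\<dots> = (\<Sum>x<N. \<Sum>i<N. f x * u i x * b i)"
      unfolding sum_distrib_right by (rule sum.swap)
    also have "\<dots> = (\<Sum>x<N. f x * v x)" unfolding v_def sum_distrib_left by (simp add: ac_simps)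
    finally show ?thesis .
  qed
  have orth: "(\<Sum>x<N. u' j x * v x) = 0" if "j \<in> I'" for j
    using b(3)[of "Inl j"] that pair[of "u' j"] by (auto simp: m_def)
  have constr: "(\<Sum>x<N. c t x * v x) = 0" if "t \<in> T" for t
    using b(3)[of "Inr t"] that pair[of "c t"] by (auto simp: m_def)
  have nv: "(\<Sum>x<N. (v x)\<^sup>2) = (\<Sum>i<N. (b i)\<^sup>2)" unfolding v_def by (rule parseval[OF ue])
  have nv_pos: "(\<Sum>x<N. (v x)\<^sup>2) > 0"
  proof -
    obtain j where j: "j \<in> I" "b j \<noteq> 0" using b(1) by blast
    have "0 < (b j)\<^sup>2" using j by simp
    also have "\<dots> \<le> (\<Sum>i<N. (b i)\<^sup>2)" using j fin by (intro member_le_sum) auto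
    finally show ?thesis unfolding nv .
  qed
  have up: "L2_set (\<lambda>x. rop {..<N} a w v x - E * v x) {..<N} \<le> r * L2_set v {..<N}"
  proof -
    have "(\<Sum>x<N. (rop {..<N} a w v x - E * v x)\<^sup>2) = (\<Sum>x<N. (\<Sum>i<N. (b i * (e i - E)) * u i x)\<^sup>2)"
    proof (intro sum.cong refl arg_cong[where f="\<lambda>x. x\<^sup>2"])
      fix x assume "x \<in> {..<N}"
      then show "rop {..<N} a w v x - E * v x = (\<Sum>i<N. (b i * (e i - E)) * u i x)"
        unfolding v_def rop_sum
        by (simp add: eigensystemD(3)[OF ue] sum_subtractf[symmetric] sum_distrib_left algebra_simps)
    qed
    also have "\<dots> = (\<Sum>i<N. (b i * (e i - E))\<^sup>2)" by (rule parseval[OF ue])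
    also have "\<dots> \<le> (\<Sum>i<N. r\<^sup>2 * (b i)\<^sup>2)"
    proof (rule sum_mono)
      fix i assume "i \<in> {..<N}"
      show "(b i * (e i - E))\<^sup>2 \<le> r\<^sup>2 * (b i)\<^sup>2"
      proof (cases "i \<in> I")
        case True
        then have "\<bar>e i - E\<bar> \<le> r" by (auto simp: I_def)
        then have "(e i - E)\<^sup>2 \<le> r\<^sup>2" using r by (simp add: abs_le_square_iff[symmetric])
        then have "(b i)\<^sup>2 * (e i - E)\<^sup>2 \<le> (b i)\<^sup>2 * r\<^sup>2" by (intro mult_left_mono) auto
        then show ?thesis by (simp add: power_mult_distrib mult.commute)
      qed (use b(2) in simp)
    qed
    also have "\<dots> = r\<^sup>2 * (\<Sum>x<N. (v x)\<^sup>2)" by (simp add: nv sum_distrib_left)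
    finally have "sqrt (\<Sum>x<N. (rop {..<N} a w v x - E * v x)\<^sup>2) \<le> sqrt (r\<^sup>2 * (\<Sum>x<N. (v x)\<^sup>2))"
      by (rule real_sqrt_le_mono)
    then show ?thesis using r by (simp add: L2_set_def real_sqrt_mult)
  qed
  define b' where "b' = (\<lambda>j. \<Sum>y<N. u' j y * v y)"
  have nv': "(\<Sum>x<N. (v x)\<^sup>2) = (\<Sum>i<N. (b' i)\<^sup>2)"
  proof -
    have "(\<Sum>x<N. (v x)\<^sup>2) = (\<Sum>x<N. (\<Sum>i<N. b' i * u' i x)\<^sup>2)"
      unfolding b'_def by (intro sum.cong refl) (subst eigen_expansion[OF ue', of _ v], auto)
    also have "\<dots> = (\<Sum>i<N. (b' i)\<^sup>2)" by (rule parseval[OF ue'])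
    finally show ?thesis .
  qed
  \<comment> \<open>Orthogonality to \<open>I'\<close> leaves only eigenvalues of the second
    operator at distance more than \<open>r + d\<close> from \<open>E\<close>. The inequality is
    strict because \<open>v\<close> is nonzero, and this strictness contradicts the upper
    bound.\<close>
  have low: "L2_set (\<lambda>x. rop {..<N} a' w' v x - E * v x) {..<N} > (r + d) * L2_set v {..<N}"
  proof -
    have eqv: "v x = (\<Sum>i<N. b' i * u' i x)" if "x < N" for x
      unfolding b'_def by (rule eigen_expansion[OF ue' that])
    have "(\<Sum>x<N. (rop {..<N} a' w' v x - E * v x)\<^sup>2) = (\<Sum>x<N. (\<Sum>i<N. (b' i * (e' i - E)) * u' i x)\<^sup>2)"
    proof (intro sum.cong refl arg_cong[where f="\<lambda>x. x\<^sup>2"])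
      fix x assume x: "x \<in> {..<N}"
      have "rop {..<N} a' w' v x = rop {..<N} a' w' (\<lambda>x. \<Sum>i<N. b' i * u' i x) x"
        using eqv x by (intro rop_cong) auto
      then have "rop {..<N} a' w' v x - E * v x =
         rop {..<N} a' w' (\<lambda>x. \<Sum>i<N. b' i * u' i x) x - E * (\<Sum>i<N. b' i * u' i x)"
        using eqv x by simp
      also have "\<dots> = (\<Sum>i<N. (b' i * (e' i - E)) * u' i x)"
        unfolding rop_sum using x
        by (simp add: eigensystemD(3)[OF ue'] sum_subtractf[symmetric] sum_distrib_left algebra_simps)
      finally show "rop {..<N} a' w' v x - E * v x = (\<Sum>i<N. (b' i * (e' i - E)) * u' i x)" .
    qed
    also have "\<dots> = (\<Sum>i<N. (b' i * (e' i - E))\<^sup>2)" by (rule parseval[OF ue'])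
    finally have eq: "(\<Sum>x<N. (rop {..<N} a' w' v x - E * v x)\<^sup>2) = (\<Sum>i<N. (b' i * (e' i - E))\<^sup>2)" .
    have le: "(r + d)\<^sup>2 * (b' i)\<^sup>2 \<le> (b' i * (e' i - E))\<^sup>2 \<and> (b' i \<noteq> 0 \<longrightarrow> (r + d)\<^sup>2 * (b' i)\<^sup>2 < (b' i * (e' i - E))\<^sup>2)"
      if i: "i < N" for i
    proof (cases "i \<in> I'")
      case True
      then show ?thesis using orth by (simp add: b'_def)
    next
      case False
      then have "\<bar>e' i - E\<bar> > r + d" using i by (auto simp: I'_def)
      then have lt: "(r + d)\<^sup>2 < (e' i - E)\<^sup>2" using r d
        by (metis abs_of_nonneg add_nonneg_nonneg linorder_not_less abs_le_square_iff)
      then have "(b' i)\<^sup>2 * (r + d)\<^sup>2 \<le> (b' i)\<^sup>2 * (e' i - E)\<^sup>2" by (intro mult_left_mono) auto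
      moreover have "(b' i)\<^sup>2 * (r + d)\<^sup>2 < (b' i)\<^sup>2 * (e' i - E)\<^sup>2" if "b' i \<noteq> 0"
        using lt that by (intro mult_strict_left_mono) auto
      ultimately show ?thesis by (simp add: power_mult_distrib mult.commute)
    qed
    have "\<exists>i<N. b' i \<noteq> 0"
    proof (rule ccontr)
      assume "\<not> ?thesis"
      then have "(\<Sum>i<N. (b' i)\<^sup>2) = 0" by (intro sum.neutral) auto
      then show False using nv_pos nv' by simp
    qed
    then obtain i0 where i0: "i0 < N" "b' i0 \<noteq> 0" by blast
    have "(\<Sum>i<N. (r + d)\<^sup>2 * (b' i)\<^sup>2) < (\<Sum>i<N. (b' i * (e' i - E))\<^sup>2)"
      by (rule sum_strict_mono_ex1) (use le i0 in auto)
    then have "(r + d)\<^sup>2 * (\<Sum>x<N. (v x)\<^sup>2) < (\<Sum>x<N. (rop {..<N} a' w' v x - E * v x)\<^sup>2)"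
      unfolding eq nv' by (simp add: sum_distrib_left)
    then have "sqrt ((r + d)\<^sup>2 * (\<Sum>x<N. (v x)\<^sup>2)) < sqrt (\<Sum>x<N. (rop {..<N} a' w' v x - E * v x)\<^sup>2)"
      by (rule real_sqrt_less_mono)
    then show ?thesis using r d by (simp add: L2_set_def real_sqrt_mult)
  qed
  have "L2_set (\<lambda>x. rop {..<N} a' w' v x - E * v x) {..<N} =
     L2_set (\<lambda>x. (rop {..<N} a w v x - E * v x) + (rop {..<N} a' w' v x - rop {..<N} a w v x)) {..<N}"
    by (intro L2_set_cong) auto
  also have "\<dots> \<le> L2_set (\<lambda>x. rop {..<N} a w v x - E * v x) {..<N} +
      L2_set (\<lambda>x. rop {..<N} a' w' v x - rop {..<N} a w v x) {..<N}"
    by (rule L2_set_triangle_ineq)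
  also have "\<dots> \<le> r * L2_set v {..<N} + d * L2_set v {..<N}"
    using up close[of v] constr by auto
  finally show False using low by (simp add: algebra_simps)
qed

lemma interval_center: "(p + q) / 2 - (q - p) / 2 = p" "(p + q) / 2 + (q - p) / 2 = (q::real)"
  by (simp_all add: field_simps)

lemma cnt_empty [simp]: "cnt N a w {} = 0" by (simp add: cnt_def)

lemma size_filter_mset_mono:
  "(\<And>x. P x \<Longrightarrow> Q x) \<Longrightarrow> size (filter_mset P m) \<le> size (filter_mset Q m)"
  by (induction m) (auto intro: le_SucI)

lemma size_filter_mset_disj:
  "(\<And>x. \<not> (P x \<and> Q x)) \<Longrightarrow>
    size (filter_mset (\<lambda>x. P x \<or> Q x) m) = size (filter_mset P m) + size (filter_mset Q m)"
  by (induction m) auto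

lemma cnt_mono: "A \<subseteq> B \<Longrightarrow> cnt N a w A \<le> cnt N a w B"
  unfolding cnt_def by (rule size_filter_mset_mono) auto

lemma cnt_Un: "A \<inter> B = {} \<Longrightarrow> cnt N a w (A \<union> B) = cnt N a w A + cnt N a w B"
  unfolding cnt_def Un_iff by (rule size_filter_mset_disj) auto

lemma L2_set_abs: "L2_set (\<lambda>x. \<bar>f x\<bar>) S = L2_set f S"
  by (simp add: L2_set_def)

text \<open>\<open>cnt_compare\<close> without constraints; Schur's test turns the row sums of the
  difference of kernels into the norm bound \<open>d\<close>.\<close>

lemma cnt_weyl_kernel:
  assumes sym: "\<And>x y. x < N \<Longrightarrow> y < N \<Longrightarrow> a x y = a y x" "\<And>x y. x < N \<Longrightarrow> y < N \<Longrightarrow> a' x y = a' y x"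
    and row: "\<And>x. x < N \<Longrightarrow> (\<Sum>y<N. \<bar>a' x y - a x y\<bar>) \<le> d" and d: "d \<ge> 0"
  shows "cnt N a w {p..q} \<le> cnt N a' w {p - d..q + d}"
proof (cases "p \<le> q")
  case True
  have "cnt N a w {(p + q) / 2 - (q - p) / 2..(p + q) / 2 + (q - p) / 2} \<le>
     cnt N a' w {(p + q) / 2 - (q - p) / 2 - d..(p + q) / 2 + (q - p) / 2 + d} + card ({} :: nat set)"
  proof (rule cnt_compare[OF sym, where c = "\<lambda>_ _. 0"])
    fix v :: "nat \<Rightarrow> real"
    have "L2_set (\<lambda>x. rop {..<N} a' w v x - rop {..<N} a w v x) {..<N} =
       L2_set (\<lambda>x. \<Sum>y<N. (a' x y - a x y) * v y) {..<N}"
      by (intro L2_set_cong) (auto simp: rop_def algebra_simps sum_subtractf)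
    also have "\<dots> \<le> L2_set (\<lambda>x. \<Sum>y<N. \<bar>a' x y - a x y\<bar> * \<bar>v y\<bar>) {..<N}"
    proof (subst L2_set_abs[symmetric], rule L2_set_mono)
      fix x
      show "\<bar>\<Sum>y<N. (a' x y - a x y) * v y\<bar> \<le> (\<Sum>y<N. \<bar>a' x y - a x y\<bar> * \<bar>v y\<bar>)"
        by (rule order.trans[OF sum_abs]) (simp add: abs_mult)
    qed auto
    also have "\<dots> = l2 {..<N} (\<lambda>x. \<Sum>y<N. of_real \<bar>a' x y - a x y\<bar> * of_real \<bar>v y\<bar>)"
    proof -
      have "(\<Sum>y<N. complex_of_real \<bar>a' x y - a x y\<bar> * of_real \<bar>v y\<bar>) = of_real (\<Sum>y<N. \<bar>a' x y - a x y\<bar> * \<bar>v y\<bar>)" for x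
        by simp
      then show ?thesis unfolding l2_def by (simp only: norm_of_real L2_set_abs)
    qed
    also have "\<dots> \<le> d * l2 {..<N} (\<lambda>y. of_real \<bar>v y\<bar>)"
      by (rule schur_test) (use sym row d in auto)
    also have "l2 {..<N} (\<lambda>y. of_real \<bar>v y\<bar>) = L2_set v {..<N}" by (simp add: l2_def L2_set_abs)
    finally show "L2_set (\<lambda>x. rop {..<N} a' w v x - rop {..<N} a w v x) {..<N} \<le> d * L2_set v {..<N}" .
  qed (use True d in auto)
  then show ?thesis unfolding interval_center by simp
qed auto

lemma cnt_weyl_potential:
  assumes sym: "\<And>x y. x < N \<Longrightarrow> y < N \<Longrightarrow> a x y = a y x"
    and w: "\<And>x. x < N \<Longrightarrow> \<bar>w' x - w x\<bar> \<le> d" and d: "d \<ge> 0"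
  shows "cnt N a w {p..q} \<le> cnt N a w' {p - d..q + d}"
proof (cases "p \<le> q")
  case True
  have "cnt N a w {(p + q) / 2 - (q - p) / 2..(p + q) / 2 + (q - p) / 2} \<le>
     cnt N a w' {(p + q) / 2 - (q - p) / 2 - d..(p + q) / 2 + (q - p) / 2 + d} + card ({} :: nat set)"
  proof (rule cnt_compare[OF sym sym, where c = "\<lambda>_ _. 0"])
    fix v :: "nat \<Rightarrow> real"
    have "L2_set (\<lambda>x. rop {..<N} a w' v x - rop {..<N} a w v x) {..<N} =
       L2_set (\<lambda>x. \<bar>w' x - w x\<bar> * \<bar>v x\<bar>) {..<N}"
      by (subst L2_set_abs[symmetric], intro L2_set_cong) (auto simp: rop_def algebra_simps simp flip: abs_mult)
    also have "\<dots> \<le> L2_set (\<lambda>x. d * \<bar>v x\<bar>) {..<N}"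
      by (intro L2_set_mono mult_right_mono) (use w in auto)
    also have "\<dots> = d * L2_set v {..<N}" using d by (simp add: L2_set_right_distrib[symmetric] L2_set_abs)
    finally show "L2_set (\<lambda>x. rop {..<N} a w' v x - rop {..<N} a w v x) {..<N} \<le> d * L2_set v {..<N}" .
  qed (use True d in auto)
  then show ?thesis unfolding interval_center by simp
qed auto

text \<open>On vectors that vanish at \<open>k\<close> the two operators coincide, so
  \<open>cnt_compare\<close> applies with \<open>d = 0\<close> and the single constraint
  \<open>v k = 0\<close>, which costs one eigenvalue whatever the new value \<open>t\<close>
  is.\<close>

lemma cnt_rank_one:
  assumes sym: "\<And>x y. x < N \<Longrightarrow> y < N \<Longrightarrow> a x y = a y x"
  shows "cnt N a w {p..q} \<le> cnt N a (w(k := t)) {p..q} + 1"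
proof (cases "p \<le> q")
  case True
  have "cnt N a w {(p + q) / 2 - (q - p) / 2..(p + q) / 2 + (q - p) / 2} \<le>
     cnt N a (w(k := t)) {(p + q) / 2 - (q - p) / 2 - 0..(p + q) / 2 + (q - p) / 2 + 0} + card {0 :: nat}"
  proof (rule cnt_compare[OF sym sym, where c = "\<lambda>_ x. if x = k then 1 else 0"])
    fix v :: "nat \<Rightarrow> real"
    assume v: "\<forall>s\<in>{0::nat}. (\<Sum>x<N. (if x = k then 1 else 0) * v x) = 0"
    have "(\<Sum>x<N. (if x = k then 1 else 0) * v x) = (\<Sum>x<N. if x = k then v x else 0)"
      by (intro sum.cong) auto
    with v have "k < N \<Longrightarrow> v k = 0" by simp
    then have "L2_set (\<lambda>x. rop {..<N} a (w(k := t)) v x - rop {..<N} a w v x) {..<N} = L2_set (\<lambda>_. 0) {..<N}"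
      by (intro L2_set_cong) (auto simp: rop_def)
    then show "L2_set (\<lambda>x. rop {..<N} a (w(k := t)) v x - rop {..<N} a w v x) {..<N} \<le> 0 * L2_set v {..<N}"
      by (simp add: L2_set_def)
  qed (use True in auto)
  then show ?thesis unfolding interval_center by simp
qed auto

section \<open>Eigenfunction expansion and trace of the Green's function\<close>

lemma green_eigensystem:
  assumes sym: "\<And>x y. x < N \<Longrightarrow> y < N \<Longrightarrow> a x y = a y x" and ue: "eigensystem N a w u e"
    and z: "Im z > 0" and x: "x < N"
  shows "green {..<N} a w z x x = (\<Sum>i<N. of_real ((u i x)\<^sup>2) / (of_real (e i) - z))"
proof -
  interpret symker "{..<N}" a using sym by unfold_locales auto
  have nz: "of_real s - z \<noteq> 0" for s using z by (auto simp: complex_eq_iff)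
  define \<psi> where "\<psi> = (\<lambda>y. \<Sum>i<N. of_real (u i x * u i y) / (of_real (e i) - z))"
  have hop_u: "hop {..<N} a w (\<lambda>y. of_real (u i y)) y = of_real (e i * u i y)" if "i < N" "y < N" for i y
    using eigensystemD(3)[OF ue that] by (simp add: hop_def rop_def flip: of_real_mult of_real_sum of_real_add)
  have lin: "hop {..<N} a w (\<lambda>y. \<Sum>i<M. f i y) y = (\<Sum>i<M. hop {..<N} a w (f i) y)" for M :: nat and f y
  proof (induction M)
    case 0
    then show ?case by (simp add: hop_def)
  qed (simp add: hop_add)
  have "green {..<N} a w z x x = \<psi> x"
  proof (rule green_unique[OF z])
    fix y assume y: "y \<in> {..<N}"
    have "hop {..<N} a w \<psi> y = (\<Sum>i<N. hop {..<N} a w (\<lambda>y. of_real (u i x) / (of_real (e i) - z) * of_real (u i y)) y)"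
      unfolding \<psi>_def lin[symmetric] by (simp add: ac_simps)
    also have "\<dots> = (\<Sum>i<N. of_real (u i x) / (of_real (e i) - z) * of_real (e i * u i y))"
      using y by (intro sum.cong refl) (auto simp only: hop_scale hop_u lessThan_iff)
    finally have "hop {..<N} a w \<psi> y - z * \<psi> y =
       (\<Sum>i<N. of_real (u i x) / (of_real (e i) - z) * of_real (e i * u i y) - z * (of_real (u i x * u i y) / (of_real (e i) - z)))"
      by (simp add: \<psi>_def sum_distrib_left sum_subtractf)
    also have "\<dots> = (\<Sum>i<N. of_real (u i x * u i y))"
    proof (intro sum.cong refl)
      fix i
      have eq: "p / d * (g * q) - z * (p * q / d) = p * q * ((g - z) / d)" for p q d g :: complex
        by (simp add: algebra_simps diff_divide_distrib)
      show "of_real (u i x) / (of_real (e i) - z) * of_real (e i * u i y) -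
          z * (of_real (u i x * u i y) / (of_real (e i) - z)) = of_real (u i x * u i y)"
        unfolding of_real_mult eq using nz by simp
    qed
    also have "\<dots> = of_real (\<Sum>i<N. u i x * u i y)" by simp
    also have "\<dots> = (if y = x then 1 else 0)" using eigensystemD(2)[OF ue x, of y] y by auto
    finally show "hop {..<N} a w \<psi> y - z * \<psi> y = (if y = x then 1 else 0)" .
  qed (use x in auto)
  then show ?thesis by (simp add: \<psi>_def power2_eq_square)
qed

lemma trace_green:
  assumes sym: "\<And>x y. x < N \<Longrightarrow> y < N \<Longrightarrow> a x y = a y x" and ue: "eigensystem N a w u e"
    and z: "Im z > 0"
  shows "(\<Sum>x<N. green {..<N} a w z x x) = (\<Sum>i<N. 1 / (of_real (e i) - z))"
proof -
  have "(\<Sum>x<N. green {..<N} a w z x x) = (\<Sum>x<N. \<Sum>i<N. of_real ((u i x)\<^sup>2) / (of_real (e i) - z))"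
    using green_eigensystem[OF sym ue z] by simp
  also have "\<dots> = (\<Sum>i<N. \<Sum>x<N. of_real ((u i x)\<^sup>2) / (of_real (e i) - z))" by (rule sum.swap)
  also have "\<dots> = (\<Sum>i<N. of_real (\<Sum>x<N. u i x * u i x) / (of_real (e i) - z))"
    by (simp add: sum_divide_distrib power2_eq_square)
  also have "\<dots> = (\<Sum>i<N. 1 / (of_real (e i) - z))"
    by (intro sum.cong refl) (simp only: eigensystemD(1)[OF ue] lessThan_iff if_True of_real_1 simp_thms)
  finally show ?thesis .
qed

section \<open>The Poisson kernel\<close>

text \<open>The Poisson kernel of the upper half-plane times \<open>pi\<close>. Without the
  normalisation it is exactly the imaginary part of a resolvent at \<open>Complex x y\<close>; this
  is the origin of the factors \<open>pi\<close> below.\<close>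

definition pker :: "real \<Rightarrow> real \<Rightarrow> real \<Rightarrow> real" where
  "pker y x t = y / ((t - x)\<^sup>2 + y\<^sup>2)"

lemma pker_nonneg: "y > 0 \<Longrightarrow> pker y x t \<ge> 0"
  by (simp add: pker_def)

lemma pker_commute: "pker y x t = pker y t x"
  by (simp add: pker_def power2_commute)

lemma Im_resolvent_kernel: "Im (1 / (complex_of_real t - Complex x y)) = pker y x t"
  by (simp add: pker_def Im_divide power2_eq_square)

lemma pker_measurable [measurable]: "pker y x \<in> borel_measurable borel"
  unfolding pker_def by measurable

text \<open>The indicator of a window of half-width \<open>y\<close> is dominated by the kernel at
  the same height \<open>y\<close>, so that eigenvalue counts can be bounded by traces of
  resolvents.\<close>

lemma pker_ge:
  assumes y: "y > 0" and t: "\<bar>t - x\<bar> \<le> y"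
  shows "1 \<le> 2 * y * pker y x t"
proof -
  have "(t - x)\<^sup>2 \<le> y\<^sup>2" using t y by (simp add: abs_le_square_iff[symmetric])
  moreover have "(t - x)\<^sup>2 + y\<^sup>2 > 0" using y by (simp add: add_nonneg_pos)
  ultimately show ?thesis unfolding pker_def by (simp add: field_simps power2_eq_square)
qed

text \<open>Homogeneity of degree -1: magnifying energies around \<open>e\<close> by
  \<open>N\<close> amounts to evaluating the transform at height \<open>y / N\<close> above
  \<open>e + x / N\<close>.\<close>

lemma pker_scale:
  assumes "N > 0"
  shows "pker (y / N) (e + x / N) t = N * pker y x (N * (t - e))"
proof -
  have "(t - (e + x / N))\<^sup>2 + (y / N)\<^sup>2 = ((N * (t - e) - x)\<^sup>2 + y\<^sup>2) / N\<^sup>2"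
    using assms by (simp add: field_simps power2_eq_square)
  then show ?thesis using assms by (simp add: pker_def power2_eq_square)
qed

lemma nn_integral_pker_Icc:
  assumes "y > 0" "a \<le> b"
  shows "(\<integral>\<^sup>+x. ennreal (pker y x t) * indicator {a..b} x \<partial>lborel) =
    ennreal (arctan ((b - t) / y) - arctan ((a - t) / y))"
proof (rule nn_integral_FTC_Icc)
  show "(\<lambda>x. pker y x t) \<in> borel_measurable borel" unfolding pker_def by measurable
  show "((\<lambda>x. arctan ((x - t) / y)) has_real_derivative pker y x t) (at x)" for x
  proof -
    have "inverse (1 + ((x - t) / y)\<^sup>2) * (1 / y) = pker y x t"
      using assms by (simp add: pker_def field_simps power2_eq_square)
    then show ?thesis by (auto intro!: derivative_eq_intros simp: divide_inverse)
  qed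
qed (use assms in \<open>auto simp: pker_nonneg\<close>)

lemma nn_integral_pker_le:
  assumes "y > 0"
  shows "(\<integral>\<^sup>+x. ennreal (pker y x t) \<partial>lborel) \<le> ennreal pi"
proof -
  let ?f = "\<lambda>i x. ennreal (pker y x t) * indicator {- real i..real i} x"
  have [measurable]: "(\<lambda>x. pker y x t) \<in> borel_measurable borel" unfolding pker_def by measurable
  have "(SUP i. ?f i x) = ennreal (pker y x t)" for x
  proof (rule antisym)
    show "(SUP i. ?f i x) \<le> ennreal (pker y x t)"
      by (intro SUP_least) (auto split: split_indicator)
    obtain i :: nat where "\<bar>x\<bar> \<le> real i" using real_arch_simple by blast
    then have "ennreal (pker y x t) = ?f i x" by (auto split: split_indicator)
    also have "\<dots> \<le> (SUP i. ?f i x)" by (rule SUP_upper) simp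
    finally show "ennreal (pker y x t) \<le> (SUP i. ?f i x)" .
  qed
  then have "(\<integral>\<^sup>+x. ennreal (pker y x t) \<partial>lborel) = (\<integral>\<^sup>+x. (SUP i. ?f i x) \<partial>lborel)" by simp
  also have "\<dots> = (SUP i. \<integral>\<^sup>+x. ?f i x \<partial>lborel)"
    by (rule nn_integral_monotone_convergence_SUP)
      (auto simp: incseq_def le_fun_def split: split_indicator)
  also have "\<dots> \<le> ennreal pi"
  proof (rule SUP_least)
    fix i :: nat
    have "arctan ((real i - t) / y) - arctan ((- real i - t) / y) \<le> pi"
      using arctan_ubound[of "(real i - t) / y"] arctan_lbound[of "(- real i - t) / y"] by linarith
    then show "(\<integral>\<^sup>+x. ?f i x \<partial>lborel) \<le> ennreal pi"
      using assms by (subst nn_integral_pker_Icc) (auto intro: ennreal_leI)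
  qed
  finally show ?thesis .
qed

lemma tendsto_arctan_inverse_nat:
  assumes "c > 0"
  shows "(\<lambda>j. arctan (c / (1 / real (Suc j)))) \<longlonglongrightarrow> pi / 2"
proof -
  have "filterlim (\<lambda>j. c * real (Suc j)) at_top sequentially"
    using assms
    by (intro filterlim_tendsto_pos_mult_at_top[OF tendsto_const]
        filterlim_compose[OF filterlim_real_sequentially filterlim_Suc])
  then have "(\<lambda>j. arctan (c * real (Suc j))) \<longlonglongrightarrow> pi / 2"
    by (rule filterlim_compose[OF tendsto_arctan_at_top])
  then show ?thesis by simp
qed

text \<open>Inversion of the Poisson transform: integrate the bound over an open set and let \<open>y \<down> 0\<close>.\<close>
lemma density_bound_of_poisson_bound:
  assumes sets [measurable_cong]: "sets \<mu> = sets borel" and fin: "finite_measure \<mu>" and B: "B \<ge> 0"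
    and bound: "\<And>x y. y > 0 \<Longrightarrow> (\<integral>\<^sup>+t. ennreal (pker y x t) \<partial>\<mu>) \<le> ennreal (pi * B)"
    and A: "A \<in> sets borel"
  shows "emeasure \<mu> A \<le> ennreal B * emeasure lborel A"
proof -
  interpret finite_measure \<mu> by fact
  interpret pair_sigma_finite \<mu> lborel ..
  have op: "emeasure \<mu> U \<le> ennreal B * emeasure lborel U" if U: "open U" for U
  proof -
    have [measurable]: "U \<in> sets borel" using U by simp
    define y where "y = (\<lambda>j. 1 / real (Suc j))"
    have y: "y j > 0" for j by (simp add: y_def)
    define g where "g = (\<lambda>j t. \<integral>\<^sup>+x. ennreal (pker (y j) x t) * indicator U x \<partial>lborel)"
    have gm [measurable]: "g j \<in> borel_measurable \<mu>" for j unfolding g_def pker_def by measurable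
    \<comment> \<open>A point of the open set \<open>U\<close> has an interval around it inside
      \<open>U\<close>, and the kernel's mass on that interval tends to \<open>pi\<close> as the
      height tends to zero. Fatou's lemma then bounds the measure of \<open>U\<close>.\<close>
    have low: "ennreal pi * indicator U t \<le> liminf (\<lambda>j. g j t)" for t
    proof (cases "t \<in> U")
      case True
      then obtain c where c: "c > 0" "cball t c \<subseteq> U" using U by (metis open_contains_cball)
      have "ennreal (2 * arctan (c / y j)) \<le> g j t" for j
      proof -
        have "ennreal (2 * arctan (c / y j)) =
            (\<integral>\<^sup>+x. ennreal (pker (y j) x t) * indicator {t - c..t + c} x \<partial>lborel)"
          using y[of j] c by (subst nn_integral_pker_Icc) (auto simp: arctan_minus)
        also have "\<dots> \<le> g j t"
          unfolding g_def using c(2)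
          by (intro nn_integral_mono mult_left_mono) (auto split: split_indicator simp: cball_eq_atLeastAtMost)
        finally show ?thesis .
      qed
      then have "liminf (\<lambda>j. ennreal (2 * arctan (c / y j))) \<le> liminf (\<lambda>j. g j t)"
        by (intro Liminf_mono) auto
      moreover have "(\<lambda>j. ennreal (2 * arctan (c / y j))) \<longlonglongrightarrow> ennreal (2 * (pi / 2))"
        unfolding y_def by (intro tendsto_ennrealI tendsto_intros tendsto_arctan_inverse_nat c)
      ultimately show ?thesis using True by (simp add: lim_imp_Liminf)
    qed simp
    have gle: "(\<integral>\<^sup>+t. g j t \<partial>\<mu>) \<le> ennreal (pi * B) * emeasure lborel U" for j
    proof -
      have "(\<integral>\<^sup>+t. g j t \<partial>\<mu>) = (\<integral>\<^sup>+x. (\<integral>\<^sup>+t. ennreal (pker (y j) x t) * indicator U x \<partial>\<mu>) \<partial>lborel)"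
        unfolding g_def by (rule Fubini'[symmetric]) (unfold pker_def, measurable)
      also have "\<dots> = (\<integral>\<^sup>+x. (\<integral>\<^sup>+t. ennreal (pker (y j) x t) \<partial>\<mu>) * indicator U x \<partial>lborel)"
        by (intro nn_integral_cong nn_integral_multc) measurable
      also have "\<dots> \<le> (\<integral>\<^sup>+x. ennreal (pi * B) * indicator U x \<partial>lborel)"
        by (intro nn_integral_mono mult_right_mono bound y) auto
      also have "\<dots> = ennreal (pi * B) * emeasure lborel U"
        by (simp add: nn_integral_cmult_indicator)
      finally show ?thesis .
    qed
    have "ennreal pi * emeasure \<mu> U = (\<integral>\<^sup>+t. ennreal pi * indicator U t \<partial>\<mu>)"
      by (simp add: nn_integral_cmult_indicator)
    also have "\<dots> \<le> (\<integral>\<^sup>+t. liminf (\<lambda>j. g j t) \<partial>\<mu>)" by (intro nn_integral_mono low)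
    also have "\<dots> \<le> liminf (\<lambda>j. \<integral>\<^sup>+t. g j t \<partial>\<mu>)" by (rule nn_integral_liminf) measurable
    also have "\<dots> \<le> liminf (\<lambda>j::nat. ennreal (pi * B) * emeasure lborel U)"
      by (intro Liminf_mono) (simp add: gle)
    also have "\<dots> = ennreal pi * (ennreal B * emeasure lborel U)"
      using B by (simp add: Liminf_const ennreal_mult mult.assoc)
    finally show ?thesis
      by (simp add: ennreal_mult_le_mult_iff)
  qed
  show ?thesis
  proof (cases "emeasure lborel A = \<infinity>")
    case True
    \<comment> \<open>An infinite factor makes the right-hand side infinite unless
      \<open>B = 0\<close>, where the product is zero; then the open set \<open>UNIV\<close> already
      shows that the measure vanishes.\<close>
    show ?thesis
    proof (cases "B = 0")
      case True
      have "emeasure \<mu> A \<le> emeasure \<mu> UNIV" by (intro emeasure_mono) auto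
      also have "\<dots> \<le> ennreal B * emeasure lborel (UNIV :: real set)" by (rule op) simp
      also have "\<dots> = 0" using True by simp
      finally show ?thesis by simp
    next
      case False
      then show ?thesis using True B by (simp add: ennreal_mult_top top_unique ennreal_eq_0_iff)
    qed
  next
    case False
    show ?thesis
    proof (rule ennreal_le_epsilon)
      fix d :: real assume d: "d > 0"
      \<comment> \<open>The denominator \<open>B + 1\<close> keeps the tolerance meaningful at
        \<open>B = 0\<close>.\<close>
      obtain U where U: "open U" "A \<subseteq> U" "emeasure lborel (U - A) < ennreal (d / (B + 1))"
        using outer_regular_lborel[OF A, of "d / (B + 1)"] d B by auto
      have "emeasure \<mu> A \<le> emeasure \<mu> U" using U A by (intro emeasure_mono) auto
      also have "\<dots> \<le> ennreal B * emeasure lborel U" by (rule op) fact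
      also have "emeasure lborel U = emeasure lborel A + emeasure lborel (U - A)"
        using U A by (subst plus_emeasure) (auto simp: Un_absorb1)
      also have "ennreal B * \<dots> \<le> ennreal B * (emeasure lborel A + ennreal (d / (B + 1)))"
        using U by (intro mult_left_mono add_left_mono) auto
      also have "\<dots> = ennreal B * emeasure lborel A + ennreal (B * (d / (B + 1)))"
        using B d by (simp only: distrib_left) (subst ennreal_mult, auto)
      also have "\<dots> \<le> ennreal B * emeasure lborel A + ennreal d"
        using B d by (intro add_left_mono ennreal_leI) (simp add: field_simps)
      finally show "emeasure \<mu> A \<le> ennreal B * emeasure lborel A + ennreal d" .
    qed
  qed
qed

lemma nn_integral_le_of_density_bound:
  assumes [measurable_cong]: "sets \<nu> = sets borel"
    and "\<And>A. A \<in> sets borel \<Longrightarrow> emeasure \<nu> A \<le> ennreal B * emeasure lborel A"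
    and [measurable]: "f \<in> borel_measurable borel"
  shows "(\<integral>\<^sup>+x. f x \<partial>\<nu>) \<le> ennreal B * (\<integral>\<^sup>+x. f x \<partial>lborel)"
proof -
  have "nn_integral \<nu> f \<le> nn_integral (density lborel (\<lambda>_. ennreal B)) f"
    using assms by (intro nn_integral_mono_measure) (auto simp: le_measure emeasure_density nn_integral_cmult_indicator)
  then show ?thesis by (simp add: nn_integral_density nn_integral_cmult)
qed

text \<open>Integrating the Poisson transform over \<open>[a, b]\<close> tests the measures against
  \<open>H y\<close>, a smoothed indicator times \<open>pi\<close>; at fixed height this converges
  by assumption. The smoothing error is controlled in Lebesgue measure by \<open>\<kappa> y\<close>,
  and the density bound \<open>B\<close>, uniform in \<open>k\<close>, carries it over to every
  \<open>\<nu> k\<close>. Hence the height may be sent to zero after \<open>k\<close> has been sent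
  to infinity.\<close>

lemma interval_mass_limit:
  fixes \<nu> :: "nat \<Rightarrow> real measure"
  assumes sets [measurable_cong]: "\<And>k. sets (\<nu> k) = sets borel" and fin: "\<And>k. finite_measure (\<nu> k)" and B: "B \<ge> 0"
    and bound: "\<And>k A. A \<in> sets borel \<Longrightarrow> emeasure (\<nu> k) A \<le> ennreal B * emeasure lborel A"
    and pbound: "\<And>k x y. y > 0 \<Longrightarrow> (\<integral>\<^sup>+t. ennreal (pker y x t) \<partial>\<nu> k) \<le> ennreal (pi * B)"
    and conv: "\<And>x y. y > 0 \<Longrightarrow> (\<lambda>k. \<integral>\<^sup>+t. ennreal (pker y x t) \<partial>\<nu> k) \<longlonglongrightarrow> ennreal (pi * h)"
    and h: "h \<ge> 0" and ab: "a \<le> b"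
  shows "(\<lambda>k. measure (\<nu> k) {a..b}) \<longlonglongrightarrow> h * (b - a)"
proof -
  let ?J = "{a..b}"
  define H where "H = (\<lambda>y s. arctan ((b - s) / y) - arctan ((a - s) / y))"
  have Hm [measurable]: "H y \<in> borel_measurable borel" for y unfolding H_def by measurable
  have H_le: "H y s \<le> pi" for y s
    unfolding H_def using arctan_ubound[of "(b - s) / y"] arctan_lbound[of "(a - s) / y"] by linarith
  have H_nn: "H y s \<ge> 0" if "y > 0" for y s
    unfolding H_def using that ab by (simp add: arctan_le_iff divide_right_mono)
  have H_int: "(\<integral>\<^sup>+x. ennreal (pker y x s) * indicator ?J x \<partial>lborel) = ennreal (H y s)" if "y > 0" for y s
    unfolding H_def using that ab by (rule nn_integral_pker_Icc)
  have nb: "(\<integral>\<^sup>+x. f x \<partial>\<nu> k) \<le> ennreal B * (\<integral>\<^sup>+x. f x \<partial>lborel)" if "f \<in> borel_measurable borel" for f k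
    by (rule nn_integral_le_of_density_bound[OF sets bound that])
  \<comment> \<open>The Lebesgue mass that smoothing removes from inside the interval.\<close>
  define \<kappa> where "\<kappa> = (\<lambda>y. \<integral>\<^sup>+s. ennreal (pi - H y s) * indicator ?J s \<partial>lborel)"
  define T where "T = (\<lambda>k y. \<integral>\<^sup>+s. ennreal (H y s) \<partial>\<nu> k)"
  have T_lim: "(\<lambda>k. T k y) \<longlonglongrightarrow> ennreal (pi * h * (b - a))" if y: "y > 0" for y
  proof -
    have "T k y = (\<integral>\<^sup>+x. (\<integral>\<^sup>+t. ennreal (pker y x t) \<partial>\<nu> k) * indicator ?J x \<partial>lborel)" for k
    proof -
      interpret finite_measure "\<nu> k" by fact
      interpret pair_sigma_finite "\<nu> k" lborel ..
      have "T k y = (\<integral>\<^sup>+s. (\<integral>\<^sup>+x. ennreal (pker y x s) * indicator ?J x \<partial>lborel) \<partial>\<nu> k)"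
        unfolding T_def H_int[OF y] ..
      also have "\<dots> = (\<integral>\<^sup>+x. (\<integral>\<^sup>+t. ennreal (pker y x t) * indicator ?J x \<partial>\<nu> k) \<partial>lborel)"
        by (rule Fubini'[symmetric]) (unfold pker_def, measurable)
      also have "\<dots> = (\<integral>\<^sup>+x. (\<integral>\<^sup>+t. ennreal (pker y x t) \<partial>\<nu> k) * indicator ?J x \<partial>lborel)"
        by (intro nn_integral_cong nn_integral_multc) measurable
      finally show ?thesis .
    qed
    moreover have "(\<lambda>k. \<integral>\<^sup>+x. (\<integral>\<^sup>+t. ennreal (pker y x t) \<partial>\<nu> k) * indicator ?J x \<partial>lborel) \<longlonglongrightarrow>
       (\<integral>\<^sup>+x. ennreal (pi * h) * indicator ?J x \<partial>lborel)"
    proof (rule nn_integral_dominated_convergence[where w = "\<lambda>x. ennreal (pi * B) * indicator ?J x"])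
      show "(\<lambda>x. (\<integral>\<^sup>+t. ennreal (pker y x t) \<partial>\<nu> k) * indicator ?J x) \<in> borel_measurable lborel" for k
      proof -
        interpret finite_measure "\<nu> k" by fact
        show ?thesis unfolding pker_def by measurable
      qed
      show "(\<integral>\<^sup>+x. ennreal (pi * B) * indicator ?J x \<partial>lborel) < \<infinity>"
        using ab B by (simp add: nn_integral_cmult_indicator ennreal_mult_less_top)
      show "AE x in lborel. (\<lambda>k. (\<integral>\<^sup>+t. ennreal (pker y x t) \<partial>\<nu> k) * indicator ?J x) \<longlonglongrightarrow> ennreal (pi * h) * indicator ?J x"
        using conv[OF y] by (auto split: split_indicator)
    qed (use pbound[OF y] in \<open>auto intro!: mult_right_mono\<close>)
    moreover have "(\<integral>\<^sup>+x. ennreal (pi * h) * indicator ?J x \<partial>lborel) = ennreal (pi * h * (b - a))"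
      using ab h by (simp add: nn_integral_cmult_indicator ennreal_mult)
    ultimately show ?thesis by simp
  qed
  have J_mass: "(\<integral>\<^sup>+s. ennreal pi * indicator ?J s \<partial>lborel) = ennreal (pi * (b - a))"
    using ab by (simp add: nn_integral_cmult_indicator ennreal_mult)
  have upper: "ennreal pi * emeasure (\<nu> k) ?J \<le> T k y + ennreal B * \<kappa> y" if y: "y > 0" for k y
  proof -
    have "ennreal pi * emeasure (\<nu> k) ?J = (\<integral>\<^sup>+s. ennreal pi * indicator ?J s \<partial>\<nu> k)"
      by (simp add: nn_integral_cmult_indicator sets)
    also have "\<dots> \<le> (\<integral>\<^sup>+s. ennreal (H y s) + ennreal (pi - H y s) * indicator ?J s \<partial>\<nu> k)"
      using H_nn[OF y] H_le by (intro nn_integral_mono) (auto split: split_indicator simp flip: ennreal_plus)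
    also have "\<dots> = T k y + (\<integral>\<^sup>+s. ennreal (pi - H y s) * indicator ?J s \<partial>\<nu> k)"
      unfolding T_def by (intro nn_integral_add) measurable
    also have "\<dots> \<le> T k y + ennreal B * \<kappa> y"
      unfolding \<kappa>_def by (intro add_left_mono nb) measurable
    finally show ?thesis .
  qed
  have lower: "T k y \<le> ennreal pi * emeasure (\<nu> k) ?J + ennreal B * \<kappa> y" if y: "y > 0" for k y
  proof -
    \<comment> \<open>The kernel has total mass at most \<open>pi\<close>, also in its other
      variable, so \<open>H y\<close> has total mass at most \<open>pi * (b - a)\<close>: what leaks
      out of the interval is at most what is missing inside. Finiteness of the inner part permits
      the cancellation.\<close>
    have outside: "(\<integral>\<^sup>+s. ennreal (H y s) * indicator (- ?J) s \<partial>lborel) \<le> \<kappa> y"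
    proof -
      let ?in = "\<integral>\<^sup>+s. ennreal (H y s) * indicator ?J s \<partial>lborel"
      have in_fin: "?in < \<infinity>"
      proof -
        have "?in \<le> (\<integral>\<^sup>+s. ennreal pi * indicator ?J s \<partial>lborel)"
          using H_le by (intro nn_integral_mono mult_right_mono ennreal_leI) auto
        also have "\<dots> < \<infinity>" unfolding J_mass by simp
        finally show ?thesis .
      qed
      have "?in + (\<integral>\<^sup>+s. ennreal (H y s) * indicator (- ?J) s \<partial>lborel) = (\<integral>\<^sup>+s. ennreal (H y s) \<partial>lborel)"
        by (subst nn_integral_add[symmetric]) (auto intro!: nn_integral_cong split: split_indicator)
      also have "\<dots> = (\<integral>\<^sup>+s. (\<integral>\<^sup>+x. ennreal (pker y x s) * indicator ?J x \<partial>lborel) \<partial>lborel)"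
        unfolding H_int[OF y] ..
      also have "\<dots> = (\<integral>\<^sup>+x. (\<integral>\<^sup>+s. ennreal (pker y x s) * indicator ?J x \<partial>lborel) \<partial>lborel)"
        by (rule lborel_pair.Fubini'[symmetric]) (unfold pker_def, measurable)
      also have "\<dots> = (\<integral>\<^sup>+x. (\<integral>\<^sup>+s. ennreal (pker y s x) \<partial>lborel) * indicator ?J x \<partial>lborel)"
      proof (rule nn_integral_cong)
        fix x
        have "(\<integral>\<^sup>+s. ennreal (pker y x s) * indicator ?J x \<partial>lborel) =
            (\<integral>\<^sup>+s. ennreal (pker y x s) \<partial>lborel) * indicator ?J x"
          by (rule nn_integral_multc) measurable
        also have "(\<integral>\<^sup>+s. ennreal (pker y x s) \<partial>lborel) = (\<integral>\<^sup>+s. ennreal (pker y s x) \<partial>lborel)"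
          by (intro nn_integral_cong) (subst pker_commute, rule refl)
        finally show "(\<integral>\<^sup>+s. ennreal (pker y x s) * indicator ?J x \<partial>lborel) =
            (\<integral>\<^sup>+s. ennreal (pker y s x) \<partial>lborel) * indicator ?J x" .
      qed
      also have "\<dots> \<le> (\<integral>\<^sup>+s. ennreal pi * indicator ?J s \<partial>lborel)"
        by (intro nn_integral_mono mult_right_mono nn_integral_pker_le y) auto
      also have "\<dots> = (\<integral>\<^sup>+s. ennreal (H y s) * indicator ?J s + ennreal (pi - H y s) * indicator ?J s \<partial>lborel)"
        using H_nn[OF y] H_le by (intro nn_integral_cong) (auto split: split_indicator simp flip: ennreal_plus)
      also have "\<dots> = ?in + \<kappa> y" unfolding \<kappa>_def by (intro nn_integral_add) measurable
      finally show ?thesis using in_fin by (auto simp: ennreal_add_left_cancel_le)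
    qed
    have "T k y = (\<integral>\<^sup>+s. ennreal (H y s) * indicator ?J s + ennreal (H y s) * indicator (- ?J) s \<partial>\<nu> k)"
      unfolding T_def by (intro nn_integral_cong) (auto split: split_indicator)
    also have "\<dots> = (\<integral>\<^sup>+s. ennreal (H y s) * indicator ?J s \<partial>\<nu> k) + (\<integral>\<^sup>+s. ennreal (H y s) * indicator (- ?J) s \<partial>\<nu> k)"
      by (intro nn_integral_add) measurable
    also have "\<dots> \<le> (\<integral>\<^sup>+s. ennreal pi * indicator ?J s \<partial>\<nu> k) + ennreal B * (\<integral>\<^sup>+s. ennreal (H y s) * indicator (- ?J) s \<partial>lborel)"
      using H_le by (intro add_mono nn_integral_mono mult_right_mono ennreal_leI nb) auto
    also have "\<dots> \<le> ennreal pi * emeasure (\<nu> k) ?J + ennreal B * \<kappa> y"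
      using outside by (intro add_mono mult_left_mono) (auto simp: nn_integral_cmult_indicator sets)
    finally show ?thesis .
  qed
  define y where "y = (\<lambda>j. 1 / real (Suc j))"
  have y: "y j > 0" for j by (simp add: y_def)
  have \<kappa>_lim: "(\<lambda>j. \<kappa> (y j)) \<longlonglongrightarrow> (\<integral>\<^sup>+s. 0 \<partial>(lborel::real measure))"
    unfolding \<kappa>_def
  proof (rule nn_integral_dominated_convergence[where w = "\<lambda>s. ennreal pi * indicator ?J s"])
    show "(\<integral>\<^sup>+s. ennreal pi * indicator ?J s \<partial>lborel) < \<infinity>" unfolding J_mass by simp
    show "AE s in lborel. ennreal (pi - H (y j) s) * indicator ?J s \<le> ennreal pi * indicator ?J s" for j
      using H_nn[OF y[of j]] by (intro AE_I2 mult_right_mono ennreal_leI) auto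
    have "AE s in lborel. s \<noteq> a" "AE s in lborel. s \<noteq> b" by (rule AE_lborel_singleton)+
    then show "AE s in lborel. (\<lambda>j. ennreal (pi - H (y j) s) * indicator ?J s) \<longlonglongrightarrow> 0"
    proof eventually_elim
      fix s assume s: "s \<noteq> a" "s \<noteq> b"
      show "(\<lambda>j. ennreal (pi - H (y j) s) * indicator ?J s) \<longlonglongrightarrow> 0"
      proof (cases "s \<in> ?J")
        case True
        then have s': "b - s > 0" "s - a > 0" using s by auto
        have "H (y j) s = arctan ((b - s) / y j) + arctan ((s - a) / y j)" for j
          unfolding H_def using arctan_minus[of "(s - a) / y j"] by (simp add: minus_divide_left)
        then have "(\<lambda>j. H (y j) s) \<longlonglongrightarrow> pi / 2 + pi / 2"
          using tendsto_add[OF tendsto_arctan_inverse_nat[OF s'(1)] tendsto_arctan_inverse_nat[OF s'(2)]]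
          by (simp add: y_def)
        then have "(\<lambda>j. ennreal (pi - H (y j) s)) \<longlonglongrightarrow> ennreal (pi - (pi / 2 + pi / 2))"
          by (intro tendsto_ennrealI tendsto_intros)
        then show ?thesis using True by simp
      qed simp
    qed
  qed auto
  show ?thesis
  proof (rule LIMSEQ_I)
    fix d :: real assume d: "d > 0"
    have "(\<lambda>j. ennreal B * \<kappa> (y j)) \<longlonglongrightarrow> ennreal B * 0"
      using \<kappa>_lim by (intro ennreal_tendsto_cmult) auto
    then have "eventually (\<lambda>j. ennreal B * \<kappa> (y j) < ennreal d) sequentially"
      using d by (intro order_tendstoD) auto
    then obtain j where j: "ennreal B * \<kappa> (y j) < ennreal d" by (meson eventually_sequentially order_refl)
    define t where "t = enn2real (ennreal B * \<kappa> (y j))"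
    have t0: "t \<ge> 0" by (simp add: t_def)
    have "ennreal B * \<kappa> (y j) < \<top>" using j by (rule less_trans) simp
    then have t1: "ennreal B * \<kappa> (y j) = ennreal t" by (simp add: t_def)
    have "t < d" using j t0 unfolding t1 by (simp add: ennreal_less_iff)
    note t = t1 this t0
    define Tr where "Tr = (\<lambda>k. enn2real (T k (y j)))"
    have Tr: "Tr \<longlonglongrightarrow> pi * h * (b - a)"
      unfolding Tr_def using T_lim[OF y[of j]] h ab
      by (intro tendsto_enn2real) auto
    have ev: "eventually (\<lambda>k. T k (y j) < \<infinity>) sequentially"
      using T_lim[OF y[of j]] by (intro order_tendstoD) auto
    have near: "\<bar>pi * measure (\<nu> k) ?J - Tr k\<bar> \<le> t" if "T k (y j) < \<infinity>" for k
    proof -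
      interpret finite_measure "\<nu> k" by fact
      have TT: "T k (y j) = ennreal (Tr k)" using that by (simp add: Tr_def less_top)
      have Tr0: "Tr k \<ge> 0" by (simp add: Tr_def)
      have u: "ennreal (pi * measure (\<nu> k) ?J) \<le> ennreal (Tr k + t)"
        using upper[OF y[of j], of k] t Tr0 unfolding TT emeasure_eq_measure by (simp add: ennreal_mult)
      have l: "ennreal (Tr k) \<le> ennreal (pi * measure (\<nu> k) ?J + t)"
        using lower[OF y[of j], of k] t unfolding TT emeasure_eq_measure by (simp add: ennreal_mult)
      have "pi * measure (\<nu> k) ?J \<le> Tr k + t" using u t Tr0 by (subst (asm) ennreal_le_iff) auto
      moreover have "Tr k \<le> pi * measure (\<nu> k) ?J + t" using l t by (subst (asm) ennreal_le_iff) auto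
      ultimately show ?thesis by (simp add: abs_le_iff)
    qed
    have "eventually (\<lambda>k. \<bar>Tr k - pi * h * (b - a)\<bar> < d) sequentially"
      using tendstoD[OF Tr d] by (simp add: dist_real_def)
    with ev have "eventually (\<lambda>k. norm (measure (\<nu> k) ?J - h * (b - a)) < d) sequentially"
    proof eventually_elim
      fix k assume k: "T k (y j) < \<infinity>" "\<bar>Tr k - pi * h * (b - a)\<bar> < d"
      \<comment> \<open>One \<open>d\<close> from smoothing and one from convergence at fixed
        height; \<open>2 \<le> pi\<close> absorbs both.\<close>
      have "\<bar>pi * (measure (\<nu> k) ?J - h * (b - a))\<bar> < 2 * d"
        using near[OF k(1)] k(2) t(2) by (simp add: algebra_simps)
      then have "pi * \<bar>measure (\<nu> k) ?J - h * (b - a)\<bar> < 2 * d" by (simp add: abs_mult)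
      also have "2 * d \<le> pi * d" using pi_ge_two d by (intro mult_right_mono) auto
      finally show "norm (measure (\<nu> k) ?J - h * (b - a)) < d" by simp
    qed
    then show "\<exists>no. \<forall>k\<ge>no. norm (measure (\<nu> k) ?J - h * (b - a)) < d" by (simp add: eventually_sequentially)
  qed
qed

text \<open>Induction over the Borel sets generated by intervals, everything intersected with a
  bounded window so that complements stay of finite mass. For countable unions, domination by
  Lebesgue measure allows Tannery's theorem to exchange limit and sum. \<open>F\<close> is only
  assumed subadditive, since it will be an absolute deviation of expected counts and an L1 distance
  of two random counts, neither of which is additive.\<close>

lemma vanishing_on_borel_sets:
  fixes F :: "nat \<Rightarrow> real set \<Rightarrow> real"
  assumes U: "U = {l..u}" and C: "C \<ge> 0"
    and nn: "\<And>k A. A \<in> sets borel \<Longrightarrow> A \<subseteq> U \<Longrightarrow> F k A \<ge> 0"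
    and bound: "\<And>k A. A \<in> sets borel \<Longrightarrow> A \<subseteq> U \<Longrightarrow> F k A \<le> C * measure lborel A"
    and sub: "\<And>k A. (\<And>i. A i \<in> sets borel) \<Longrightarrow> (\<And>i. A i \<subseteq> U) \<Longrightarrow> disjoint_family A \<Longrightarrow>
        summable (\<lambda>i. F k (A i)) \<Longrightarrow> F k (\<Union>i::nat. A i) \<le> (\<Sum>i. F k (A i))"
    and diff: "\<And>k A. A \<in> sets borel \<Longrightarrow> A \<subseteq> U \<Longrightarrow> F k (U - A) \<le> F k U + F k A"
    and ints: "\<And>p q. p \<le> q \<Longrightarrow> {p..q} \<subseteq> U \<Longrightarrow> (\<lambda>k. F k {p..q}) \<longlonglongrightarrow> 0"
    and A: "A \<in> sets borel" "A \<subseteq> U"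
  shows "(\<lambda>k. F k A) \<longlonglongrightarrow> 0"
proof -
  have emp: "F k {} = 0" for k using nn[of "{}" k] bound[of "{}" k] by simp
  have int': "(\<lambda>k. F k {p..q}) \<longlonglongrightarrow> 0" if "{p..q} \<subseteq> U" for p q
    using ints[OF _ that] by (cases "p \<le> q") (auto simp: emp)
  have "(\<lambda>k. F k (A \<inter> U)) \<longlonglongrightarrow> 0" using A(1)
  proof (induction rule: borel_set_induct)
    case empty
    then show ?case by (simp add: emp)
  next
    case (interval a b)
    have "{a..b} \<inter> U = {max a l..min b u}" using U by auto
    then show ?case using int'[of "max a l" "min b u"] U by auto
  next
    case (compl A)
    have "(\<lambda>k. F k U + F k (A \<inter> U)) \<longlonglongrightarrow> 0 + 0"
      using int'[of l u] compl.IH U by (intro tendsto_add) auto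
    moreover have "F k (- A \<inter> U) \<le> F k U + F k (A \<inter> U)" for k
      using diff[of "A \<inter> U" k] compl.hyps U by (simp add: Diff_Int_distrib Diff_eq inf_commute Int_Un_distrib Int_Un_distrib2)
    moreover have "F k (- A \<inter> U) \<ge> 0" for k using compl.hyps U by (intro nn) auto
    ultimately show ?case
      by (intro tendsto_sandwich[OF _ _ tendsto_const, of 0 "\<lambda>k. F k (- A \<inter> U)" sequentially "\<lambda>k. F k U + F k (A \<inter> U)"]) auto
  next
    case (union A)
    let ?A = "\<lambda>i. A i \<inter> U"
    have Am: "?A i \<in> sets borel" "?A i \<subseteq> U" for i using union.hyps U by auto
    have dis: "disjoint_family ?A" using union.hyps by (auto simp: disjoint_family_on_def)
    have summ: "summable (\<lambda>i. C * measure lborel (?A i))"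
    proof (rule summable_mult)
      have "emeasure lborel (\<Union>i. ?A i) \<noteq> \<infinity>"
      proof -
        have "emeasure lborel (\<Union>i. ?A i) \<le> emeasure lborel {l..u}" using Am U by (intro emeasure_mono) auto
        also have "\<dots> < \<infinity>" by (simp add: emeasure_lborel_Icc_eq)
        finally show ?thesis by simp
      qed
      then have "(\<lambda>i. measure lborel (?A i)) sums measure lborel (\<Union>i. ?A i)"
        using Am dis by (intro measure_UNION) auto
      then show "summable (\<lambda>i. measure lborel (?A i))" by (rule sums_summable)
    qed
    have summF: "summable (\<lambda>i. F k (?A i))" for k
      using bound nn Am by (intro summable_comparison_test'[OF summ]) auto
    have "(\<lambda>k. \<Sum>i. F k (?A i)) \<longlonglongrightarrow> (\<Sum>i. 0)"
    proof (rule tannerys_theorem[THEN conjunct2, THEN conjunct2])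
      show "\<forall>\<^sub>F (i, k) in at_top \<times>\<^sub>F at_top. norm (F k (?A i)) \<le> C * measure lborel (?A i)"
        using bound nn Am by (auto intro!: always_eventually)
    qed (use union.IH summ in auto)
    moreover have "F k ((\<Union>i. A i) \<inter> U) \<le> (\<Sum>i. F k (?A i))" for k
      using sub[of ?A k] Am dis summF by simp
    moreover have "F k ((\<Union>i. A i) \<inter> U) \<ge> 0" for k using union.hyps U by (intro nn) auto
    ultimately show ?case
      by (intro tendsto_sandwich[OF _ _ tendsto_const, of 0 "\<lambda>k. F k ((\<Union>i. A i) \<inter> U)" sequentially "\<lambda>k. \<Sum>i. F k (?A i)"]) auto
  qed
  then show ?thesis using A(2) by (simp add: Int_absorb2)
qed

section \<open>Dependence of resolvents and counts on the potential\<close>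

lemma continuous_on_green:
  assumes "symker S a" "Im z > 0" "x \<in> S" "y \<in> S"
  shows "continuous_on UNIV (\<lambda>w. green S a w z x y)"
  unfolding continuous_on_def
proof
  interpret symker S a by fact
  fix w :: "nat \<Rightarrow> real"
  define g where "g = (\<lambda>w'. (\<Sum>v\<in>S. \<bar>w' v - w v\<bar>) / (Im z)\<^sup>2)"
  have coord: "((\<lambda>w'. w' v) \<longlongrightarrow> w v) (at w within UNIV)" for v
    using continuous_on_product_coordinates[of v] unfolding continuous_on_def by blast
  have "(g \<longlongrightarrow> (\<Sum>v\<in>S. \<bar>w v - w v\<bar>) / (Im z)\<^sup>2) (at w within UNIV)"
    unfolding g_def using assms(2) by (intro tendsto_intros coord) auto
  then have g0: "(g \<longlongrightarrow> 0) (at w within UNIV)" by simp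
  have "norm (green S a w' z x y - green S a w z x y) \<le> g w'" for w'
    unfolding g_def
  proof (rule green_lipschitz)
    fix v assume "v \<in> S"
    then show "\<bar>w' v - w v\<bar> \<le> (\<Sum>v\<in>S. \<bar>w' v - w v\<bar>)" using fin by (intro member_le_sum) auto
  qed (use assms in auto)
  then have "((\<lambda>w'. green S a w' z x y - green S a w z x y) \<longlongrightarrow> 0) (at w within UNIV)"
    by (intro Lim_null_comparison[OF _ g0] always_eventually) auto
  then show "((\<lambda>w. green S a w z x y) \<longlongrightarrow> green S a w z x y) (at w within UNIV)"
    by (simp add: LIM_zero_iff)
qed

text \<open>Upper semicontinuity: by Weyl, counts along the sequence are eventually bounded by the
  limit's count of a slightly larger interval, and the limit has finitely many eigenvalues, so a
  small enough enlargement captures no new one.\<close>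

lemma closed_cnt_ge:
  assumes sym: "\<And>x y. x < N \<Longrightarrow> y < N \<Longrightarrow> a x y = a y x"
  shows "closed {w. m \<le> cnt N a w {p..q}}"
  unfolding closed_sequential_limits
proof (intro allI impI, elim conjE)
  fix X :: "nat \<Rightarrow> nat \<Rightarrow> real" and l
  assume X: "\<forall>n. X n \<in> {w. m \<le> cnt N a w {p..q}}" "X \<longlonglongrightarrow> l"
  obtain u e where ue: "eigensystem N a l u e" using spectral_theorem[of N a l] sym by blast
  have "\<forall>\<^sub>F d in at_right 0. \<forall>i\<in>{..<N}. e i \<in> {p - d..q + d} \<longrightarrow> e i \<in> {p..q}"
  proof (intro eventually_ball_finite ballI)
    fix i
    show "\<forall>\<^sub>F d in at_right 0. e i \<in> {p - d..q + d} \<longrightarrow> e i \<in> {p..q}"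
    proof (cases "e i \<in> {p..q}")
      case False
      define c where "c = max (p - e i) (e i - q)"
      have "c > 0" using False by (auto simp: c_def)
      then have "\<forall>\<^sub>F d in at_right 0. d < c" by (auto simp: eventually_at_right_field)
      then show ?thesis by eventually_elim (auto simp: c_def)
    qed auto
  qed auto
  moreover have "\<forall>\<^sub>F d in at_right 0. (0::real) < d" by (simp add: eventually_at_right_less)
  ultimately have "\<forall>\<^sub>F d in at_right 0. 0 < d \<and> (\<forall>i\<in>{..<N}. e i \<in> {p - d..q + d} \<longrightarrow> e i \<in> {p..q})"
    by eventually_elim auto
  then have "\<exists>d. 0 < d \<and> (\<forall>i\<in>{..<N}. e i \<in> {p - d..q + d} \<longrightarrow> e i \<in> {p..q})"
    by (rule eventually_happens'[OF trivial_limit_at_right_real])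
  then obtain d where "0 < d \<and> (\<forall>i\<in>{..<N}. e i \<in> {p - d..q + d} \<longrightarrow> e i \<in> {p..q})" by blast
  then have d: "d > 0" "\<And>i. i < N \<Longrightarrow> e i \<in> {p - d..q + d} \<Longrightarrow> e i \<in> {p..q}" by blast+
  have "\<forall>\<^sub>F n in sequentially. \<forall>x\<in>{..<N}. \<bar>l x - X n x\<bar> < d"
  proof (intro eventually_ball_finite ballI)
    fix x
    have "isCont (\<lambda>w. w x) l"
      using continuous_on_product_coordinates[of x] continuous_on_eq_continuous_at[OF open_UNIV] by blast
    then have "(\<lambda>n. X n x) \<longlonglongrightarrow> l x" using X(2) by (rule isCont_tendsto_compose)
    from tendstoD[OF this d(1)] show "\<forall>\<^sub>F n in sequentially. \<bar>l x - X n x\<bar> < d"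
      by eventually_elim (simp add: dist_real_def abs_minus_commute)
  qed simp
  then have "\<exists>n. \<forall>x\<in>{..<N}. \<bar>l x - X n x\<bar> < d" by (rule eventually_happens'[OF sequentially_bot])
  then obtain n where "\<forall>x\<in>{..<N}. \<bar>l x - X n x\<bar> < d" ..
  then have "cnt N a (X n) {p..q} \<le> cnt N a l {p - d..q + d}"
    using sym d(1) by (intro cnt_weyl_potential) (auto intro!: less_imp_le)
  also have "\<dots> \<le> cnt N a l {p..q}"
    unfolding cnt_eigensystem[OF ue] using d(2) by (intro card_mono) auto
  finally show "l \<in> {w. m \<le> cnt N a w {p..q}}" using X(1) order.trans by fastforce
qed

text \<open>Some enumeration of the eigenvalues, neither ordered nor claimed measurable in
  \<open>w\<close>; only quantities symmetric in the index are averaged over the disorder.\<close>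

definition eig :: "nat \<Rightarrow> (nat \<Rightarrow> nat \<Rightarrow> real) \<Rightarrow> (nat \<Rightarrow> real) \<Rightarrow> nat \<Rightarrow> real" where
  "eig N a w = (SOME e. \<exists>u. eigensystem N a w u e)"

lemma eigensystem_eig:
  assumes sym: "\<And>x y. x < N \<Longrightarrow> y < N \<Longrightarrow> a x y = a y x"
  shows "\<exists>u. eigensystem N a w u (eig N a w)"
proof -
  have "\<exists>e. \<exists>u. eigensystem N a w u e" using spectral_theorem[of N a w] sym by blast
  then show ?thesis unfolding eig_def by (rule someI_ex)
qed

lemma sum_Im_green:
  assumes sym: "\<And>x y. x < N \<Longrightarrow> y < N \<Longrightarrow> a x y = a y x" and y: "y > 0"
  shows "(\<Sum>x<N. Im (green {..<N} a w (Complex E y) x x)) = (\<Sum>i<N. pker y E (eig N a w i))"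
proof -
  obtain u where ue: "eigensystem N a w u (eig N a w)" using eigensystem_eig[of N a w] sym by blast
  have "(\<Sum>x<N. Im (green {..<N} a w (Complex E y) x x)) = Im (\<Sum>x<N. green {..<N} a w (Complex E y) x x)" by simp
  also have "\<dots> = (\<Sum>i<N. Im (1 / (of_real (eig N a w i) - Complex E y)))"
    using y sym by (subst trace_green[OF _ ue]) auto
  also have "\<dots> = (\<Sum>i<N. pker y E (eig N a w i))" by (simp only: Im_resolvent_kernel)
  finally show ?thesis .
qed

lemma cnt_le_sum_Im_green:
  assumes sym: "\<And>x y. x < N \<Longrightarrow> y < N \<Longrightarrow> a x y = a y x" and y: "y > 0"
  shows "real (cnt N a w {E - y..E + y}) \<le> 2 * y * (\<Sum>x<N. Im (green {..<N} a w (Complex E y) x x))"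
proof -
  obtain u where ue: "eigensystem N a w u (eig N a w)" using eigensystem_eig[of N a w] sym by blast
  have "real (cnt N a w {E - y..E + y}) = (\<Sum>i\<in>{i. i < N \<and> eig N a w i \<in> {E - y..E + y}}. 1)"
    unfolding cnt_eigensystem[OF ue] by simp
  also have "\<dots> \<le> (\<Sum>i\<in>{i. i < N \<and> eig N a w i \<in> {E - y..E + y}}. 2 * y * pker y E (eig N a w i))"
    using y by (intro sum_mono pker_ge) (auto simp: abs_le_iff)
  also have "\<dots> \<le> (\<Sum>i<N. 2 * y * pker y E (eig N a w i))"
    using y by (intro sum_mono2) (auto simp: pker_nonneg)
  also have "\<dots> = 2 * y * (\<Sum>x<N. Im (green {..<N} a w (Complex E y) x x))"
    by (simp only: sum_Im_green[OF sym y] sum_distrib_left)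
  finally show ?thesis .
qed

text \<open>The empirical spectral distribution. Viewed as a kernel of probability measures, it has
  to be checked for measurability on closed intervals only, and the counts of all Borel sets inherit
  it.\<close>

definition esm :: "nat \<Rightarrow> (nat \<Rightarrow> nat \<Rightarrow> real) \<Rightarrow> (nat \<Rightarrow> real) \<Rightarrow> real measure" where
  "esm N a w = distr (measure_pmf (pmf_of_set {..<N})) borel (eig N a w)"

lemma sets_esm [simp]: "sets (esm N a w) = sets borel" and space_esm [simp]: "space (esm N a w) = UNIV"
  by (simp_all add: esm_def)

lemma prob_space_esm: "prob_space (esm N a w)"
  unfolding esm_def by (rule prob_space.prob_space_distr) (auto intro: prob_space_measure_pmf)

lemma emeasure_esm:
  assumes sym: "\<And>x y. x < N \<Longrightarrow> y < N \<Longrightarrow> a x y = a y x" and N: "N > 0" and A: "A \<in> sets borel"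
  shows "emeasure (esm N a w) A = ennreal (real (cnt N a w A) / real N)"
proof -
  obtain u where ue: "eigensystem N a w u (eig N a w)" using eigensystem_eig[of N a w] sym by blast
  have "{..<N} \<noteq> {}" using N by auto
  moreover have "{..<N} \<inter> eig N a w -` A = {i. i < N \<and> eig N a w i \<in> A}" by auto
  ultimately show ?thesis unfolding esm_def using A cnt_eigensystem[OF ue]
    by (simp add: emeasure_distr emeasure_pmf_of_set)
qed

lemma nn_integral_esm:
  assumes N: "N > 0" and [measurable]: "f \<in> borel_measurable borel"
  shows "(\<integral>\<^sup>+t. f t \<partial>esm N a w) = (\<Sum>i<N. f (eig N a w i)) / ennreal (real N)"
proof -
  have "{..<N} \<noteq> {}" using N by auto
  then show ?thesis unfolding esm_def
    by (simp add: nn_integral_distr nn_integral_pmf_of_set ennreal_of_nat_eq_real_of_nat)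
qed

section \<open>Wegner and Minami estimates\<close>

locale anderson =
  fixes \<gamma> :: "real \<Rightarrow> real" and Bd :: real
  assumes gamma_meas [measurable]: "\<gamma> \<in> borel_measurable borel"
    and gamma_nonneg: "\<gamma> t \<ge> 0" and gamma_le: "\<gamma> t \<le> Bd"
    and gamma_prob: "(\<integral>\<^sup>+ t. ennreal (\<gamma> t) \<partial>lborel) = 1"
begin

definition D :: "real measure" where "D = density lborel (\<lambda>t. ennreal (\<gamma> t))"
definition M :: "(nat \<Rightarrow> real) measure" where "M = PiM UNIV (\<lambda>_. D)"

lemma Bd_nonneg: "Bd \<ge> 0"
  using gamma_nonneg[of 0] gamma_le[of 0] by linarith

lemma sets_D [measurable_cong, simp]: "sets D = sets borel" and space_D [simp]: "space D = UNIV"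
  by (simp_all add: D_def)

lemma prob_space_D: "prob_space D"
  by (rule prob_spaceI) (simp add: D_def emeasure_density gamma_prob)

sublocale D: prob_space D by (rule prob_space_D)

sublocale SS: sequence_space D ..

lemma prob_space_M: "prob_space M"
  unfolding M_def by (rule prob_space_PiM) (rule prob_space_D)

sublocale M: prob_space M by (rule prob_space_M)

lemma sets_M: "sets M = sets borel"
proof -
  have "sets M = sets (PiM UNIV (\<lambda>_::nat. borel :: real measure))"
    unfolding M_def by (rule sets_PiM_cong) auto
  also have "\<dots> = sets borel" by (rule sets_PiM_equal_borel)
  finally show ?thesis .
qed

lemma space_M [simp]: "space M = UNIV"
  by (simp add: M_def space_PiM PiE_UNIV_domain)

lemma measurable_M_iff: "f \<in> measurable M N \<longleftrightarrow> f \<in> measurable borel N"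
  using measurable_cong_sets[OF sets_M refl] by blast

lemma measurable_upd:
  assumes "f \<in> measurable K M" "g \<in> measurable K borel"
  shows "(\<lambda>s. (f s)(x := g s)) \<in> measurable K M"
proof -
  have "g \<in> measurable K D" using assms(2) measurable_cong_sets[OF refl sets_D] by blast
  then show ?thesis using assms unfolding M_def
    by (intro measurable_fun_upd[where J = UNIV]) auto
qed

section \<open>Resampling and relabelling of the i.i.d. potential\<close>

lemma nn_integral_split_coord:
  fixes x :: nat
  assumes [measurable]: "F \<in> borel_measurable M"
  shows "(\<integral>\<^sup>+w. F w \<partial>M) = (\<integral>\<^sup>+X. (\<integral>\<^sup>+v. F (X(x := v)) \<partial>D) \<partial>PiM (UNIV - {x}) (\<lambda>_. D))"
proof -
  let ?M' = "PiM (UNIV - {x}) (\<lambda>_. D)"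
  interpret M': prob_space ?M' by (rule prob_space_PiM) (rule prob_space_D)
  interpret pair_sigma_finite D ?M' ..
  have "distr (D \<Otimes>\<^sub>M ?M') (PiM (insert x (UNIV - {x})) (\<lambda>_. D)) (\<lambda>(v, X). X(x := v)) = PiM (insert x (UNIV - {x})) (\<lambda>_. D)"
    by (rule distr_pair_PiM_eq_PiM) (rule prob_space_D)+
  then have d: "distr (D \<Otimes>\<^sub>M ?M') M (\<lambda>(v, X). X(x := v)) = M" by (simp add: M_def insert_Diff_if)
  have [measurable]: "(\<lambda>(v, X). X(x := v)) \<in> measurable (D \<Otimes>\<^sub>M ?M') M"
    unfolding M_def split_beta' by (intro measurable_fun_upd[where J = "UNIV - {x}"]) auto
  have "(\<integral>\<^sup>+w. F w \<partial>M) = (\<integral>\<^sup>+w. F w \<partial>distr (D \<Otimes>\<^sub>M ?M') M (\<lambda>(v, X). X(x := v)))" unfolding d ..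
  also have "\<dots> = (\<integral>\<^sup>+p. F ((\<lambda>(v, X). X(x := v)) p) \<partial>(D \<Otimes>\<^sub>M ?M'))" by (rule nn_integral_distr) measurable
  also have "\<dots> = (\<integral>\<^sup>+X. (\<integral>\<^sup>+v. F ((\<lambda>(v, X). X(x := v)) (v, X)) \<partial>D) \<partial>?M')"
    by (rule nn_integral_snd[symmetric]) measurable
  finally show ?thesis by simp
qed

lemma measurable_resample:
  assumes [measurable]: "F \<in> borel_measurable M"
  shows "(\<lambda>w. \<integral>\<^sup>+v. F (w(x := v)) \<partial>D) \<in> borel_measurable M"
proof -
  have [measurable]: "(\<lambda>p. (fst p)(x := snd p)) \<in> measurable (M \<Otimes>\<^sub>M D) M" by (rule measurable_upd) auto
  show ?thesis by measurable
qed

text \<open>Redrawing one site leaves the law of the potential unchanged. In this form a single site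
  can be averaged while all integrals stay on the full product space.\<close>

lemma nn_integral_resample:
  assumes [measurable]: "F \<in> borel_measurable M"
  shows "(\<integral>\<^sup>+w. F w \<partial>M) = (\<integral>\<^sup>+w. (\<integral>\<^sup>+v. F (w(x := v)) \<partial>D) \<partial>M)"
proof -
  have "(\<integral>\<^sup>+w. (\<integral>\<^sup>+v. F (w(x := v)) \<partial>D) \<partial>M) =
     (\<integral>\<^sup>+X. (\<integral>\<^sup>+v'. (\<integral>\<^sup>+v. F ((X(x := v'))(x := v)) \<partial>D) \<partial>D) \<partial>PiM (UNIV - {x}) (\<lambda>_. D))"
    by (rule nn_integral_split_coord[OF measurable_resample[OF assms]])
  also have "\<dots> = (\<integral>\<^sup>+X. (\<integral>\<^sup>+v. F (X(x := v)) \<partial>D) \<partial>PiM (UNIV - {x}) (\<lambda>_. D))"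
    using D.emeasure_space_1 by simp
  also have "\<dots> = (\<integral>\<^sup>+w. F w \<partial>M)" by (rule nn_integral_split_coord[symmetric]) measurable
  finally show ?thesis by simp
qed

lemma distr_reindex:
  assumes "inj f"
  shows "distr M M (\<lambda>w i. w (f i)) = M"
  using distr_PiM_reindex[of UNIV "\<lambda>_. D" f UNIV] assms prob_space_D
  by (simp add: M_def restrict_UNIV)

lemma measurable_reindex: "(\<lambda>w i. w (f i)) \<in> measurable M M"
proof -
  have "(\<lambda>w i. w (f i)) \<in> measurable (PiM UNIV (\<lambda>_. D)) (PiM UNIV (\<lambda>_. D))"
    by (rule measurable_PiM_single') (auto simp: space_PiM)
  then show ?thesis by (simp add: M_def)
qed

lemma distr_comb_seq: "distr (M \<Otimes>\<^sub>M M) M (\<lambda>(w, w'). comb_seq i w w') = M"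
  unfolding M_def by (rule SS.PiM_comb_seq)

lemma measurable_green:
  assumes "symker S a" "Im z > 0" "x \<in> S" "y \<in> S"
  shows "(\<lambda>w. green S a w z x y) \<in> borel_measurable M"
  unfolding measurable_M_iff by (intro borel_measurable_continuous_onI continuous_on_green assms)

text \<open>By \<open>green_rank_one\<close> the diagonal entry is a Poisson kernel in the potential
  at \<open>x\<close>, with parameters given by the other sites. Its mass is at most
  \<open>pi\<close> at every height, so after bounding the density by \<open>Bd\<close> no trace of
  \<open>Im z\<close> remains.\<close>

lemma spectral_averaging:
  assumes "symker S a" and z: "Im z > 0" and x: "x \<in> S"
  shows "(\<integral>\<^sup>+v. ennreal (Im (green S a (w(x := v)) z x x)) \<partial>D) \<le> ennreal (pi * Bd)"
proof -
  interpret symker S a by fact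
  define g where "g = green S a (w(x := 0)) z x x"
  have g: "Im g > 0" unfolding g_def by (rule Im_green_pos[OF z x])
  \<comment> \<open>\<open>Complex r \<beta>\<close> equals \<open>- 1 / g\<close>, which lies in
    the upper half-plane because \<open>g\<close> does.\<close>
  define \<beta> where "\<beta> = - Im (1 / g)"
  have pm [measurable]: "(\<lambda>v. pker \<beta> v t) \<in> borel_measurable borel" for t unfolding pker_def by measurable
  have "\<beta> > 0" using g unfolding \<beta>_def Im_divide by (auto simp: divide_pos_pos add_nonneg_pos)
  define r where "r = - Re (1 / g)"
  have "Im (green S a (w(x := v)) z x x) = pker \<beta> r v" for v
  proof -
    have "complex_of_real v + 1 / g = of_real v - Complex r \<beta>"
      by (simp add: complex_eq_iff \<beta>_def r_def)
    then show ?thesis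
      unfolding green_rank_one[OF z x, of w v] g_def[symmetric] by (simp only: Im_resolvent_kernel)
  qed
  then have "(\<integral>\<^sup>+v. ennreal (Im (green S a (w(x := v)) z x x)) \<partial>D) =
     (\<integral>\<^sup>+v. ennreal (\<gamma> v) * ennreal (pker \<beta> r v) \<partial>lborel)"
    unfolding D_def by (simp add: nn_integral_density)
  also have "\<dots> \<le> (\<integral>\<^sup>+v. ennreal Bd * ennreal (pker \<beta> v r) \<partial>lborel)"
    using gamma_le by (intro nn_integral_mono mult_mono ennreal_leI) (auto simp: pker_commute)
  also have "\<dots> = ennreal Bd * (\<integral>\<^sup>+v. ennreal (pker \<beta> v r) \<partial>lborel)"
    by (rule nn_integral_cmult) measurable
  also have "\<dots> \<le> ennreal Bd * ennreal pi"
    by (intro mult_left_mono nn_integral_pker_le) (use \<open>\<beta> > 0\<close> in auto)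
  also have "\<dots> = ennreal (pi * Bd)" using Bd_nonneg by (simp add: ennreal_mult mult.commute)
  finally show ?thesis .
qed

lemma nn_integral_Im_green_le:
  assumes "symker S a" and z: "Im z > 0" and x: "x \<in> S"
  shows "(\<integral>\<^sup>+w. ennreal (Im (green S a w z x x)) \<partial>M) \<le> ennreal (pi * Bd)"
proof -
  have [measurable]: "(\<lambda>w. green S a w z x x) \<in> borel_measurable M" by (rule measurable_green) fact+
  have "(\<integral>\<^sup>+w. ennreal (Im (green S a w z x x)) \<partial>M) =
      (\<integral>\<^sup>+w. (\<integral>\<^sup>+v. ennreal (Im (green S a (w(x := v)) z x x)) \<partial>D) \<partial>M)"
    by (rule nn_integral_resample) measurable
  also have "\<dots> \<le> (\<integral>\<^sup>+w. ennreal (pi * Bd) \<partial>M)"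
    by (intro nn_integral_mono spectral_averaging assms)
  also have "\<dots> = ennreal (pi * Bd)" using M.emeasure_space_1 by simp
  finally show ?thesis .
qed

end

locale anderson_kernel = anderson +
  fixes N :: nat and a :: "nat \<Rightarrow> nat \<Rightarrow> real"
  assumes N_pos: "N > 0" and a_sym: "x < N \<Longrightarrow> y < N \<Longrightarrow> a x y = a y x"
begin

lemma symker_N: "symker {..<N} a"
  using a_sym by unfold_locales auto

lemma esm_cnt:
  assumes "A \<in> sets borel"
  shows "emeasure (esm N a w) A = ennreal (real (cnt N a w A) / real N)"
  by (rule emeasure_esm[OF _ N_pos assms]) (rule a_sym)

lemma measurable_esm: "esm N a \<in> measurable M (prob_algebra borel)"
proof (rule measurable_prob_algebra_generated)
  show "sets borel = sigma_sets UNIV (range (\<lambda>(a, b). {a..b :: real}))"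
    by (subst borel_eq_atLeastAtMost) simp
  show "Int_stable (range (\<lambda>(a, b). {a..b :: real}))" by (auto simp: Int_stable_def)
  fix A assume "A \<in> range (\<lambda>(a, b). {a..b :: real})"
  then obtain p q where A: "A = {p..q}" by auto
  have "(\<lambda>w. cnt N a w {p..q}) \<in> measurable M (count_space UNIV)"
  proof -
    have *: "{w. m \<le> cnt N a w {p..q}} \<in> sets M" for m
      unfolding sets_M using a_sym by (intro borel_closed closed_cnt_ge)
    have "(\<lambda>w. cnt N a w {p..q}) -` {m} \<inter> space M = {w. m \<le> cnt N a w {p..q}} - {w. Suc m \<le> cnt N a w {p..q}}" for m
      by auto
    then have "(\<lambda>w. cnt N a w {p..q}) -` {m} \<inter> space M \<in> sets M" for m using * by auto
    then show ?thesis by (intro measurable_count_space_eq2_countable[THEN iffD2]) auto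
  qed
  then have "(\<lambda>w. real (cnt N a w {p..q})) \<in> borel_measurable M"
    by (rule measurable_compose) simp
  then show "(\<lambda>w. emeasure (esm N a w) A) \<in> borel_measurable M"
    unfolding A by (simp add: esm_cnt)
qed (auto simp: prob_space_esm)

lemma measurable_cnt:
  assumes A: "A \<in> sets borel"
  shows "(\<lambda>w. cnt N a w A) \<in> measurable M (count_space UNIV)"
proof -
  have "esm N a \<in> measurable M (subprob_algebra borel)" by (rule measurable_prob_algebraD[OF measurable_esm])
  from measurable_emeasure_kernel[OF this A]
  have "(\<lambda>w. emeasure (esm N a w) A) \<in> borel_measurable M" .
  then have m: "(\<lambda>w. ennreal (real (cnt N a w A) / real N)) \<in> borel_measurable M"
    unfolding esm_cnt[OF A] .
  have "(\<lambda>w. cnt N a w A) -` {m} \<inter> space M \<in> sets M" for m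
  proof -
    have "(\<lambda>w. cnt N a w A) -` {m} \<inter> space M =
        (\<lambda>w. ennreal (real (cnt N a w A) / real N)) -` {ennreal (real m / real N)} \<inter> space M"
      using N_pos by (auto simp: ennreal_inj)
    also have "\<dots> \<in> sets M" by (rule measurable_sets[OF m]) simp
    finally show ?thesis .
  qed
  then show ?thesis by (intro measurable_count_space_eq2_countable[THEN iffD2]) auto
qed

text \<open>The density of states measure: the bind of the probability monad averages the empirical
  spectral distribution over the disorder.\<close>

definition dos :: "real measure" where "dos = M \<bind> esm N a"

lemma esm_subprob: "esm N a \<in> measurable M (subprob_algebra borel)"
  by (rule measurable_prob_algebraD[OF measurable_esm])

lemma sets_dos [simp]: "sets dos = sets borel"
  unfolding dos_def by (rule sets_bind) auto

lemma prob_space_dos: "prob_space dos"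
  unfolding dos_def by (rule M.prob_space_bind[OF _ esm_subprob]) (simp add: prob_space_esm)

lemma emeasure_dos:
  assumes "A \<in> sets borel"
  shows "emeasure dos A = (\<integral>\<^sup>+w. ennreal (real (cnt N a w A) / real N) \<partial>M)"
  unfolding dos_def using assms by (subst emeasure_bind[OF _ esm_subprob]) (auto simp: esm_cnt)

lemma nn_integral_cnt:
  assumes A: "A \<in> sets borel"
  shows "(\<integral>\<^sup>+w. ennreal (real (cnt N a w A)) \<partial>M) = ennreal (real N) * emeasure dos A"
proof -
  have cm: "(\<lambda>w. ennreal (real (cnt N a w A) / real N)) \<in> borel_measurable M"
    by (rule measurable_compose[OF measurable_cnt[OF A]]) simp
  have "ennreal (real N) * emeasure dos A = (\<integral>\<^sup>+w. ennreal (real N) * ennreal (real (cnt N a w A) / real N) \<partial>M)"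
    unfolding emeasure_dos[OF A] by (rule nn_integral_cmult[OF cm, symmetric])
  also have "\<dots> = (\<integral>\<^sup>+w. ennreal (real (cnt N a w A)) \<partial>M)"
    using N_pos by (intro nn_integral_cong) (simp flip: ennreal_mult)
  finally show ?thesis by simp
qed

lemma measurable_Im_green:
  assumes "y > 0" "x < N"
  shows "(\<lambda>w. Im (green {..<N} a w (Complex E y) x x)) \<in> borel_measurable M"
    and "(\<lambda>w. ennreal (Im (green {..<N} a w (Complex E y) x x))) \<in> borel_measurable M"
proof -
  have [measurable]: "(\<lambda>w. green {..<N} a w (Complex E y) x x) \<in> borel_measurable M"
    using assms by (intro measurable_green[OF symker_N]) auto
  show "(\<lambda>w. Im (green {..<N} a w (Complex E y) x x)) \<in> borel_measurable M" by measurable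
  then show "(\<lambda>w. ennreal (Im (green {..<N} a w (Complex E y) x x))) \<in> borel_measurable M"
    by (rule measurable_compose[OF _ measurable_ennreal])
qed

text \<open>The trace of the resolvent is computed once from the eigenvalues and once from the
  diagonal; the second form can be averaged site by site.\<close>

lemma nn_integral_pker_dos:
  assumes y: "y > 0"
  shows "(\<integral>\<^sup>+t. ennreal (pker y E t) \<partial>dos) =
    (\<integral>\<^sup>+w. (\<Sum>x<N. ennreal (Im (green {..<N} a w (Complex E y) x x))) \<partial>M) / ennreal (real N)"
proof -
  interpret symker "{..<N}" a by (rule symker_N)
  have pos: "Im (green {..<N} a w (Complex E y) x x) \<ge> 0" if "x < N" for w x
    using Im_green_pos[of "Complex E y" x w] y that by simp
  have [measurable]: "(\<lambda>w. \<Sum>x<N. ennreal (Im (green {..<N} a w (Complex E y) x x))) \<in> borel_measurable M"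
    using y by (intro borel_measurable_sum measurable_Im_green(2)) auto
  have "(\<integral>\<^sup>+t. ennreal (pker y E t) \<partial>dos) = (\<integral>\<^sup>+w. (\<integral>\<^sup>+t. ennreal (pker y E t) \<partial>esm N a w) \<partial>M)"
    unfolding dos_def by (rule nn_integral_bind[OF _ esm_subprob]) measurable
  also have "\<dots> = (\<integral>\<^sup>+w. (\<Sum>x<N. ennreal (Im (green {..<N} a w (Complex E y) x x))) / ennreal (real N) \<partial>M)"
  proof (rule nn_integral_cong)
    fix w
    have "(\<integral>\<^sup>+t. ennreal (pker y E t) \<partial>esm N a w) = ennreal (\<Sum>i<N. pker y E (eig N a w i)) / ennreal (real N)"
      using N_pos y by (subst nn_integral_esm) (auto simp: pker_nonneg sum_ennreal)
    also have "(\<Sum>i<N. pker y E (eig N a w i)) = (\<Sum>x<N. Im (green {..<N} a w (Complex E y) x x))"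
      by (rule sum_Im_green[symmetric]) (use a_sym y in auto)
    also have "ennreal \<dots> = (\<Sum>x<N. ennreal (Im (green {..<N} a w (Complex E y) x x)))"
      using pos by (intro sum_ennreal[symmetric]) auto
    finally show "(\<integral>\<^sup>+t. ennreal (pker y E t) \<partial>esm N a w) =
      (\<Sum>x<N. ennreal (Im (green {..<N} a w (Complex E y) x x))) / ennreal (real N)" .
  qed
  also have "\<dots> = (\<integral>\<^sup>+w. (\<Sum>x<N. ennreal (Im (green {..<N} a w (Complex E y) x x))) \<partial>M) / ennreal (real N)"
    by (rule nn_integral_divide) measurable
  finally show ?thesis .
qed

lemma nn_integral_pker_dos_le:
  assumes y: "y > 0"
  shows "(\<integral>\<^sup>+t. ennreal (pker y E t) \<partial>dos) \<le> ennreal (pi * Bd)"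
proof -
  have "(\<integral>\<^sup>+w. (\<Sum>x<N. ennreal (Im (green {..<N} a w (Complex E y) x x))) \<partial>M) =
     (\<Sum>x<N. \<integral>\<^sup>+w. ennreal (Im (green {..<N} a w (Complex E y) x x)) \<partial>M)"
    using y by (intro nn_integral_sum measurable_Im_green(2)) auto
  also have "\<dots> \<le> (\<Sum>x<N. ennreal (pi * Bd))"
    using y by (intro sum_mono nn_integral_Im_green_le symker_N) auto
  also have "\<dots> = ennreal (pi * Bd) * ennreal (real N)"
    by (simp add: ennreal_of_nat_eq_real_of_nat mult.commute)
  finally have "(\<integral>\<^sup>+t. ennreal (pker y E t) \<partial>dos) \<le> ennreal (pi * Bd) * ennreal (real N) / ennreal (real N)"
    unfolding nn_integral_pker_dos[OF y] by (rule divide_right_mono_ennreal)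
  also have "\<dots> = ennreal (pi * Bd)" using N_pos by (simp add: ennreal_mult_divide_eq)
  finally show ?thesis .
qed

text \<open>Spectral averaging bounds the Poisson transform by \<open>pi * Bd\<close> at every
  height, and inversion turns this into the density bound, with a constant independent of the volume
  and of the kernel.\<close>

lemma wegner:
  assumes "A \<in> sets borel"
  shows "emeasure dos A \<le> ennreal Bd * emeasure lborel A"
proof (rule density_bound_of_poisson_bound)
  show "finite_measure dos" using prob_space_dos by (simp add: prob_space_def)
qed (use assms nn_integral_pker_dos_le Bd_nonneg in auto)

lemma wegner_cnt:
  assumes A: "A \<in> sets borel"
  shows "(\<integral>\<^sup>+w. ennreal (real (cnt N a w A)) \<partial>M) \<le> ennreal (real N * Bd) * emeasure lborel A"
proof -
  have "(\<integral>\<^sup>+w. ennreal (real (cnt N a w A)) \<partial>M) \<le> ennreal (real N) * (ennreal Bd * emeasure lborel A)"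
    unfolding nn_integral_cnt[OF A] by (intro mult_left_mono wegner A) auto
  then show ?thesis using Bd_nonneg by (simp add: ennreal_mult mult.assoc)
qed

text \<open>Minami's estimate, following Combes, Germinet and Klein: by rank-one interlacing the factor
  \<open>cnt - 1\<close> is bounded by a count that does not depend on the potential at \<open>x\<close>, so that the
  potential at \<open>x\<close> can be averaged in the first factor alone.\<close>
lemma minami:
  assumes y: "y > 0"
  shows "(\<integral>\<^sup>+w. ennreal (real (cnt N a w {E - y..E + y} * (cnt N a w {E - y..E + y} - 1))) \<partial>M)
    \<le> ennreal (pi * (2 * y * Bd * real N)\<^sup>2)"
proof -
  interpret symker "{..<N}" a by (rule symker_N)
  define c where "c = (\<lambda>w. cnt N a w {E - y..E + y})"
  define G where "G = (\<lambda>x w. Im (green {..<N} a w (Complex E y) x x))"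
  have cm [measurable]: "c \<in> measurable M (count_space UNIV)" unfolding c_def by (rule measurable_cnt) auto
  have Gm [measurable]: "G x \<in> borel_measurable M" if "x < N" for x
    unfolding G_def using y that by (rule measurable_Im_green(1))
  have G_nn: "G x w \<ge> 0" if "x < N" for x w
    unfolding G_def using Im_green_pos[of "Complex E y" x w] y that by simp
  have c_int: "(\<integral>\<^sup>+w. ennreal (real (c w)) \<partial>M) \<le> ennreal (real N * Bd * (2 * y))"
  proof -
    have "(\<integral>\<^sup>+w. ennreal (real (c w)) \<partial>M) \<le> ennreal (real N * Bd) * emeasure lborel {E - y..E + y}"
      unfolding c_def by (rule wegner_cnt) auto
    also have "\<dots> = ennreal (real N * Bd * (2 * y))"
      using y Bd_nonneg by (simp add: ennreal_mult)
    finally show ?thesis .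
  qed
  have one: "(\<integral>\<^sup>+w. ennreal (G x w) * ennreal (real (c w - 1)) \<partial>M) \<le> ennreal (pi * Bd) * ennreal (real N * Bd * (2 * y))"
    if x: "x < N" for x
  proof -
    note [measurable] = Gm[OF x]
    \<comment> \<open>The mean count after redrawing the site \<open>x\<close>. By interlacing it
      dominates \<open>c w - 1\<close>, and it no longer depends on \<open>w x\<close>, so it passes
      through the average over that site.\<close>
    define C where "C = (\<lambda>w. \<integral>\<^sup>+v. ennreal (real (c (w(x := v)))) \<partial>D)"
    have Cm [measurable]: "C \<in> borel_measurable M" unfolding C_def by (rule measurable_resample) measurable
    have Cle: "ennreal (real (c w - 1)) \<le> C w" for w
    proof -
      have "ennreal (real (c w - 1)) = (\<integral>\<^sup>+v. ennreal (real (c w - 1)) \<partial>D)" using D.emeasure_space_1 by simp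
      also have "\<dots> \<le> C w" unfolding C_def
      proof (intro nn_integral_mono ennreal_leI of_nat_mono)
        fix v
        have "c w \<le> c (w(x := v)) + 1" unfolding c_def using a_sym by (rule cnt_rank_one)
        then show "c w - 1 \<le> c (w(x := v))" by simp
      qed
      finally show ?thesis .
    qed
    have "(\<integral>\<^sup>+w. ennreal (G x w) * ennreal (real (c w - 1)) \<partial>M) \<le> (\<integral>\<^sup>+w. ennreal (G x w) * C w \<partial>M)"
      by (intro nn_integral_mono mult_left_mono Cle) auto
    also have "\<dots> = (\<integral>\<^sup>+w. (\<integral>\<^sup>+v. ennreal (G x (w(x := v))) * C (w(x := v)) \<partial>D) \<partial>M)"
      by (rule nn_integral_resample) measurable
    also have "\<dots> = (\<integral>\<^sup>+w. (\<integral>\<^sup>+v. ennreal (G x (w(x := v))) \<partial>D) * C w \<partial>M)"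
    proof (rule nn_integral_cong)
      fix w
      have Cw: "C (w(x := v)) = C w" for v by (simp add: C_def)
      have u: "(\<lambda>v. w(x := v)) \<in> measurable D M" by (rule measurable_upd) auto
      have Gw: "(\<lambda>v. ennreal (G x (w(x := v)))) \<in> borel_measurable D"
        by (rule measurable_compose[OF u, of "\<lambda>w. ennreal (G x w)"]) measurable
      show "(\<integral>\<^sup>+v. ennreal (G x (w(x := v))) * C (w(x := v)) \<partial>D) = (\<integral>\<^sup>+v. ennreal (G x (w(x := v))) \<partial>D) * C w"
        unfolding Cw by (rule nn_integral_multc[OF Gw])
    qed
    also have "\<dots> \<le> (\<integral>\<^sup>+w. ennreal (pi * Bd) * C w \<partial>M)"
      unfolding G_def using y x by (intro nn_integral_mono mult_right_mono spectral_averaging symker_N) auto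
    also have "\<dots> = ennreal (pi * Bd) * (\<integral>\<^sup>+w. C w \<partial>M)" by (rule nn_integral_cmult) measurable
    also have "(\<integral>\<^sup>+w. C w \<partial>M) = (\<integral>\<^sup>+w. ennreal (real (c w)) \<partial>M)"
      unfolding C_def by (rule nn_integral_resample[symmetric]) measurable
    also have "ennreal (pi * Bd) * \<dots> \<le> ennreal (pi * Bd) * ennreal (real N * Bd * (2 * y))"
      by (intro mult_left_mono c_int) auto
    finally show ?thesis .
  qed
  have "(\<integral>\<^sup>+w. ennreal (real (c w * (c w - 1))) \<partial>M) \<le>
     (\<integral>\<^sup>+w. ennreal (2 * y) * (\<Sum>x<N. ennreal (G x w) * ennreal (real (c w - 1))) \<partial>M)"
  proof (rule nn_integral_mono)
    fix w
    have "real (c w * (c w - 1)) = real (c w) * real (c w - 1)" by simp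
    also have "\<dots> \<le> (2 * y * (\<Sum>x<N. G x w)) * real (c w - 1)"
      unfolding c_def G_def using a_sym y by (intro mult_right_mono cnt_le_sum_Im_green) auto
    finally have "ennreal (real (c w * (c w - 1))) \<le> ennreal (2 * y * (\<Sum>x<N. G x w * real (c w - 1)))"
      by (intro ennreal_leI) (simp add: sum_distrib_right mult.assoc)
    also have "\<dots> = ennreal (2 * y) * (\<Sum>x<N. ennreal (G x w * real (c w - 1)))"
      using y G_nn by (subst sum_ennreal) (auto intro!: ennreal_mult sum_nonneg)
    also have "(\<Sum>x<N. ennreal (G x w * real (c w - 1))) = (\<Sum>x<N. ennreal (G x w) * ennreal (real (c w - 1)))"
      using G_nn by (intro sum.cong refl ennreal_mult) auto
    finally show "ennreal (real (c w * (c w - 1))) \<le> ennreal (2 * y) * (\<Sum>x<N. ennreal (G x w) * ennreal (real (c w - 1)))" .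
  qed
  also have "\<dots> = ennreal (2 * y) * (\<integral>\<^sup>+w. (\<Sum>x<N. ennreal (G x w) * ennreal (real (c w - 1))) \<partial>M)"
    by (rule nn_integral_cmult) (use Gm in measurable)
  also have "(\<integral>\<^sup>+w. (\<Sum>x<N. ennreal (G x w) * ennreal (real (c w - 1))) \<partial>M) =
     (\<Sum>x<N. \<integral>\<^sup>+w. ennreal (G x w) * ennreal (real (c w - 1)) \<partial>M)"
    by (rule nn_integral_sum) (use Gm in measurable)
  \<comment> \<open>Each of the \<open>N\<close> sites costs \<open>pi * Bd\<close> by spectral
    averaging and \<open>N * Bd * (2 * y)\<close> by Wegner; the remaining \<open>2 * y\<close>
    stems from \<open>cnt_le_sum_Im_green\<close>.\<close>
  also have "ennreal (2 * y) * \<dots> \<le> ennreal (2 * y) * (\<Sum>x<N. ennreal (pi * Bd) * ennreal (real N * Bd * (2 * y)))"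
    by (intro mult_left_mono sum_mono one) auto
  also have "\<dots> = ennreal (pi * (2 * y * Bd * real N)\<^sup>2)"
    using y Bd_nonneg by (simp add: ennreal_of_nat_eq_real_of_nat power2_eq_square ac_simps flip: ennreal_mult)
  finally show ?thesis unfolding c_def .
qed

end

section \<open>The hierarchical Laplacian\<close>

definition hker :: "nat \<Rightarrow> (nat \<Rightarrow> real) \<Rightarrow> nat \<Rightarrow> nat \<Rightarrow> nat \<Rightarrow> real" where
  "hker n p l x y = (\<Sum>s\<in>{1..l}. p s / real n ^ s * (if x div n ^ s = y div n ^ s then 1 else 0))"

lemma hker_sym: "hker n p l x y = hker n p l y x"
  by (auto simp: hker_def intro!: sum.cong)

lemma shifted_div:
  assumes "s \<le> k" "n > 0"
  shows "(c * n ^ k + i) div n ^ s = c * n ^ (k - s) + i div (n::nat) ^ s"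
proof -
  have "n ^ k = n ^ s * n ^ (k - s)" using assms(1) by (simp add: power_add[symmetric])
  then have eq: "c * n ^ k + i = i + n ^ s * (c * n ^ (k - s))" by (simp only: ac_simps)
  show ?thesis unfolding eq using assms(2) by simp
qed

text \<open>A shift by a multiple of \<open>n ^ k\<close> does not affect which points share a ball
  at levels \<open>s \<le> k\<close>, so the ball around \<open>x0\<close> can be exchanged for the
  initial one with a shifted potential.\<close>

lemma hHk_mat_eq_Hm:
  assumes "n > 0"
  shows "hHk_mat n p x0 k w = Hm (n ^ k) (hker n p k) (\<lambda>i. w (x0 div n ^ k * n ^ k + i))"
  using assms by (auto simp: hHk_mat_def Let_def Hm_def hker_def shifted_div intro!: eq_matI sum.cong)

section \<open>Hierarchical balls and their symmetries\<close>

lemma hball_eq: "n > 0 \<Longrightarrow> hball n x r = {x div n ^ r * n ^ r..<x div n ^ r * n ^ r + n ^ r}"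
proof -
  assume "n > 0"
  then have "0 < n ^ r" by simp
  then have "y div n ^ r = q \<longleftrightarrow> q * n ^ r \<le> y \<and> y < q * n ^ r + n ^ r" for y q
    using div_nat_eqI[of "n ^ r" q y] div_times_less_eq_dividend[of y "n ^ r"] dividend_less_div_times[of "n ^ r" y]
    by (auto simp: mult.commute)
  then show ?thesis by (auto simp: hball_def)
qed

lemma finite_hball [simp]: "n > 0 \<Longrightarrow> finite (hball n x r)"
  by (simp add: hball_eq)

lemma card_hball: "n > 0 \<Longrightarrow> card (hball n x r) = n ^ r"
  by (simp add: hball_eq)

lemma hball_self [simp]: "x \<in> hball n x r"
  by (simp add: hball_def)

lemma hball_cong: "y \<in> hball n x r \<Longrightarrow> hball n y r = hball n x r"
  by (auto simp: hball_def)

lemma div_pow_mono: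
  assumes "s \<le> r" "x div n ^ s = y div (n::nat) ^ s"
  shows "x div n ^ r = y div n ^ r"
proof -
  have "z div n ^ r = (z div n ^ s) div n ^ (r - s)" for z
    using assms(1) by (simp add: div_mult2_eq[symmetric] power_add[symmetric])
  then show ?thesis using assms(2) by simp
qed

lemma hball_mono: "s \<le> r \<Longrightarrow> hball n x s \<subseteq> hball n x r"
  unfolding hball_def using div_pow_mono by blast

lemma hball_subset: "s \<le> r \<Longrightarrow> y \<in> hball n x r \<Longrightarrow> hball n y s \<subseteq> hball n x r"
  using hball_mono hball_cong by blast

text \<open>From some level on both points have quotient zero: the balls around any point exhaust
  the whole space.\<close>

lemma eventually_in_hball:
  assumes "n \<ge> 2"
  shows "\<forall>\<^sub>F k in sequentially. y \<in> hball n x k"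
proof -
  have "y \<in> hball n x k" if "k \<ge> max x y" for k
  proof -
    have "k < n ^ k" using assms by (rule_tac less_le_trans[OF less_exp]) (auto intro: power_mono)
    then have "x < n ^ k" "y < n ^ k" using that by auto
    then show ?thesis by (simp add: hball_def)
  qed
  then show ?thesis by (rule eventually_sequentiallyI)
qed

text \<open>Addition of base-\<open>n\<close> digits: without carries in the lowest \<open>l\<close>
  digits, ordinary addition above them. Ordinary translation does not map balls to balls because of
  carries; this substitute respects all levels up to \<open>l\<close> and moves 0 to
  \<open>b\<close>.\<close>

fun dadd :: "nat \<Rightarrow> nat \<Rightarrow> nat \<Rightarrow> nat \<Rightarrow> nat" where
  "dadd n 0 b x = b + x"
| "dadd n (Suc l) b x = n * dadd n l (b div n) (x div n) + (x + b) mod n"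

text \<open>Without carries, dropping the lowest \<open>s\<close> digits commutes with the
  addition.\<close>

lemma dadd_div: "n > 0 \<Longrightarrow> s \<le> l \<Longrightarrow> dadd n l b x div n ^ s = dadd n (l - s) (b div n ^ s) (x div n ^ s)"
proof (induction s)
  case (Suc s)
  have "dadd n l b x div n ^ Suc s = (dadd n l b x div n ^ s) div n"
    by (simp add: div_mult2_eq[symmetric] mult.commute)
  also have "\<dots> = dadd n (Suc (l - Suc s)) (b div n ^ s) (x div n ^ s) div n"
    using Suc by (simp add: Suc_diff_Suc)
  also have "\<dots> = dadd n (l - Suc s) (b div n ^ Suc s) (x div n ^ Suc s)"
    using Suc.prems(1) by (simp add: div_mult2_eq[symmetric] mult.commute)
  finally show ?case .
qed simp

lemma inj_dadd: "n > 0 \<Longrightarrow> inj (dadd n l b)"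
proof (induction l arbitrary: b)
  case 0
  then show ?case by (auto simp: inj_def)
next
  case (Suc l)
  show ?case
  proof (rule injI)
    fix x y assume eq: "dadd n (Suc l) b x = dadd n (Suc l) b y"
    have "dadd n (Suc l) b x div n = dadd n (Suc l) b y div n" using eq by simp
    then have "dadd n l (b div n) (x div n) = dadd n l (b div n) (y div n)" using Suc.prems by simp
    then have d: "x div n = y div n" using Suc by (simp add: inj_eq)
    have "dadd n (Suc l) b x mod n = dadd n (Suc l) b y mod n" using eq by simp
    then have "(x + b) mod n = (y + b) mod n" by simp
    then have "int (x + b) mod int n = int (y + b) mod int n" by (metis of_nat_mod)
    then have "int n dvd int (x + b) - int (y + b)" by (simp only: mod_eq_dvd_iff)
    then have "int x mod int n = int y mod int n" by (simp add: mod_eq_dvd_iff)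
    then have "x mod n = y mod n" by (metis of_nat_mod of_nat_eq_iff)
    then show "x = y" using d by (metis div_mult_mod_eq)
  qed
qed

lemma dadd_zero: "dadd n l b 0 = b"
  by (induction l arbitrary: b) auto

lemma dadd_div_eq_iff:
  "n > 0 \<Longrightarrow> s \<le> l \<Longrightarrow> dadd n l b x div n ^ s = dadd n l b y div n ^ s \<longleftrightarrow> x div n ^ s = y div n ^ s"
  using inj_dadd[of n "l - s" "b div n ^ s"] by (simp add: dadd_div inj_eq)

lemma hker_dadd: "n > 0 \<Longrightarrow> hker n p l (dadd n l b x) (dadd n l b y) = hker n p l x y"
  by (auto simp: hker_def dadd_div_eq_iff intro!: sum.cong)

lemma image_dadd: "n > 0 \<Longrightarrow> dadd n l b ` {..<n ^ l} = hball n b l"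
proof (rule card_subset_eq)
  assume n: "n > 0"
  show "finite (hball n b l)" using n by simp
  show "dadd n l b ` {..<n ^ l} \<subseteq> hball n b l"
    using n by (auto simp: hball_def dadd_div)
  show "card (dadd n l b ` {..<n ^ l}) = card (hball n b l)"
    using n inj_dadd[OF n, of l b] by (subst card_image) (auto simp: card_hball intro: inj_on_subset)
qed

text \<open>A relabelling of sites that preserves the kernel transports the resolvent equation,
  whose solution is unique.\<close>

lemma green_equivariant:
  assumes S: "symker S a'" and T: "symker T a" and f: "inj_on f T" "f ` T = S"
    and ker: "\<And>x y. x \<in> T \<Longrightarrow> y \<in> T \<Longrightarrow> a' (f x) (f y) = a x y"
    and z: "Im z > 0" and xy: "x \<in> T" "y \<in> T"
  shows "green S a' w z (f x) (f y) = green T a (\<lambda>i. w (f i)) z x y"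
proof -
  interpret S: symker S a' by fact
  interpret T: symker T a by fact
  let ?g = "green S a' w z (f x)"
  have "green T a (\<lambda>i. w (f i)) z x y = ?g (f y)"
  proof (rule T.green_unique[OF z xy])
    fix v assume v: "v \<in> T"
    have "(\<Sum>u\<in>S. of_real (a' (f v) u) * ?g u) = (\<Sum>u\<in>T. of_real (a' (f v) (f u)) * ?g (f u))"
      unfolding f(2)[symmetric] using f(1) by (simp add: sum.reindex)
    also have "\<dots> = (\<Sum>u\<in>T. of_real (a v u) * ?g (f u))" using ker v by (intro sum.cong) auto
    finally have "hop T a (\<lambda>i. w (f i)) (\<lambda>u. ?g (f u)) v = hop S a' w ?g (f v)" by (simp add: hop_def)
    then show "hop T a (\<lambda>i. w (f i)) (\<lambda>u. ?g (f u)) v - z * ?g (f v) = (if v = x then 1 else 0)"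
      using S.green_eq(1)[OF z, of "f x" "f v" w] v xy f by (auto simp: inj_on_eq_iff)
  qed
  then show ?thesis by simp
qed

lemma symker_hker: "finite S \<Longrightarrow> symker S (hker n p l)"
  by unfold_locales (auto simp: hker_sym)

locale hierarchy =
  fixes n :: nat and p :: "nat \<Rightarrow> real"
  assumes n2: "n \<ge> 2" and p_pos: "s \<ge> 1 \<Longrightarrow> p s > 0" and p_sum: "(\<lambda>r. p (Suc r)) sums 1"
begin

lemma n_pos [simp]: "n > 0" using n2 by simp

text \<open>The mass of \<open>p\<close> above level \<open>l\<close>, written through the finitely
  many levels below. It bounds the norm of the discarded part of the Laplacian, each averaging
  operator having norm at most one.\<close>

definition tail :: "nat \<Rightarrow> real" where "tail l = 1 - (\<Sum>s\<in>{1..l}. p s)"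

lemma sum_Icc_Suc: "(\<Sum>s\<in>{1..l}. f s) = (\<Sum>r<l. f (Suc r))" for f :: "nat \<Rightarrow> 'b::comm_monoid_add"
  by (rule sum.reindex_bij_witness[of _ Suc "\<lambda>s. s - 1"]) auto

lemma tail_sums: "(\<lambda>r. p (Suc (r + l))) sums tail l"
  unfolding tail_def sum_Icc_Suc using sums_split_initial_segment[OF p_sum, of l] by simp

lemma tail_nonneg: "tail l \<ge> 0"
  using sums_le[OF _ sums_zero tail_sums[of l]] p_pos by (auto intro: less_imp_le)

lemma tail_tendsto: "tail \<longlonglongrightarrow> 0"
proof -
  have "(\<lambda>l. \<Sum>r<l. p (Suc r)) \<longlonglongrightarrow> 1" using p_sum by (simp add: sums_def)
  from tendsto_diff[OF tendsto_const[of 1] this] show ?thesis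
    unfolding tail_def sum_Icc_Suc by simp
qed

lemma sum_split_Icc:
  fixes f :: "nat \<Rightarrow> 'b::comm_monoid_add"
  assumes "l \<le> k"
  shows "sum f {1..k} = sum f {1..l} + sum f {l<..k}"
proof -
  have e: "{1..k} = {1..l} \<union> {l<..k}" using assms by auto
  show ?thesis unfolding e by (rule sum.union_disjoint) auto
qed

lemma sum_p_le_tail: "(\<Sum>s\<in>{l<..m}. p s) \<le> tail l"
proof (cases "l \<le> m")
  case True
  have "(\<Sum>s\<in>{1..m}. p s) = (\<Sum>s\<in>{1..l}. p s) + (\<Sum>s\<in>{l<..m}. p s)"
    using True by (rule sum_split_Icc)
  then show ?thesis using tail_nonneg[of m] by (simp add: tail_def)
qed (simp add: tail_nonneg)

lemma row_sum_le:
  assumes "finite S" "s \<ge> 1"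
  shows "(\<Sum>y\<in>S. p s / real n ^ s * (if x div n ^ s = y div n ^ s then 1 else 0)) \<le> p s"
proof -
  have "(\<Sum>y\<in>S. p s / real n ^ s * (if x div n ^ s = y div n ^ s then 1 else 0)) =
      p s / real n ^ s * (\<Sum>y\<in>S. if y \<in> hball n x s then 1 else 0)"
    by (simp add: sum_distrib_left hball_def eq_commute)
  also have "(\<Sum>y\<in>S. if y \<in> hball n x s then 1 else (0::real)) = real (card (S \<inter> hball n x s))"
    using assms by (simp add: sum.If_cases)
  also have "p s / real n ^ s * \<dots> \<le> p s / real n ^ s * real (card (hball n x s))"
    using p_pos[OF assms(2)] by (intro mult_left_mono of_nat_mono card_mono) auto
  also have "p s / real n ^ s * real (card (hball n x s)) = p s" by (simp add: card_hball)
  finally show ?thesis .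
qed

lemma hker_diff: "l \<le> k \<Longrightarrow> hker n p k x y - hker n p l x y =
    (\<Sum>s\<in>{l<..k}. p s / real n ^ s * (if x div n ^ s = y div n ^ s then 1 else 0))"
  unfolding hker_def by (subst sum_split_Icc) auto

text \<open>The averaging kernel at level \<open>s\<close> has row sums at most one, so that level
  contributes at most \<open>p s\<close>. Restricting the columns to \<open>S\<close> can only lower
  the sums.\<close>

lemma row_sum_diff_le:
  assumes "finite S" "l \<le> k"
  shows "(\<Sum>y\<in>S. \<bar>hker n p k x y - hker n p l x y\<bar>) \<le> tail l"
proof -
  have "(\<Sum>y\<in>S. \<bar>hker n p k x y - hker n p l x y\<bar>) =
     (\<Sum>y\<in>S. \<Sum>s\<in>{l<..k}. p s / real n ^ s * (if x div n ^ s = y div n ^ s then 1 else 0))"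
    unfolding hker_diff[OF assms(2)] using p_pos
    by (intro sum.cong refl abs_of_nonneg sum_nonneg) (auto intro: less_imp_le)
  also have "\<dots> = (\<Sum>s\<in>{l<..k}. \<Sum>y\<in>S. p s / real n ^ s * (if x div n ^ s = y div n ^ s then 1 else 0))"
    by (rule sum.swap)
  also have "\<dots> \<le> (\<Sum>s\<in>{l<..k}. p s)" by (intro sum_mono row_sum_le assms) auto
  also have "\<dots> \<le> tail l" by (rule sum_p_le_tail)
  finally show ?thesis .
qed

section \<open>From finite-volume Green's functions to the infinite-volume resolvent\<close>

lemma hop_hball:
  assumes x: "x \<in> hball n x0 l"
  shows "hop (hball n x0 l) (hker n p l) w \<psi> x = (\<Sum>s\<in>{1..l}. of_real (p s) * hE n s \<psi> x) + of_real (w x) * \<psi> x"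
proof -
  let ?S = "hball n x0 l"
  have "(\<Sum>y\<in>?S. of_real (hker n p l x y) * \<psi> y) =
     (\<Sum>y\<in>?S. \<Sum>s\<in>{1..l}. of_real (p s) / of_nat n ^ s * (if y \<in> hball n x s then \<psi> y else 0))"
    unfolding hker_def of_real_sum sum_distrib_right
    by (intro sum.cong refl) (auto simp: hball_def)
  also have "\<dots> = (\<Sum>s\<in>{1..l}. \<Sum>y\<in>?S. of_real (p s) / of_nat n ^ s * (if y \<in> hball n x s then \<psi> y else 0))"
    by (rule sum.swap)
  also have "\<dots> = (\<Sum>s\<in>{1..l}. of_real (p s) * hE n s \<psi> x)"
  proof (intro sum.cong refl)
    fix s assume s: "s \<in> {1..l}"
    have sub: "hball n x s \<subseteq> ?S" using s x by (intro hball_subset) auto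
    have "(\<Sum>y\<in>?S. if y \<in> hball n x s then \<psi> y else 0) = (\<Sum>y\<in>hball n x s. \<psi> y)"
      using sub by (simp add: sum.If_cases Int_absorb1)
    then show "(\<Sum>y\<in>?S. of_real (p s) / of_nat n ^ s * (if y \<in> hball n x s then \<psi> y else 0)) = of_real (p s) * hE n s \<psi> x"
      unfolding sum_distrib_left[symmetric] by (simp add: hE_def)
  qed
  finally show ?thesis by (simp add: hop_def)
qed

text \<open>Cauchy-Schwarz on a ball of \<open>n ^ s\<close> points: averages of a square-summable
  function decay like the inverse root of the volume. A uniform bound over finite sets expresses
  square-summability here.\<close>

lemma norm_hE_le:
  assumes C: "\<And>F. finite F \<Longrightarrow> l2 F \<psi> \<le> C"
  shows "cmod (hE n s \<psi> x) \<le> C / sqrt (real n ^ s)"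
proof -
  let ?S = "hball n x s"
  have "cmod (\<Sum>y\<in>?S. \<psi> y) \<le> (\<Sum>y\<in>?S. \<bar>1\<bar> * \<bar>cmod (\<psi> y)\<bar>)" by (rule order.trans[OF norm_sum]) simp
  also have "\<dots> \<le> L2_set (\<lambda>_. 1) ?S * l2 ?S \<psi>" unfolding l2_def by (rule L2_set_mult_ineq)
  also have "L2_set (\<lambda>_. 1) ?S = sqrt (real n ^ s)" by (simp add: L2_set_def card_hball)
  also have "sqrt (real n ^ s) * l2 ?S \<psi> \<le> sqrt (real n ^ s) * C" by (intro mult_left_mono C) auto
  finally have "cmod (hE n s \<psi> x) \<le> sqrt (real n ^ s) * C / real n ^ s"
    by (simp add: hE_def norm_divide norm_power divide_right_mono)
  also have "\<dots> = C / sqrt (real n ^ s)"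
  proof -
    have "real n ^ s = sqrt (real n ^ s) * sqrt (real n ^ s)" by simp
    then show ?thesis by (metis mult_divide_mult_cancel_left n_pos of_nat_0_less_iff real_sqrt_gt_0_iff zero_less_power less_irrefl)
  qed
  finally show ?thesis .
qed

lemma norm_hE_le_const:
  assumes C: "\<And>F. finite F \<Longrightarrow> l2 F \<psi> \<le> C" and C0: "C \<ge> 0" and ls: "l \<le> s"
  shows "cmod (hE n s \<psi> x) \<le> C / sqrt (real n ^ l)"
proof -
  have "C / sqrt (real n ^ s) \<le> C / sqrt (real n ^ l)"
    using C0 ls n2 by (intro divide_left_mono real_sqrt_le_mono power_increasing mult_pos_pos) auto
  then show ?thesis using norm_hE_le[OF C] order.trans by blast
qed

text \<open>Summing the pointwise bound in l2 over the \<open>n ^ l\<close> points of the ball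
  consumes exactly the factor \<open>1 / sqrt (real n ^ l)\<close>, so the estimate carries no
  volume factor.\<close>

lemma green_hball_stability:
  assumes z: "Im z > 0" and C: "C \<ge> 0"
    and eq: "\<And>x. x \<in> hball n x0 l \<Longrightarrow> hop (hball n x0 l) (hker n p l) w \<psi> x - z * \<psi> x = (if x = x0 then 1 else 0) + r x"
    and r: "\<And>x. x \<in> hball n x0 l \<Longrightarrow> cmod (r x) \<le> tail l * (C / sqrt (real n ^ l))"
    and x: "x \<in> hball n x0 l"
  shows "cmod (\<psi> x - green (hball n x0 l) (hker n p l) w z x0 x) \<le> tail l * C / Im z"
proof -
  let ?S = "hball n x0 l"
  interpret symker ?S "hker n p l" by (rule symker_hker) simp
  have "l2 ?S r \<le> sqrt (\<Sum>x\<in>?S. (tail l * (C / sqrt (real n ^ l)))\<^sup>2)"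
    unfolding l2_def L2_set_def using r by (intro real_sqrt_le_mono sum_mono power_mono) auto
  also have "\<dots> = sqrt ((tail l * C)\<^sup>2)"
    by (intro arg_cong[where f = sqrt]) (simp add: card_hball power_divide power_mult_distrib)
  also have "\<dots> = tail l * C" using tail_nonneg C by simp
  finally have rl: "l2 ?S r \<le> tail l * C" .
  have "cmod (\<psi> x - green ?S (hker n p l) w z x0 x) \<le> l2 ?S (\<lambda>y. \<psi> y - green ?S (hker n p l) w z x0 y)"
    using x by (intro norm_le_l2) auto
  also have "\<dots> \<le> l2 ?S r / Im z" by (rule green_stability[OF z]) (use eq in auto)
  also have "\<dots> \<le> tail l * C / Im z" using rl z by (intro divide_right_mono) auto
  finally show ?thesis .
qed

text \<open>Radius and truncation level coincide, so the ball is invariant under the truncated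
  operator and its boundary causes no error.\<close>

definition gball :: "nat \<Rightarrow> (nat \<Rightarrow> real) \<Rightarrow> complex \<Rightarrow> nat \<Rightarrow> nat \<Rightarrow> complex" where
  "gball x0 w z l = green (hball n x0 l) (hker n p l) w z x0"

lemma gball_eq:
  assumes z: "Im z > 0" and x: "x \<in> hball n x0 m"
  shows "(\<Sum>s\<in>{1..m}. of_real (p s) * hE n s (gball x0 w z m) x) + of_real (w x) * gball x0 w z m x - z * gball x0 w z m x
    = (if x = x0 then 1 else 0)"
proof -
  interpret symker "hball n x0 m" "hker n p m" by (rule symker_hker) simp
  show ?thesis using green_eq(1)[OF z hball_self x, of w] hop_hball[OF x, of w "gball x0 w z m"]
    by (simp add: gball_def)
qed

lemma l2_gball:
  assumes z: "Im z > 0" and F: "finite F"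
  shows "l2 F (gball x0 w z m) \<le> 1 / Im z"
proof -
  interpret symker "hball n x0 m" "hker n p m" by (rule symker_hker) simp
  have out: "gball x0 w z m x = 0" if "x \<notin> hball n x0 m" for x
    unfolding gball_def using green_eq(2)[OF z hball_self that] by simp
  have "(l2 F (gball x0 w z m))\<^sup>2 \<le> (\<Sum>x\<in>F \<union> hball n x0 m. (cmod (gball x0 w z m x))\<^sup>2)"
    unfolding l2_power2 using F by (intro sum_mono2) auto
  also have "\<dots> = (l2 (hball n x0 m) (gball x0 w z m))\<^sup>2"
    unfolding l2_power2 using F out by (intro sum.mono_neutral_right) auto
  finally have "l2 F (gball x0 w z m) \<le> l2 (hball n x0 m) (gball x0 w z m)"
    by (simp add: power2_le_iff_abs_le)
  also have "\<dots> \<le> 1 / Im z" unfolding gball_def by (rule l2_green_le[OF z]) simp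
  finally show ?thesis .
qed

text \<open>Seen from the smaller ball, the larger Green's function solves the smaller equation with
  the averages at levels between \<open>l\<close> and \<open>m\<close> as defect, and these are
  small by \<open>norm_hE_le_const\<close>.\<close>

lemma gball_close:
  assumes z: "Im z > 0" and lm: "l \<le> m" and x: "x \<in> hball n x0 l"
  shows "cmod (gball x0 w z m x - gball x0 w z l x) \<le> tail l / (Im z)\<^sup>2"
proof -
  let ?g = "gball x0 w z m"
  define r where "r = (\<lambda>x. - (\<Sum>s\<in>{l<..m}. of_real (p s) * hE n s ?g x))"
  have "cmod (?g x - green (hball n x0 l) (hker n p l) w z x0 x) \<le> tail l * (1 / Im z) / Im z"
  proof (rule green_hball_stability[OF z])
    fix y assume y: "y \<in> hball n x0 l"
    have ym: "y \<in> hball n x0 m" using y hball_mono[OF lm] by blast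
    have "(\<Sum>s\<in>{1..m}. of_real (p s) * hE n s ?g y) =
        (\<Sum>s\<in>{1..l}. of_real (p s) * hE n s ?g y) + (\<Sum>s\<in>{l<..m}. of_real (p s) * hE n s ?g y)"
      by (rule sum_split_Icc[OF lm])
    then show "hop (hball n x0 l) (hker n p l) w ?g y - z * ?g y = (if y = x0 then 1 else 0) + r y"
      using gball_eq[OF z ym, of w] unfolding hop_hball[OF y] r_def by (simp add: algebra_simps split: if_splits)
    have "cmod (r y) \<le> (\<Sum>s\<in>{l<..m}. p s * (1 / Im z / sqrt (real n ^ l)))"
      unfolding r_def norm_minus_cancel
    proof (rule order.trans[OF norm_sum], rule sum_mono)
      fix s assume s: "s \<in> {l<..m}"
      have "cmod (hE n s ?g y) \<le> 1 / Im z / sqrt (real n ^ l)"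
        using s z by (intro norm_hE_le_const l2_gball) auto
      then have "p s * cmod (hE n s ?g y) \<le> p s * (1 / Im z / sqrt (real n ^ l))"
        using p_pos[of s] s by (intro mult_left_mono) auto
      then show "cmod (of_real (p s) * hE n s ?g y) \<le> p s * (1 / Im z / sqrt (real n ^ l))"
        using p_pos[of s] s by (simp add: norm_mult)
    qed
    also have "\<dots> \<le> tail l * (1 / Im z / sqrt (real n ^ l))"
      unfolding sum_distrib_right[symmetric] using z by (intro mult_right_mono sum_p_le_tail) auto
    finally show "cmod (r y) \<le> tail l * (1 / Im z / sqrt (real n ^ l))" .
  qed (use z x in auto)
  then show ?thesis by (simp add: gball_def power2_eq_square)
qed

lemma hE_series_summable:
  assumes C: "\<And>F. finite F \<Longrightarrow> l2 F \<psi> \<le> C" and C0: "C \<ge> 0"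
  shows "summable (\<lambda>r. of_real (p (Suc r)) * hE n (Suc r) \<psi> x)"
proof (rule summable_comparison_test')
  show "summable (\<lambda>r. p (Suc r) * C)" using p_sum by (intro summable_mult2) (auto simp: sums_iff)
  fix r
  have "cmod (hE n (Suc r) \<psi> x) \<le> C" using norm_hE_le_const[OF C C0, of 0 "Suc r"] by simp
  then show "cmod (of_real (p (Suc r)) * hE n (Suc r) \<psi> x) \<le> p (Suc r) * C"
    using p_pos[of "Suc r"] by (simp add: norm_mult mult_left_mono)
qed

text \<open>The same comparison with all higher levels discarded. Letting \<open>l\<close> grow, any
  square-summable solution is pinned at \<open>x0\<close> to the limit of the finite-volume values,
  which is uniqueness for the resolvent entry.\<close>

lemma gball_close_solution:
  assumes z: "Im z > 0" and C: "\<And>F. finite F \<Longrightarrow> l2 F \<psi> \<le> C" and C0: "C \<ge> 0"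
    and sol: "\<And>x. hH n p w \<psi> x - z * \<psi> x = (if x = x0 then 1 else 0)"
  shows "cmod (\<psi> x0 - gball x0 w z l x0) \<le> tail l * C / Im z"
proof -
  define r where "r = (\<lambda>x. - (\<Sum>r. of_real (p (Suc (r + l))) * hE n (Suc (r + l)) \<psi> x))"
  show ?thesis unfolding gball_def
  proof (rule green_hball_stability[OF z C0])
    fix y assume y: "y \<in> hball n x0 l"
    have "(\<Sum>r. of_real (p (Suc r)) * hE n (Suc r) \<psi> y) =
       (\<Sum>r. of_real (p (Suc (r + l))) * hE n (Suc (r + l)) \<psi> y) + (\<Sum>s\<in>{1..l}. of_real (p s) * hE n s \<psi> y)"
      unfolding sum_Icc_Suc by (rule suminf_split_initial_segment[OF hE_series_summable[OF C C0]])
    then show "hop (hball n x0 l) (hker n p l) w \<psi> y - z * \<psi> y = (if y = x0 then 1 else 0) + r y"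
      using sol[of y] unfolding hop_hball[OF y] r_def hH_def by (simp add: algebra_simps split: if_splits)
    let ?c = "C / sqrt (real n ^ l)"
    have le: "cmod (of_real (p (Suc (r + l))) * hE n (Suc (r + l)) \<psi> y) \<le> p (Suc (r + l)) * ?c" for r
    proof -
      have "p (Suc (r + l)) * cmod (hE n (Suc (r + l)) \<psi> y) \<le> p (Suc (r + l)) * ?c"
        using p_pos[of "Suc (r + l)"] by (intro mult_left_mono norm_hE_le_const[OF C C0]) auto
      then show ?thesis using p_pos[of "Suc (r + l)"] by (simp add: norm_mult)
    qed
    have s: "(\<lambda>r. p (Suc (r + l)) * ?c) sums (tail l * ?c)" by (intro sums_mult2 tail_sums)
    have sn: "summable (\<lambda>r. cmod (of_real (p (Suc (r + l))) * hE n (Suc (r + l)) \<psi> y))"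
      by (rule summable_comparison_test'[OF sums_summable[OF s]]) (use le in auto)
    have "cmod (r y) \<le> (\<Sum>r. cmod (of_real (p (Suc (r + l))) * hE n (Suc (r + l)) \<psi> y))"
      unfolding r_def norm_minus_cancel by (rule summable_norm[OF sn])
    also have "\<dots> \<le> tail l * ?c" using suminf_le[OF le sn sums_summable[OF s]] s by (simp add: sums_iff)
    finally show "cmod (r y) \<le> tail l * ?c" .
  qed simp
qed

text \<open>By \<open>gball_close\<close> the finite-volume functions are Cauchy at each site. The
  limit passes through the sum over levels by Tannery's theorem, and the equation itself bounds the
  potential term, which puts the limit into the domain.\<close>

lemma gball_limit_solution:
  assumes z: "Im z > 0"
  obtains \<psi> where "\<psi> \<in> hdom w" "\<And>x. hH n p w \<psi> x - z * \<psi> x = (if x = x0 then 1 else 0)"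
    "\<And>x. (\<lambda>m. gball x0 w z m x) \<longlonglongrightarrow> \<psi> x" "\<And>F. finite F \<Longrightarrow> l2 F \<psi> \<le> 1 / Im z"
proof -
  let ?g = "gball x0 w z"
  have "convergent (\<lambda>m. ?g m x)" for x
  proof (rule Cauchy_convergent, rule metric_CauchyI)
    fix e :: real assume e: "e > 0"
    have "(\<lambda>l. 2 * (tail l / (Im z)\<^sup>2)) \<longlonglongrightarrow> 2 * (0 / (Im z)\<^sup>2)"
      using z by (intro tendsto_intros tail_tendsto) auto
    then have "\<forall>\<^sub>F l in sequentially. 2 * (tail l / (Im z)\<^sup>2) < e"
      using e by (intro order_tendstoD) auto
    with eventually_in_hball[OF n2, of x x0]
    have "\<forall>\<^sub>F l in sequentially. x \<in> hball n x0 l \<and> 2 * (tail l / (Im z)\<^sup>2) < e" by eventually_elim auto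
    then have "\<exists>l. x \<in> hball n x0 l \<and> 2 * (tail l / (Im z)\<^sup>2) < e" by (rule eventually_happens'[OF sequentially_bot])
    then obtain l where l: "x \<in> hball n x0 l" "2 * (tail l / (Im z)\<^sup>2) < e" by blast
    have "dist (?g m x) (?g m' x) < e" if "m \<ge> l" "m' \<ge> l" for m m'
    proof -
      have "dist (?g m x) (?g m' x) \<le> dist (?g m x) (?g l x) + dist (?g m' x) (?g l x)" by (rule dist_triangle2)
      also have "\<dots> \<le> 2 * (tail l / (Im z)\<^sup>2)"
        using gball_close[OF z that(1) l(1), of w] gball_close[OF z that(2) l(1), of w] by (simp add: dist_norm)
      finally show ?thesis using l(2) by simp
    qed
    then show "\<exists>M. \<forall>m\<ge>M. \<forall>n\<ge>M. dist (?g m x) (?g n x) < e" by blast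
  qed
  then have "\<forall>x. \<exists>L. (\<lambda>m. ?g m x) \<longlonglongrightarrow> L" by (simp add: convergent_def)
  then obtain \<psi> where \<psi>: "\<And>x. (\<lambda>m. ?g m x) \<longlonglongrightarrow> \<psi> x" by metis
  have l2\<psi>: "l2 F \<psi> \<le> 1 / Im z" if "finite F" for F
  proof (rule LIMSEQ_le_const2)
    show "(\<lambda>m. l2 F (?g m)) \<longlonglongrightarrow> l2 F \<psi>" unfolding l2_def L2_set_def by (intro tendsto_intros \<psi>)
  qed (use l2_gball[OF z that] in auto)
  have hE_lim: "(\<lambda>m. hE n s (?g m) x) \<longlonglongrightarrow> hE n s \<psi> x" for s x
    unfolding hE_def by (intro tendsto_intros \<psi>) auto
  have sol: "hH n p w \<psi> x - z * \<psi> x = (if x = x0 then 1 else 0)" for x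
  proof -
    \<comment> \<open>Padding with zeros beyond \<open>m\<close> turns the finite sums into series
      over a fixed index set, dominated by \<open>p (Suc r) / Im z\<close>.\<close>
    define a where "a = (\<lambda>r m. if r < m then of_real (p (Suc r)) * hE n (Suc r) (?g m) x else 0)"
    have "(\<lambda>m. \<Sum>r. a r m) \<longlonglongrightarrow> (\<Sum>r. of_real (p (Suc r)) * hE n (Suc r) \<psi> x)"
    proof (rule tannerys_theorem[THEN conjunct2, THEN conjunct2])
      fix r
      have "(\<lambda>m. of_real (p (Suc r)) * hE n (Suc r) (?g m) x) \<longlonglongrightarrow> of_real (p (Suc r)) * hE n (Suc r) \<psi> x"
        by (intro tendsto_intros hE_lim)
      moreover have "\<forall>\<^sub>F m in sequentially. of_real (p (Suc r)) * hE n (Suc r) (?g m) x = a r m"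
        using eventually_gt_at_top[of r] by eventually_elim (simp add: a_def)
      ultimately show "(\<lambda>m. a r m) \<longlonglongrightarrow> of_real (p (Suc r)) * hE n (Suc r) \<psi> x"
        by (rule Lim_transform_eventually)
    next
      have "norm (a r m) \<le> p (Suc r) * (1 / Im z)" for r m
      proof -
        have "cmod (hE n (Suc r) (?g m) x) \<le> 1 / Im z"
          using norm_hE_le_const[OF l2_gball[OF z], of 0 "Suc r"] z by simp
        then have "p (Suc r) * cmod (hE n (Suc r) (?g m) x) \<le> p (Suc r) * (1 / Im z)"
          using p_pos[of "Suc r"] by (intro mult_left_mono) auto
        then show ?thesis unfolding a_def using p_pos[of "Suc r"] z by (simp add: norm_mult)
      qed
      then show "\<forall>\<^sub>F (r, m) in at_top \<times>\<^sub>F sequentially. norm (a r m) \<le> p (Suc r) * (1 / Im z)"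
        by (intro always_eventually) auto
      show "summable (\<lambda>r. p (Suc r) * (1 / Im z))" using p_sum by (intro summable_mult2) (auto simp: sums_iff)
    qed simp
    moreover have "(\<Sum>r. a r m) = (\<Sum>s\<in>{1..m}. of_real (p s) * hE n s (?g m) x)" for m
    proof -
      have "(\<Sum>r. a r m) = (\<Sum>r<m. a r m)" by (rule suminf_finite) (auto simp: a_def)
      then show ?thesis unfolding sum_Icc_Suc by (simp add: a_def)
    qed
    ultimately have "(\<lambda>m. (\<Sum>s\<in>{1..m}. of_real (p s) * hE n s (?g m) x) + of_real (w x) * ?g m x - z * ?g m x)
      \<longlonglongrightarrow> hH n p w \<psi> x - z * \<psi> x"
      unfolding hH_def by (intro tendsto_intros \<psi>) simp
    moreover have "\<forall>\<^sub>F m in sequentially. (\<Sum>s\<in>{1..m}. of_real (p s) * hE n s (?g m) x) + of_real (w x) * ?g m x - z * ?g m x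
       = (if x = x0 then 1 else 0)"
      using eventually_in_hball[OF n2, of x x0] by eventually_elim (rule gball_eq[OF z])
    ultimately have "(\<lambda>m. if x = x0 then 1 else 0 :: complex) \<longlonglongrightarrow> hH n p w \<psi> x - z * \<psi> x"
      by (rule Lim_transform_eventually)
    from LIMSEQ_unique[OF this tendsto_const] show ?thesis .
  qed
  \<comment> \<open>The equation is solved for the potential term: the source contributes 1, the
    spectral term \<open>cmod z / Im z\<close>, and the Laplacian, of norm at most one,
    \<open>1 / Im z\<close>.\<close>
  define K where "K = 1 + cmod z / Im z + 1 / Im z"
  have K: "l2 (hball n x0 m) (\<lambda>x. of_real (w x) * ?g m x) \<le> K" for m
  proof -
    let ?S = "hball n x0 m" and ?a = "hker n p m"
    interpret symker ?S ?a by (rule symker_hker) simp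
    let ?k = "\<lambda>x. \<Sum>y\<in>?S. of_real (?a x y) * ?g m y"
    have "l2 ?S (\<lambda>x. of_real (w x) * ?g m x) = l2 ?S (\<lambda>x. ((if x = x0 then 1 else 0) + z * ?g m x) + (-1) * ?k x)"
      using green_eq(1)[OF z hball_self, of _ w]
      by (intro l2_cong arg_cong[where f = cmod]) (auto simp: gball_def hop_def algebra_simps split: if_splits)
    also have "\<dots> \<le> l2 ?S (\<lambda>x. (if x = x0 then 1 else 0) + z * ?g m x) + l2 ?S (\<lambda>x. (-1) * ?k x)"
      by (rule l2_triangle)
    also have "\<dots> \<le> (l2 ?S (\<lambda>x. if x = x0 then 1 else 0) + l2 ?S (\<lambda>x. z * ?g m x)) + l2 ?S (\<lambda>x. (-1) * ?k x)"
      by (intro add_right_mono l2_triangle)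
    also have "\<dots> = 1 + cmod z * l2 ?S (?g m) + l2 ?S ?k"
      using l2_delta[OF fin hball_self, of 1] by (simp only: l2_scale) simp
    also have "l2 ?S ?k \<le> 1 * l2 ?S (?g m)"
    proof (rule schur_test)
      have nn: "?a x y \<ge> 0" for x y unfolding hker_def using p_pos by (intro sum_nonneg) (auto intro: less_imp_le)
      then show "?a x y \<ge> 0" for x y .
      fix x
      have "(\<Sum>y\<in>?S. ?a x y) = (\<Sum>y\<in>?S. \<bar>hker n p m x y - hker n p 0 x y\<bar>)" using nn by (simp add: hker_def[of _ _ 0])
      also have "\<dots> \<le> tail 0" by (rule row_sum_diff_le) auto
      finally show "(\<Sum>y\<in>?S. ?a x y) \<le> 1" by (simp add: tail_def)
    qed (auto simp: hker_sym)
    also have "1 + cmod z * l2 ?S (?g m) + 1 * l2 ?S (?g m) \<le> 1 + cmod z * (1 / Im z) + 1 * (1 / Im z)"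
      using l2_gball[OF z, of ?S x0 w m] by (intro add_mono mult_left_mono) auto
    finally show ?thesis by (simp add: K_def)
  qed
  have "summable (\<lambda>x. (cmod (\<psi> x))\<^sup>2 * (1 + (w x)\<^sup>2))"
  proof (rule summableI_nonneg_bounded)
    fix j
    show "(\<Sum>x<j. (cmod (\<psi> x))\<^sup>2 * (1 + (w x)\<^sup>2)) \<le> (1 / Im z)\<^sup>2 + K\<^sup>2"
    proof (rule LIMSEQ_le_const2)
      show "(\<lambda>m. \<Sum>x<j. (cmod (?g m x))\<^sup>2 * (1 + (w x)\<^sup>2)) \<longlonglongrightarrow> (\<Sum>x<j. (cmod (\<psi> x))\<^sup>2 * (1 + (w x)\<^sup>2))"
        by (intro tendsto_intros \<psi>)
      have "\<forall>\<^sub>F m in sequentially. \<forall>x\<in>{..<j}. x \<in> hball n x0 m"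
        by (intro eventually_ball_finite ballI eventually_in_hball n2) auto
      then have "\<forall>\<^sub>F m in sequentially. (\<Sum>x<j. (cmod (?g m x))\<^sup>2 * (1 + (w x)\<^sup>2)) \<le> (1 / Im z)\<^sup>2 + K\<^sup>2"
      proof eventually_elim
        fix m assume m: "\<forall>x\<in>{..<j}. x \<in> hball n x0 m"
        have "(\<Sum>x<j. (cmod (?g m x))\<^sup>2 * (1 + (w x)\<^sup>2)) =
            (l2 {..<j} (?g m))\<^sup>2 + (l2 {..<j} (\<lambda>x. of_real (w x) * ?g m x))\<^sup>2"
          unfolding l2_power2 sum.distrib[symmetric] by (simp add: norm_mult power_mult_distrib algebra_simps)
        also have "\<dots> \<le> (1 / Im z)\<^sup>2 + K\<^sup>2"
        proof (intro add_mono power_mono)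
          show "l2 {..<j} (\<lambda>x. of_real (w x) * ?g m x) \<le> K"
            using m by (intro order.trans[OF l2_mono_set K]) auto
        qed (use l2_gball[OF z] in auto)
        finally show "(\<Sum>x<j. (cmod (?g m x))\<^sup>2 * (1 + (w x)\<^sup>2)) \<le> (1 / Im z)\<^sup>2 + K\<^sup>2" .
      qed
      then show "\<exists>N. \<forall>m\<ge>N. (\<Sum>x<j. (cmod (?g m x))\<^sup>2 * (1 + (w x)\<^sup>2)) \<le> (1 / Im z)\<^sup>2 + K\<^sup>2"
        by (simp add: eventually_sequentially)
    qed
  qed auto
  then have "\<psi> \<in> hdom w" by (simp add: hdom_def)
  then show thesis using that sol \<psi> l2\<psi> by blast
qed

text \<open>The definite description in \<open>hresolvent\<close> is justified here: a solution
  exists as a limit of finite-volume functions, and any other solution in the domain is at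
  \<open>x0\<close> the limit of the same sequence.\<close>

lemma hresolvent_limit:
  assumes z: "Im z > 0"
  shows "(\<lambda>m. gball x0 w z m x0) \<longlonglongrightarrow> hresolvent n p x0 w z"
proof -
  obtain \<psi> where \<psi>: "\<psi> \<in> hdom w" "\<And>x. hH n p w \<psi> x - z * \<psi> x = (if x = x0 then 1 else 0)"
    "\<And>x. (\<lambda>m. gball x0 w z m x) \<longlonglongrightarrow> \<psi> x"
    using gball_limit_solution[OF z, of w x0] by metis
  have "hresolvent n p x0 w z = \<psi> x0"
    unfolding hresolvent_def
  proof (rule the_equality)
    fix c assume "\<exists>\<psi>\<in>hdom w. (\<forall>x. hH n p w \<psi> x - z * \<psi> x = (if x = x0 then 1 else 0)) \<and> c = \<psi> x0"
    then obtain \<phi> where \<phi>: "\<phi> \<in> hdom w" "\<And>x. hH n p w \<phi> x - z * \<phi> x = (if x = x0 then 1 else 0)" "c = \<phi> x0" by blast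
    define C where "C = sqrt (\<Sum>x. (cmod (\<phi> x))\<^sup>2)"
    have "summable (\<lambda>x. (cmod (\<phi> x))\<^sup>2)"
    proof (rule summable_comparison_test')
      show "summable (\<lambda>x. (cmod (\<phi> x))\<^sup>2 * (1 + (w x)\<^sup>2))" using \<phi>(1) by (simp add: hdom_def)
    qed (auto simp: algebra_simps)
    then have C: "l2 F \<phi> \<le> C" if "finite F" for F
      unfolding l2_def L2_set_def C_def using that by (intro real_sqrt_le_mono sum_le_suminf) auto
    have C0: "C \<ge> 0" using C[of "{}"] l2_nonneg order.trans by blast
    have "(\<lambda>l. tail l * C / Im z) \<longlonglongrightarrow> 0 * C / Im z" using z by (intro tendsto_intros tail_tendsto) auto
    then have t0: "(\<lambda>l. tail l * C / Im z) \<longlonglongrightarrow> 0" by simp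
    have "cmod (\<phi> x0 - gball x0 w z l x0) \<le> tail l * C / Im z" for l
      by (rule gball_close_solution[OF z C C0 \<phi>(2)])
    then have "(\<lambda>l. \<phi> x0 - gball x0 w z l x0) \<longlonglongrightarrow> 0"
      by (intro Lim_null_comparison[OF _ t0] always_eventually allI)
    from tendsto_diff[OF tendsto_const[of "\<phi> x0"] this] have "(\<lambda>l. gball x0 w z l x0) \<longlonglongrightarrow> \<phi> x0" by simp
    from LIMSEQ_unique[OF this \<psi>(3)] show "c = \<psi> x0" using \<phi>(3) by simp
  qed (use \<psi> in blast)
  then show ?thesis using \<psi>(3) by simp
qed

lemma hresolvent_close:
  assumes z: "Im z > 0"
  shows "cmod (hresolvent n p x0 w z - gball x0 w z l x0) \<le> tail l / (Im z)\<^sup>2"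
proof (rule LIMSEQ_le_const2)
  show "(\<lambda>m. cmod (gball x0 w z m x0 - gball x0 w z l x0)) \<longlonglongrightarrow> cmod (hresolvent n p x0 w z - gball x0 w z l x0)"
    by (intro tendsto_intros hresolvent_limit z)
  show "\<exists>N. \<forall>m\<ge>N. cmod (gball x0 w z m x0 - gball x0 w z l x0) \<le> tail l / (Im z)\<^sup>2"
    using gball_close[OF z _ hball_self] by blast
qed

end

section \<open>Block decomposition of the truncated operator\<close>

lemma char_poly_nonzero: "char_poly (Hm N a w) \<noteq> 0"
  using degree_monic_char_poly[OF Hm_carrier[of N a w]] by auto

lemma char_poly_Hm_block:
  assumes "\<And>i j. i < P \<Longrightarrow> P \<le> j \<Longrightarrow> j < P + L \<Longrightarrow> a i j = 0 \<and> a j i = 0"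
  shows "char_poly (Hm (P + L) a w) =
    char_poly (Hm P a w) * char_poly (Hm L (\<lambda>i j. a (P + i) (P + j)) (\<lambda>i. w (P + i)))"
proof -
  let ?A = "char_poly_matrix (Hm P a w)"
  let ?D = "char_poly_matrix (Hm L (\<lambda>i j. a (P + i) (P + j)) (\<lambda>i. w (P + i)))"
  have A: "?A \<in> carrier_mat P P" and D: "?D \<in> carrier_mat L L" by simp_all
  have "char_poly_matrix (Hm (P + L) a w) = four_block_mat ?A (0\<^sub>m P L) (0\<^sub>m L P) ?D"
  proof (rule eq_matI)
    fix i j assume "i < dim_row (four_block_mat ?A (0\<^sub>m P L) (0\<^sub>m L P) ?D)" "j < dim_col (four_block_mat ?A (0\<^sub>m P L) (0\<^sub>m L P) ?D)"
    then have ij: "i < P + L" "j < P + L" using A D by auto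
    have "a i j = 0" if "i < P \<longleftrightarrow> \<not> j < P" using that assms[of i j] assms[of j i] ij by auto
    then show "char_poly_matrix (Hm (P + L) a w) $$ (i, j) = four_block_mat ?A (0\<^sub>m P L) (0\<^sub>m L P) ?D $$ (i, j)"
      using ij A D by (auto simp: char_poly_matrix_def Hm_def)
  qed (use A D in \<open>auto simp: char_poly_matrix_def\<close>)
  then show ?thesis unfolding char_poly_def
    using det_four_block_mat_lower_left_zero[OF A _ refl D, of "0\<^sub>m P L"] by simp
qed

lemma cnt_block:
  assumes "\<And>i j. i < P \<Longrightarrow> P \<le> j \<Longrightarrow> j < P + L \<Longrightarrow> a i j = 0 \<and> a j i = 0"
  shows "cnt (P + L) a w A = cnt P a w A + cnt L (\<lambda>i j. a (P + i) (P + j)) (\<lambda>i. w (P + i)) A"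
proof -
  have eq: "char_poly (Hm (P + L) a w) =
    char_poly (Hm P a w) * char_poly (Hm L (\<lambda>i j. a (P + i) (P + j)) (\<lambda>i. w (P + i)))"
    by (rule char_poly_Hm_block) (use assms in blast)
  show ?thesis unfolding cnt_def eq by (simp add: proots_mult char_poly_nonzero)
qed

lemma cnt_cong:
  assumes "\<And>i j. i < N \<Longrightarrow> j < N \<Longrightarrow> a i j = a' i j" "\<And>i. i < N \<Longrightarrow> w i = w' i"
  shows "cnt N a w A = cnt N a' w' A"
proof -
  have "Hm N a w = Hm N a' w'" unfolding Hm_def using assms by (intro eq_matI) auto
  then show ?thesis by (simp add: cnt_def)
qed

text \<open>Points in different balls of radius \<open>l\<close> share no ball at any level
  \<open>s \<le> l\<close>, so the matrix is block diagonal and its characteristic polynomial a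
  product; shifts by multiples of \<open>n ^ l\<close> make all blocks carry the same
  kernel.\<close>

lemma cnt_hker_blocks:
  assumes n: "n > 0"
  shows "cnt (b * n ^ l) (hker n p l) w A = (\<Sum>j<b. cnt (n ^ l) (hker n p l) (\<lambda>i. w (j * n ^ l + i)) A)"
proof (induction b)
  case 0
  have "proots (char_poly (Hm 0 (hker n p l) w)) = {#}"
  proof -
    have "degree (char_poly (Hm 0 (hker n p l) w)) = 0" using degree_monic_char_poly[OF Hm_carrier[of 0]] by simp
    then obtain c where "char_poly (Hm 0 (hker n p l) w) = [:c:]" by (metis degree_eq_zeroE)
    then show ?thesis by simp
  qed
  then show ?case by (simp add: cnt_def)
next
  case (Suc b)
  have zero: "hker n p l i j = 0 \<and> hker n p l j i = 0" if "i < b * n ^ l" "b * n ^ l \<le> j" for i j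
  proof -
    have "i div n ^ l < b" using that n by (simp add: div_less_iff_less_mult)
    moreover have "b \<le> j div n ^ l" using that n by (simp add: less_eq_div_iff_mult_less_eq)
    ultimately have ne: "i div n ^ l \<noteq> j div n ^ l" by linarith
    then have "i div n ^ s \<noteq> j div n ^ s" if "s \<le> l" for s using div_pow_mono[OF that] by blast
    then have "hker n p l i j = 0" unfolding hker_def by (intro sum.neutral) auto
    then show ?thesis using hker_sym by metis
  qed
  have "cnt (Suc b * n ^ l) (hker n p l) w A = cnt (b * n ^ l + n ^ l) (hker n p l) w A" by (simp add: add.commute)
  also have "\<dots> = cnt (b * n ^ l) (hker n p l) w A +
      cnt (n ^ l) (\<lambda>i j. hker n p l (b * n ^ l + i) (b * n ^ l + j)) (\<lambda>i. w (b * n ^ l + i)) A"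
    by (rule cnt_block) (use zero in auto)
  also have "cnt (n ^ l) (\<lambda>i j. hker n p l (b * n ^ l + i) (b * n ^ l + j)) (\<lambda>i. w (b * n ^ l + i)) A =
      cnt (n ^ l) (hker n p l) (\<lambda>i. w (b * n ^ l + i)) A"
    using n by (intro cnt_cong) (auto simp: hker_def shifted_div intro!: sum.cong)
  finally show ?case using Suc by simp
qed

section \<open>Poisson approximation of sums of independent vectors\<close>

text \<open>The range of summation in a convolution of laws of vectors of naturals. Extensional
  functions keep it finite and make vectors equal once their first \<open>m\<close> entries
  agree.\<close>

definition vbox :: "nat \<Rightarrow> (nat \<Rightarrow> nat) \<Rightarrow> (nat \<Rightarrow> nat) set" where
  "vbox m r = PiE {..<m} (\<lambda>s. {..r s})"

definition vsub :: "nat \<Rightarrow> (nat \<Rightarrow> nat) \<Rightarrow> (nat \<Rightarrow> nat) \<Rightarrow> nat \<Rightarrow> nat" where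
  "vsub m r q = restrict (\<lambda>s. r s - q s) {..<m}"

lemma finite_vbox [simp]: "finite (vbox m r)"
  unfolding vbox_def by (intro finite_PiE) auto

lemma vbox_ext:
  assumes "q \<in> vbox m r" "q' \<in> vbox m r" "\<And>s. s < m \<Longrightarrow> q s = q' s"
  shows "q = q'"
proof (rule PiE_ext)
  show "q \<in> PiE {..<m} (\<lambda>s. {..r s})" using assms(1) by (simp only: vbox_def)
  show "q' \<in> PiE {..<m} (\<lambda>s. {..r s})" using assms(2) by (simp only: vbox_def)
  show "q s = q' s" if "s \<in> {..<m}" for s using that assms(3) by simp
qed

text \<open>Young's inequality on a box: for fixed \<open>q\<close>, subtracting \<open>q\<close> is
  injective on the vectors above \<open>q\<close> and does not leave the box.\<close>

lemma vbox_convolution_le: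
  fixes h k :: "(nat \<Rightarrow> nat) \<Rightarrow> real"
  assumes h: "\<And>r. h r \<ge> 0" and k: "\<And>r. k r \<ge> 0"
  shows "(\<Sum>r\<in>vbox m R. \<Sum>q\<in>vbox m r. h (vsub m r q) * k q) \<le> (\<Sum>q\<in>vbox m R. k q) * (\<Sum>r\<in>vbox m R. h r)"
proof -
  have sub: "vbox m r \<subseteq> vbox m R" if "r \<in> vbox m R" for r
  proof
    fix q assume q: "q \<in> vbox m r"
    have "q s \<le> R s" if "s < m" for s
      using q that \<open>r \<in> vbox m R\<close> le_trans[of "q s" "r s" "R s"] by (auto simp: vbox_def PiE_iff)
    then show "q \<in> vbox m R" using q by (auto simp: vbox_def PiE_iff)
  qed
  have "(\<Sum>r\<in>vbox m R. \<Sum>q\<in>vbox m r. h (vsub m r q) * k q) =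
     (\<Sum>r\<in>vbox m R. \<Sum>q\<in>vbox m R. if q \<in> vbox m r then h (vsub m r q) * k q else 0)"
  proof (rule sum.cong[OF refl])
    fix r assume "r \<in> vbox m R"
    then show "(\<Sum>q\<in>vbox m r. h (vsub m r q) * k q) =
        (\<Sum>q\<in>vbox m R. if q \<in> vbox m r then h (vsub m r q) * k q else 0)"
      by (simp add: sum.If_cases Int_absorb1[OF sub])
  qed
  also have "\<dots> = (\<Sum>q\<in>vbox m R. \<Sum>r\<in>vbox m R. if q \<in> vbox m r then h (vsub m r q) * k q else 0)"
    by (rule sum.swap)
  also have "\<dots> \<le> (\<Sum>q\<in>vbox m R. k q * (\<Sum>r\<in>vbox m R. h r))"
  proof (rule sum_mono)
    fix q assume q: "q \<in> vbox m R"
    let ?T = "{r \<in> vbox m R. q \<in> vbox m r}"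
    have inj: "inj_on (\<lambda>r. vsub m r q) ?T"
    proof (rule inj_onI)
      fix r r' assume r: "r \<in> ?T" "r' \<in> ?T" "vsub m r q = vsub m r' q"
      show "r = r'"
      proof (rule PiE_ext)
        show "r \<in> PiE {..<m} (\<lambda>s. {..R s})" "r' \<in> PiE {..<m} (\<lambda>s. {..R s})" using r by (auto simp: vbox_def)
        fix s assume s: "s \<in> {..<m}"
        have "q s \<le> r s" "q s \<le> r' s" using r s by (auto simp: vbox_def PiE_iff)
        moreover have "r s - q s = r' s - q s" using fun_cong[OF r(3), of s] s by (simp add: vsub_def)
        ultimately show "r s = r' s" by linarith
      qed
    qed
    have im: "(\<lambda>r. vsub m r q) ` ?T \<subseteq> vbox m R"
    proof (rule image_subsetI)
      fix r assume r: "r \<in> ?T"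
      have "r s - q s \<le> R s" if "s < m" for s
      proof -
        have "r s \<le> R s" using r that by (auto simp: vbox_def PiE_iff)
        then show ?thesis by linarith
      qed
      then show "vsub m r q \<in> vbox m R" by (simp add: vbox_def vsub_def restrict_PiE_iff)
    qed
    have "(\<Sum>r\<in>vbox m R. if q \<in> vbox m r then h (vsub m r q) * k q else 0) = (\<Sum>r\<in>?T. h (vsub m r q) * k q)"
      by (rule sum.inter_filter[symmetric]) simp
    also have "\<dots> = k q * (\<Sum>r\<in>(\<lambda>r. vsub m r q) ` ?T. h r)"
      using inj by (simp add: sum.reindex sum_distrib_left mult.commute)
    also have "\<dots> \<le> k q * (\<Sum>r\<in>vbox m R. h r)"
      using im h k by (intro mult_left_mono sum_mono2) auto
    finally show "(\<Sum>r\<in>vbox m R. if q \<in> vbox m r then h (vsub m r q) * k q else 0) \<le> k q * (\<Sum>r\<in>vbox m R. h r)" .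
  qed
  also have "\<dots> = (\<Sum>q\<in>vbox m R. k q) * (\<Sum>r\<in>vbox m R. h r)" by (simp add: sum_distrib_right)
  finally show ?thesis .
qed

text \<open>Le Cam's argument: replacing the summands one at a time costs at most the distance of their laws.\<close>
lemma le_cam:
  fixes F G :: "nat \<Rightarrow> (nat \<Rightarrow> nat) \<Rightarrow> real" and f g :: "(nat \<Rightarrow> nat) \<Rightarrow> real"
  assumes F: "\<And>b r. F (Suc b) r = (\<Sum>q\<in>vbox m r. F b (vsub m r q) * f q)"
    and G: "\<And>b r. G (Suc b) r = (\<Sum>q\<in>vbox m r. G b (vsub m r q) * g q)"
    and FG0: "\<And>r. F 0 r = G 0 r"
    and Fnn: "\<And>b r. F b r \<ge> 0" and gnn: "\<And>q. g q \<ge> 0"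
    and F1: "\<And>b. (\<Sum>r\<in>vbox m R. F b r) \<le> 1" and g1: "(\<Sum>q\<in>vbox m R. g q) \<le> 1"
  shows "(\<Sum>r\<in>vbox m R. \<bar>F b r - G b r\<bar>) \<le> real b * (\<Sum>q\<in>vbox m R. \<bar>f q - g q\<bar>)"
proof (induction b)
  case 0
  then show ?case by (simp add: FG0)
next
  case (Suc b)
  let ?d = "\<Sum>q\<in>vbox m R. \<bar>f q - g q\<bar>"
  have "\<bar>F (Suc b) r - G (Suc b) r\<bar> \<le> (\<Sum>q\<in>vbox m r. F b (vsub m r q) * \<bar>f q - g q\<bar>) +
      (\<Sum>q\<in>vbox m r. \<bar>F b (vsub m r q) - G b (vsub m r q)\<bar> * g q)" for r
  proof -
    \<comment> \<open>The product difference is telescoped as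
      \<open>F * (f - g) + (F - G) * g\<close>: one new replacement plus the error inherited from
      the earlier ones.\<close>
    have eq: "F (Suc b) r - G (Suc b) r = (\<Sum>q\<in>vbox m r. F b (vsub m r q) * (f q - g q) +
        (F b (vsub m r q) - G b (vsub m r q)) * g q)"
      unfolding F G by (simp add: sum_subtractf[symmetric] algebra_simps)
    have "\<bar>F (Suc b) r - G (Suc b) r\<bar> \<le>
        (\<Sum>q\<in>vbox m r. \<bar>F b (vsub m r q) * (f q - g q) + (F b (vsub m r q) - G b (vsub m r q)) * g q\<bar>)"
      unfolding eq by (rule sum_abs)
    also have "\<dots> \<le> (\<Sum>q\<in>vbox m r. F b (vsub m r q) * \<bar>f q - g q\<bar> + \<bar>F b (vsub m r q) - G b (vsub m r q)\<bar> * g q)"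
    proof (rule sum_mono)
      fix q
      have "\<bar>F b (vsub m r q) * (f q - g q) + (F b (vsub m r q) - G b (vsub m r q)) * g q\<bar> \<le>
        \<bar>F b (vsub m r q) * (f q - g q)\<bar> + \<bar>(F b (vsub m r q) - G b (vsub m r q)) * g q\<bar>"
        by (rule abs_triangle_ineq)
      then show "\<bar>F b (vsub m r q) * (f q - g q) + (F b (vsub m r q) - G b (vsub m r q)) * g q\<bar> \<le>
        F b (vsub m r q) * \<bar>f q - g q\<bar> + \<bar>F b (vsub m r q) - G b (vsub m r q)\<bar> * g q"
        using Fnn[of b "vsub m r q"] gnn[of q] by (simp only: abs_mult abs_of_nonneg)
    qed
    finally show ?thesis by (simp add: sum.distrib)
  qed
  then have "(\<Sum>r\<in>vbox m R. \<bar>F (Suc b) r - G (Suc b) r\<bar>) \<le>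
     (\<Sum>r\<in>vbox m R. (\<Sum>q\<in>vbox m r. F b (vsub m r q) * \<bar>f q - g q\<bar>) + (\<Sum>q\<in>vbox m r. \<bar>F b (vsub m r q) - G b (vsub m r q)\<bar> * g q))"
    by (intro sum_mono)
  also have "\<dots> = (\<Sum>r\<in>vbox m R. \<Sum>q\<in>vbox m r. F b (vsub m r q) * \<bar>f q - g q\<bar>) +
      (\<Sum>r\<in>vbox m R. \<Sum>q\<in>vbox m r. \<bar>F b (vsub m r q) - G b (vsub m r q)\<bar> * g q)"
    by (rule sum.distrib)
  also have "\<dots> \<le> ?d * (\<Sum>r\<in>vbox m R. F b r) + (\<Sum>q\<in>vbox m R. g q) * (\<Sum>r\<in>vbox m R. \<bar>F b r - G b r\<bar>)"
    by (intro add_mono vbox_convolution_le[where h = "F b" and k = "\<lambda>q. \<bar>f q - g q\<bar>"]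
        vbox_convolution_le[where h = "\<lambda>r. \<bar>F b r - G b r\<bar>" and k = g]) (auto simp: Fnn gnn)
  also have "\<dots> \<le> ?d * 1 + 1 * (\<Sum>r\<in>vbox m R. \<bar>F b r - G b r\<bar>)"
    using F1[of b] g1 by (intro add_mono mult_left_mono mult_right_mono) (auto intro: sum_nonneg)
  also have "\<dots> \<le> real (Suc b) * ?d" using Suc by (simp add: algebra_simps)
  finally show ?case .
qed

section \<open>Poisson vectors as a convolution semigroup\<close>

definition pois :: "real \<Rightarrow> nat \<Rightarrow> real" where "pois t j = exp (- t) * t ^ j / fact j"

text \<open>The joint law of independent Poisson variables with means
  \<open>t * \<Lambda> s\<close>. The parameter \<open>t\<close> acts as a time, so that the total
  intensity can be distributed evenly over the blocks.\<close>

definition vpois :: "nat \<Rightarrow> (nat \<Rightarrow> real) \<Rightarrow> real \<Rightarrow> (nat \<Rightarrow> nat) \<Rightarrow> real" where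
  "vpois m \<Lambda> t r = (\<Prod>s<m. pois (t * \<Lambda> s) (r s))"

lemma pois_add: "pois (t + u) j = (\<Sum>i\<le>j. pois t (j - i) * pois u i)"
proof -
  have "(\<Sum>i\<le>j. pois t (j - i) * pois u i) = (\<Sum>i\<le>j. exp (- (t + u)) / fact j * (of_nat (j choose i) * u ^ i * t ^ (j - i)))"
  proof (intro sum.cong refl)
    fix i assume "i \<in> {..j}"
    then have "real (j choose i) = fact j / (fact i * fact (j - i))" by (simp add: binomial_fact)
    moreover have "exp (- (t + u)) = exp (- t) * exp (- u)" by (simp flip: exp_add)
    ultimately show "pois t (j - i) * pois u i = exp (- (t + u)) / fact j * (of_nat (j choose i) * u ^ i * t ^ (j - i))"
      by (simp add: pois_def ac_simps)
  qed
  also have "\<dots> = exp (- (t + u)) / fact j * (u + t) ^ j"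
    unfolding sum_distrib_left[symmetric] binomial_ring[of u t j] ..
  finally show ?thesis by (simp add: pois_def add.commute)
qed

lemma pois_nonneg: "t \<ge> 0 \<Longrightarrow> pois t j \<ge> 0"
  by (simp add: pois_def)

lemma sum_pois_le: "t \<ge> 0 \<Longrightarrow> (\<Sum>j\<le>N. pois t j) \<le> 1"
proof -
  assume t: "t \<ge> 0"
  have "(\<Sum>j\<le>N. t ^ j / fact j) \<le> (\<Sum>j. t ^ j / fact j)"
    using t summable_exp[of t] by (intro sum_le_suminf) (auto simp: divide_inverse mult.commute)
  also have "\<dots> = exp t" by (simp add: exp_def divide_inverse mult.commute scaleR_conv_of_real)
  finally have "exp (- t) * (\<Sum>j\<le>N. t ^ j / fact j) \<le> exp (- t) * exp t" by (intro mult_left_mono) auto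
  then show ?thesis by (simp add: pois_def sum_distrib_left exp_minus)
qed

text \<open>The semigroup law, coordinatewise the binomial theorem. It presents the Poisson vector
  at time 1 as a sum of independent pieces, one for each block to be replaced.\<close>

lemma vpois_add: "vpois m \<Lambda> (t + u) r = (\<Sum>q\<in>vbox m r. vpois m \<Lambda> t (vsub m r q) * vpois m \<Lambda> u q)"
proof -
  have "vpois m \<Lambda> (t + u) r = (\<Prod>s<m. \<Sum>i\<le>r s. pois (t * \<Lambda> s) (r s - i) * pois (u * \<Lambda> s) i)"
    unfolding vpois_def by (simp add: distrib_right pois_add)
  also have "\<dots> = (\<Sum>q\<in>vbox m r. \<Prod>s<m. pois (t * \<Lambda> s) (r s - q s) * pois (u * \<Lambda> s) (q s))"
    unfolding vbox_def by (subst prod_sum_PiE) auto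
  also have "\<dots> = (\<Sum>q\<in>vbox m r. vpois m \<Lambda> t (vsub m r q) * vpois m \<Lambda> u q)"
    unfolding vpois_def prod.distrib[symmetric] by (intro sum.cong refl prod.cong) (auto simp: vsub_def)
  finally show ?thesis .
qed

lemma sum_vpois_le:
  assumes "\<And>s. \<Lambda> s \<ge> 0" "t \<ge> 0"
  shows "(\<Sum>q\<in>vbox m R. vpois m \<Lambda> t q) \<le> 1"
proof -
  have "(\<Sum>q\<in>vbox m R. vpois m \<Lambda> t q) = (\<Prod>s<m. \<Sum>i\<le>R s. pois (t * \<Lambda> s) i)"
    unfolding vbox_def vpois_def by (subst prod_sum_PiE) auto
  also have "\<dots> \<le> 1" using assms by (intro prod_le_1) (auto intro!: sum_nonneg pois_nonneg sum_pois_le)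
  finally show ?thesis .
qed

section \<open>Laws of sums over independent blocks\<close>

lemma (in anderson) sets_nat_vector:
  fixes m :: nat
  assumes "\<And>s. s < m \<Longrightarrow> (\<lambda>w. f w s) \<in> measurable M (count_space UNIV)"
  shows "{w. \<forall>s<m. f w s = (r s :: nat)} \<in> sets M"
proof -
  have "{w. \<forall>s<m. f w s = r s} = {w \<in> space M. \<forall>s\<in>{..<m}. f w s = r s}" by auto
  also have "\<dots> \<in> sets M"
  proof (rule sets.sets_Collect_finite_All)
    fix s assume "s \<in> {..<m}"
    then have "(\<lambda>w. f w s) -` {r s} \<inter> space M \<in> sets M" using assms by (intro measurable_sets) auto
    also have "(\<lambda>w. f w s) -` {r s} \<inter> space M = {w \<in> space M. f w s = r s}" by auto
    finally show "{w \<in> space M. f w s = r s} \<in> sets M" .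
  qed simp
  finally show ?thesis .
qed

text \<open>By \<open>Y_local\<close> the vector \<open>Y\<close> reads only the first
  \<open>L\<close> sites, so its copies on the consecutive windows of length \<open>L\<close> are
  independent and identically distributed.\<close>

locale block_sum = anderson +
  fixes L m :: nat and Y :: "(nat \<Rightarrow> real) \<Rightarrow> nat \<Rightarrow> nat"
  assumes Y_meas: "s < m \<Longrightarrow> (\<lambda>w. Y w s) \<in> measurable M (count_space UNIV)"
    and Y_local: "(\<And>i. i < L \<Longrightarrow> w i = w' i) \<Longrightarrow> Y w = Y w'"
begin

definition bsum :: "nat \<Rightarrow> (nat \<Rightarrow> real) \<Rightarrow> nat \<Rightarrow> nat" where
  "bsum b w s = (\<Sum>j<b. Y (\<lambda>i. w (j * L + i)) s)"

definition law :: "nat \<Rightarrow> (nat \<Rightarrow> nat) \<Rightarrow> real" where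
  "law b r = measure M {w. \<forall>s<m. bsum b w s = r s}"

definition law1 :: "(nat \<Rightarrow> nat) \<Rightarrow> real" where
  "law1 r = measure M {w. \<forall>s<m. Y w s = r s}"

lemma bsum_meas:
  assumes "s < m"
  shows "(\<lambda>w. bsum b w s) \<in> measurable M (count_space UNIV)"
proof -
  have [measurable]: "(\<lambda>w. Y (\<lambda>i. w (j * L + i)) s) \<in> measurable M (count_space UNIV)" for j
    by (rule measurable_compose[OF measurable_reindex Y_meas[OF assms]])
  show ?thesis unfolding bsum_def by (induction b) (simp_all, measurable)
qed

lemma bsum_sets: "{w. \<forall>s<m. bsum b w s = r s} \<in> sets M"
  by (rule sets_nat_vector) (rule bsum_meas)

lemma Y_sets: "{w. \<forall>s<m. Y w s = r s} \<in> sets M"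
  by (rule sets_nat_vector) (rule Y_meas)

lemma bsum_comb: "bsum (Suc b) (comb_seq (b * L) w w') s = bsum b w s + Y w' s"
proof -
  have "Y (\<lambda>i. comb_seq (b * L) w w' (j * L + i)) = Y (\<lambda>i. w (j * L + i))" if "j < b" for j
  proof (rule Y_local)
    fix i assume i: "i < L"
    have "j * L + i < Suc j * L" using i by simp
    also have "\<dots> \<le> b * L" using that by (intro mult_le_mono1) auto
    finally show "comb_seq (b * L) w w' (j * L + i) = w (j * L + i)" by (simp add: comb_seq_def)
  qed
  moreover have "(\<lambda>i. comb_seq (b * L) w w' (b * L + i)) = w'" by (auto simp: comb_seq_def)
  ultimately show ?thesis by (simp add: bsum_def)
qed

text \<open>Gluing the first \<open>b * L\<close> sites of one potential to an independent second
  one preserves the law and separates the first \<open>b\<close> blocks from the last. The event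
  then splits into disjoint products according to the contribution \<open>q\<close> of the last
  block.\<close>

lemma law_Suc: "law (Suc b) r = (\<Sum>q\<in>vbox m r. law b (vsub m r q) * law1 q)"
proof -
  interpret MM: pair_prob_space M M ..
  have cm: "(\<lambda>(w, w'). comb_seq (b * L) w w') \<in> measurable (M \<Otimes>\<^sub>M M) M"
    unfolding M_def by (rule measurable_comb_seq)
  let ?E = "\<lambda>q. {w. \<forall>s<m. bsum b w s = vsub m r q s} \<times> {w. \<forall>s<m. Y w s = q s}"
  have "law (Suc b) r = measure (distr (M \<Otimes>\<^sub>M M) M (\<lambda>(w, w'). comb_seq (b * L) w w')) {w. \<forall>s<m. bsum (Suc b) w s = r s}"
    unfolding law_def distr_comb_seq ..
  also have "\<dots> = measure (M \<Otimes>\<^sub>M M) ((\<lambda>(w, w'). comb_seq (b * L) w w') -` {w. \<forall>s<m. bsum (Suc b) w s = r s} \<inter> space (M \<Otimes>\<^sub>M M))"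
    by (rule measure_distr[OF cm bsum_sets])
  also have "(\<lambda>(w, w'). comb_seq (b * L) w w') -` {w. \<forall>s<m. bsum (Suc b) w s = r s} \<inter> space (M \<Otimes>\<^sub>M M) = (\<Union>q\<in>vbox m r. ?E q)"
  proof (intro equalityI subsetI)
    fix p assume p: "p \<in> (\<lambda>(w, w'). comb_seq (b * L) w w') -` {w. \<forall>s<m. bsum (Suc b) w s = r s} \<inter> space (M \<Otimes>\<^sub>M M)"
    obtain w w' where pw: "p = (w, w')" by (cases p)
    have e: "bsum b w s + Y w' s = r s" if "s < m" for s using p that by (simp add: pw bsum_comb)
    \<comment> \<open>The witness is the actual contribution of the last block, made extensional to
      lie in the box; it cannot exceed the total \<open>r\<close>.\<close>
    have "restrict (Y w') {..<m} \<in> vbox m r" using e by (auto simp: vbox_def PiE_iff intro: order.trans[OF le_add2 eq_refl])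
    moreover have "p \<in> ?E (restrict (Y w') {..<m})" using e by (auto simp: pw vsub_def simp flip: e)
    ultimately show "p \<in> (\<Union>q\<in>vbox m r. ?E q)" by blast
  next
    fix p assume "p \<in> (\<Union>q\<in>vbox m r. ?E q)"
    then show "p \<in> (\<lambda>(w, w'). comb_seq (b * L) w w') -` {w. \<forall>s<m. bsum (Suc b) w s = r s} \<inter> space (M \<Otimes>\<^sub>M M)"
      by (auto simp: bsum_comb vsub_def vbox_def PiE_iff space_pair_measure)
  qed
  also have "measure (M \<Otimes>\<^sub>M M) (\<Union>q\<in>vbox m r. ?E q) = (\<Sum>q\<in>vbox m r. measure (M \<Otimes>\<^sub>M M) (?E q))"
  proof (rule MM.finite_measure_finite_Union)
    show "disjoint_family_on ?E (vbox m r)"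
    proof (clarsimp simp: disjoint_family_on_def, rule ccontr)
      fix q q' assume q: "q \<in> vbox m r" "q' \<in> vbox m r" "q \<noteq> q'"
        and ne: "{w. \<forall>s<m. bsum b w s = vsub m r q s} \<times> {w. \<forall>s<m. Y w s = q s} \<inter>
          {w. \<forall>s<m. bsum b w s = vsub m r q' s} \<times> {w. \<forall>s<m. Y w s = q' s} \<noteq> {}"
      then obtain w where "\<forall>s<m. Y w s = q s" "\<forall>s<m. Y w s = q' s" by auto
      then have "q = q'" by (intro vbox_ext[OF q(1,2)]) simp
      then show False using q by simp
    qed
  qed (use bsum_sets Y_sets in auto)
  also have "\<dots> = (\<Sum>q\<in>vbox m r. law b (vsub m r q) * law1 q)"
    unfolding law_def law1_def using bsum_sets Y_sets
    by (intro sum.cong refl) (simp add: measure_def M.emeasure_pair_measure_Times enn2real_mult)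
  finally show ?thesis .
qed

lemma law_0: "law 0 r = vpois m \<Lambda> 0 r"
proof -
  have "vpois m \<Lambda> 0 r = (if \<forall>s<m. r s = 0 then 1 else 0)"
    by (auto simp: vpois_def pois_def power_0_left prod_zero_iff)
  moreover have "law 0 r = (if \<forall>s<m. r s = 0 then 1 else 0)"
  proof (cases "\<forall>s<m. r s = 0")
    case True
    then have "{w::nat \<Rightarrow> real. \<forall>s<m. bsum 0 w s = r s} = space M" by (auto simp: bsum_def)
    then show ?thesis using True by (simp add: law_def M.prob_space[unfolded space_M])
  next
    case False
    then have e: "{w. \<forall>s<m. bsum 0 w s = r s} = {}" by (auto simp: bsum_def)
    show ?thesis unfolding law_def e using False by simp
  qed
  ultimately show ?thesis by simp
qed

lemma sum_law_le: "(\<Sum>r\<in>vbox m R. law b r) \<le> 1"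
proof -
  have "(\<Sum>r\<in>vbox m R. law b r) = measure M (\<Union>r\<in>vbox m R. {w. \<forall>s<m. bsum b w s = r s})"
    unfolding law_def
  proof (rule M.finite_measure_finite_Union[symmetric])
    show "disjoint_family_on (\<lambda>r. {w. \<forall>s<m. bsum b w s = r s}) (vbox m R)"
    proof (clarsimp simp: disjoint_family_on_def, rule ccontr)
      fix q q' assume q: "q \<in> vbox m R" "q' \<in> vbox m R" "q \<noteq> q'"
        and ne: "{w. \<forall>s<m. bsum b w s = q s} \<inter> {w. \<forall>s<m. bsum b w s = q' s} \<noteq> {}"
      then obtain w where "\<forall>s<m. bsum b w s = q s" "\<forall>s<m. bsum b w s = q' s" by auto
      then have "q = q'" by (intro vbox_ext[OF q(1,2)]) simp
      then show False using q by simp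
    qed
  qed (use bsum_sets in auto)
  also have "\<dots> \<le> 1" by (rule M.prob_le_1)
  finally show ?thesis .
qed

text \<open>Le Cam against the Poisson semigroup run in \<open>b\<close> steps of length
  \<open>1 / b\<close>. Membership of \<open>R\<close> in its own box only says that
  \<open>R\<close> is extensional.\<close>

lemma law_poisson_bound:
  assumes "b > 0" "\<And>s. \<Lambda> s \<ge> 0" "R \<in> vbox m R"
  shows "\<bar>law b R - vpois m \<Lambda> 1 R\<bar> \<le> real b * (\<Sum>q\<in>vbox m R. \<bar>law1 q - vpois m \<Lambda> (1 / real b) q\<bar>)"
proof -
  have "\<bar>law b R - vpois m \<Lambda> (real b * (1 / real b)) R\<bar> \<le> (\<Sum>r\<in>vbox m R. \<bar>law b r - vpois m \<Lambda> (real b * (1 / real b)) r\<bar>)"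
    using assms(3) by (intro member_le_sum) auto
  also have "\<dots> \<le> real b * (\<Sum>q\<in>vbox m R. \<bar>law1 q - vpois m \<Lambda> (1 / real b) q\<bar>)"
  proof (rule le_cam[where F = law and G = "\<lambda>c r. vpois m \<Lambda> (real c * (1 / real b)) r"])
    show "vpois m \<Lambda> (real (Suc c) * (1 / real b)) r =
       (\<Sum>q\<in>vbox m r. vpois m \<Lambda> (real c * (1 / real b)) (vsub m r q) * vpois m \<Lambda> (1 / real b) q)" for c r
      unfolding vpois_add[symmetric] by (simp add: add_divide_distrib add.commute)
    show "vpois m \<Lambda> (1 / real b) q \<ge> 0" for q
      unfolding vpois_def using assms by (intro prod_nonneg) (auto intro!: pois_nonneg)
    show "law c r \<ge> 0" for c r by (simp add: law_def)
    show "law 0 r = vpois m \<Lambda> (real 0 * (1 / real b)) r" for r using law_0[of r \<Lambda>] by simp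
    show "(\<Sum>q\<in>vbox m R. vpois m \<Lambda> (1 / real b) q) \<le> 1" using assms by (intro sum_vpois_le) auto
  qed (rule law_Suc sum_law_le)+
  finally show ?thesis using assms(1) by simp
qed

end

section \<open>The hierarchical Anderson model at a fixed energy\<close>

text \<open>Decay rates enter only through the decoupling scale \<open>l\<close>:
  \<open>l_gap\<close> makes the number of blocks diverge, and \<open>l_tail\<close> makes the
  discarded levels invisible to resolvents at distance of order \<open>n^(-k)\<close> from the real
  axis.\<close>

locale hmodel = anderson \<gamma> Bd + hierarchy n p for \<gamma> Bd n p +
  fixes x0 :: nat and e :: real and \<eta> :: "real \<Rightarrow> real" and l :: "nat \<Rightarrow> nat"
  assumes l_le: "l k \<le> k"
    and l_gap: "filterlim (\<lambda>k. k - l k) at_top sequentially"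
    and l_tail: "(\<lambda>k. (real n ^ k)\<^sup>2 * tail (l k)) \<longlonglongrightarrow> 0"
    and eta_meas [measurable]: "\<eta> \<in> borel_measurable borel"
    and eta_nonneg: "\<eta> t \<ge> 0"
    and eta_prob: "(\<integral>\<^sup>+ t. ennreal (\<eta> t) \<partial>lborel) = 1"
    and eta_density: "Im z > 0 \<Longrightarrow>
        (\<integral> t. complex_of_real (\<eta> t) / (complex_of_real t - z) \<partial>lborel) = (\<integral> \<omega>. hresolvent n p x0 \<omega> z \<partial>M)"
    and eta_limit: "Im z > 0 \<Longrightarrow>
        ((\<lambda>\<epsilon>. \<integral> t. Im (1 / (complex_of_real (t - e) - complex_of_real \<epsilon> * z)) * \<eta> t \<partial>lborel)
          \<longlongrightarrow> pi * \<eta> e) (at_right 0)"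
begin

text \<open>Volume and truncation level are separate parameters: the full operator, the decoupled
  one and a single block are the pairs \<open>(k, k)\<close>, \<open>(k, l k)\<close> and
  \<open>(l k, l k)\<close>.\<close>

lemma kernel: "anderson_kernel \<gamma> Bd (n ^ k) (hker n p j)"
  by unfold_locales (auto simp: hker_sym)

lemma nn_integral_reindex:
  assumes "F \<in> borel_measurable M" "inj f"
  shows "(\<integral>\<^sup>+w. F (\<lambda>i. w (f i)) \<partial>M) = (\<integral>\<^sup>+w. F w \<partial>M)"
proof -
  have "(\<integral>\<^sup>+w. F w \<partial>M) = (\<integral>\<^sup>+w. F w \<partial>distr M M (\<lambda>w i. w (f i)))" unfolding distr_reindex[OF assms(2)] ..
  also have "\<dots> = (\<integral>\<^sup>+w. F (\<lambda>i. w (f i)) \<partial>M)" by (rule nn_integral_distr[OF measurable_reindex]) (simp add: assms(1))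
  finally show ?thesis by simp
qed

lemma green_dadd:
  assumes "Im z > 0"
  shows "green (hball n b j) (hker n p j) w z b b = green {..<n ^ j} (hker n p j) (\<lambda>i. w (dadd n j b i)) z 0 0"
proof -
  have "green (hball n b j) (hker n p j) w z (dadd n j b 0) (dadd n j b 0) =
      green {..<n ^ j} (hker n p j) (\<lambda>i. w (dadd n j b i)) z 0 0"
  proof (rule green_equivariant)
    show "inj_on (dadd n j b) {..<n ^ j}" using inj_dadd[OF n_pos] inj_on_subset by blast
    show "dadd n j b ` {..<n ^ j} = hball n b j" by (rule image_dadd) simp
  qed (use assms in \<open>auto simp: symker_hker hker_dadd\<close>)
  then show ?thesis by (simp add: dadd_zero)
qed

lemma symker_std: "symker {..<n ^ j} (hker n p j)"
  by (rule symker_hker) simp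

text \<open>\<open>dadd\<close> is injective, so relabelling by it preserves the i.i.d. law; hence
  the averaged diagonal entry does not depend on the site.\<close>

lemma nn_integral_green_dadd:
  assumes z: "Im z > 0"
  shows "(\<integral>\<^sup>+w. ennreal (Im (green (hball n b j) (hker n p j) w z b b)) \<partial>M) =
    (\<integral>\<^sup>+w. ennreal (Im (green {..<n ^ j} (hker n p j) w z 0 0)) \<partial>M)"
proof -
  have [measurable]: "(\<lambda>w. green {..<n ^ j} (hker n p j) w z 0 0) \<in> borel_measurable M"
    by (rule measurable_green[OF symker_std z]) auto
  have m: "(\<lambda>w. ennreal (Im (green {..<n ^ j} (hker n p j) w z 0 0))) \<in> borel_measurable M" by measurable
  show ?thesis unfolding green_dadd[OF z]
    by (rule nn_integral_reindex[OF m inj_dadd[OF n_pos]])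
qed

definition \<mu> :: "nat \<Rightarrow> real measure" where "\<mu> j = anderson_kernel.dos \<gamma> (n ^ j) (hker n p j)"

text \<open>All sites contribute equally to the averaged trace, so the normalised trace reduces to
  the entry at \<open>x0\<close>. This is the bridge from eigenvalue statistics to the
  infinite-volume resolvent.\<close>

lemma nn_integral_pker_\<mu>:
  assumes y: "y > 0"
  shows "(\<integral>\<^sup>+t. ennreal (pker y E t) \<partial>\<mu> j) = (\<integral>\<^sup>+w. ennreal (Im (gball x0 w (Complex E y) j x0)) \<partial>M)"
proof -
  interpret K: anderson_kernel \<gamma> Bd "n ^ j" "hker n p j" by (rule kernel)
  let ?z = "Complex E y"
  have z: "Im ?z > 0" using y by simp
  let ?c = "\<integral>\<^sup>+w. ennreal (Im (green {..<n ^ j} (hker n p j) w ?z 0 0)) \<partial>M"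
  have "(\<integral>\<^sup>+w. (\<Sum>x<n ^ j. ennreal (Im (green {..<n ^ j} (hker n p j) w ?z x x))) \<partial>M) =
      (\<Sum>x<n ^ j. \<integral>\<^sup>+w. ennreal (Im (green {..<n ^ j} (hker n p j) w ?z x x)) \<partial>M)"
    using y by (intro nn_integral_sum K.measurable_Im_green(2)) auto
  also have "\<dots> = (\<Sum>x<n ^ j. ?c)"
  proof (intro sum.cong refl)
    fix x assume "x \<in> {..<n ^ j}"
    then have "hball n x j = {..<n ^ j}" by (auto simp: hball_eq)
    then show "(\<integral>\<^sup>+w. ennreal (Im (green {..<n ^ j} (hker n p j) w ?z x x)) \<partial>M) = ?c"
      using nn_integral_green_dadd[OF z, of x j] by simp
  qed
  also have "\<dots> = ?c * ennreal (real (n ^ j))"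
    by (simp add: ennreal_of_nat_eq_real_of_nat mult.commute)
  finally have "(\<integral>\<^sup>+t. ennreal (pker y E t) \<partial>\<mu> j) = ?c * ennreal (real (n ^ j)) / ennreal (real (n ^ j))"
    unfolding \<mu>_def K.nn_integral_pker_dos[OF y] by simp
  also have "\<dots> = ?c" by (simp add: ennreal_mult_divide_eq)
  also have "\<dots> = (\<integral>\<^sup>+w. ennreal (Im (gball x0 w ?z j x0)) \<partial>M)"
    unfolding gball_def nn_integral_green_dadd[OF z] ..
  finally show ?thesis .
qed

lemma measurable_gball:
  assumes "Im z > 0"
  shows "(\<lambda>w. gball x0 w z j x0) \<in> borel_measurable M"
  unfolding gball_def using assms by (intro measurable_green symker_hker) auto

lemma norm_gball_le:
  assumes "Im z > 0"
  shows "cmod (gball x0 w z j x0) \<le> 1 / Im z"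
proof -
  interpret symker "hball n x0 j" "hker n p j" by (rule symker_hker) simp
  show ?thesis unfolding gball_def by (rule norm_green_le[OF assms]) simp
qed

lemma integrable_gball:
  assumes "Im z > 0"
  shows "integrable M (\<lambda>w. gball x0 w z j x0)"
  using norm_gball_le[OF assms] measurable_gball[OF assms]
  by (intro M.integrable_const_bound[of _ "1 / Im z"]) auto

lemma integrable_hresolvent:
  assumes z: "Im z > 0"
  shows "integrable M (\<lambda>w. hresolvent n p x0 w z)"
proof (rule M.integrable_const_bound[of _ "1 / Im z"])
  show "(\<lambda>w. hresolvent n p x0 w z) \<in> borel_measurable M"
    by (rule borel_measurable_LIMSEQ_metric[where f = "\<lambda>j w. gball x0 w z j x0"])
      (use measurable_gball[OF z] hresolvent_limit[OF z] in auto)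
  have "cmod (hresolvent n p x0 w z) \<le> 1 / Im z" for w
  proof (rule LIMSEQ_le_const2)
    show "(\<lambda>m. cmod (gball x0 w z m x0)) \<longlonglongrightarrow> cmod (hresolvent n p x0 w z)"
      by (intro tendsto_norm hresolvent_limit z)
    show "\<exists>N. \<forall>m\<ge>N. cmod (gball x0 w z m x0) \<le> 1 / Im z" using norm_gball_le[OF z] by blast
  qed
  then show "AE w in M. cmod (hresolvent n p x0 w z) \<le> 1 / Im z" by simp
qed

lemma integral_gball_close:
  assumes z: "Im z > 0"
  shows "cmod ((\<integral>w. gball x0 w z j x0 \<partial>M) - (\<integral>w. hresolvent n p x0 w z \<partial>M)) \<le> tail j / (Im z)\<^sup>2"
proof -
  have "(\<integral>w. gball x0 w z j x0 \<partial>M) - (\<integral>w. hresolvent n p x0 w z \<partial>M) =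
      (\<integral>w. gball x0 w z j x0 - hresolvent n p x0 w z \<partial>M)"
    by (rule Bochner_Integration.integral_diff[symmetric, OF integrable_gball[OF z] integrable_hresolvent[OF z]])
  also have "cmod \<dots> \<le> (\<integral>w. cmod (gball x0 w z j x0 - hresolvent n p x0 w z) \<partial>M)"
    by (rule integral_norm_bound)
  also have "\<dots> \<le> (\<integral>w. tail j / (Im z)\<^sup>2 \<partial>M)"
  proof (rule integral_mono)
    show "integrable M (\<lambda>w. cmod (gball x0 w z j x0 - hresolvent n p x0 w z))"
      by (intro integrable_norm Bochner_Integration.integrable_diff integrable_gball integrable_hresolvent z)
    show "cmod (gball x0 w z j x0 - hresolvent n p x0 w z) \<le> tail j / (Im z)\<^sup>2" for w
      using hresolvent_close[OF z, of x0 w j] by (simp add: norm_minus_commute)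
  qed simp
  also have "\<dots> = tail j / (Im z)\<^sup>2" using M.prob_space by simp
  finally show ?thesis .
qed

lemma integrable_eta: "integrable lborel \<eta>"
  using eta_prob eta_nonneg by (intro integrableI_nonneg) auto

lemma Im_eta_transform:
  assumes y: "y > 0"
  shows "Im (\<integral>t. complex_of_real (\<eta> t) / (complex_of_real t - Complex E y) \<partial>lborel) = (\<integral>t. pker y E t * \<eta> t \<partial>lborel)"
proof -
  have nz: "complex_of_real t - Complex E y \<noteq> 0" for t using y by (simp add: complex_eq_iff)
  have int: "integrable lborel (\<lambda>t. complex_of_real (\<eta> t) / (complex_of_real t - Complex E y))"
  proof (rule Bochner_Integration.integrable_bound[where f = "\<lambda>t. \<eta> t / y"])
    show "integrable lborel (\<lambda>t. \<eta> t / y)" using integrable_eta by simp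
    have "cmod (complex_of_real (\<eta> t) / (complex_of_real t - Complex E y)) \<le> \<eta> t / y" for t
    proof -
      have "y \<le> cmod (complex_of_real t - Complex E y)"
        using abs_Im_le_cmod[of "complex_of_real t - Complex E y"] y by simp
      then show ?thesis using y eta_nonneg[of t] by (simp add: norm_divide frac_le)
    qed
    then show "AE t in lborel. norm (complex_of_real (\<eta> t) / (complex_of_real t - Complex E y)) \<le> norm (\<eta> t / y)"
      using y eta_nonneg by simp
  qed measurable
  have "Im (\<integral>t. complex_of_real (\<eta> t) / (complex_of_real t - Complex E y) \<partial>lborel) =
      (\<integral>t. Im (complex_of_real (\<eta> t) / (complex_of_real t - Complex E y)) \<partial>lborel)"
    by (rule integral_Im[symmetric, OF int])
  also have "\<dots> = (\<integral>t. pker y E t * \<eta> t \<partial>lborel)"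
  proof (rule Bochner_Integration.integral_cong[OF refl])
    fix t
    have "Im (of_real r * u) = Im u * r" for r u by simp
    moreover have "complex_of_real (\<eta> t) / (complex_of_real t - Complex E y) =
        of_real (\<eta> t) * (1 / (complex_of_real t - Complex E y))" by simp
    ultimately show "Im (complex_of_real (\<eta> t) / (complex_of_real t - Complex E y)) = pker y E t * \<eta> t"
      by (simp only: Im_resolvent_kernel)
  qed
  finally show ?thesis .
qed

text \<open>Both transforms are imaginary parts of averaged resolvent entries at \<open>x0\<close>,
  and \<open>hresolvent_close\<close> is uniform in the potential, so it survives the
  expectation.\<close>

lemma poisson_\<mu>_close:
  fixes y E :: real
  assumes y: "y > 0"
  defines "I \<equiv> \<lambda>j. \<integral>w. Im (gball x0 w (Complex E y) j x0) \<partial>M"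
  shows "(\<integral>\<^sup>+t. ennreal (pker y E t) \<partial>\<mu> j) = ennreal (I j)"
    and "\<bar>I j - (\<integral>t. pker y E t * \<eta> t \<partial>lborel)\<bar> \<le> tail j / y\<^sup>2"
proof -
  let ?z = "Complex E y"
  have z: "Im ?z > 0" using y by simp
  interpret symker "hball n x0 j" "hker n p j" by (rule symker_hker) simp
  have pos: "Im (gball x0 w ?z j x0) \<ge> 0" for w
    unfolding gball_def using Im_green_pos[OF z hball_self, of w] by simp
  show "(\<integral>\<^sup>+t. ennreal (pker y E t) \<partial>\<mu> j) = ennreal (I j)"
    unfolding nn_integral_pker_\<mu>[OF y] I_def using pos integrable_gball[OF z]
    by (intro nn_integral_eq_integral) auto
  have "I j = Im (\<integral>w. gball x0 w ?z j x0 \<partial>M)"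
    unfolding I_def by (rule integral_Im[OF integrable_gball[OF z]])
  moreover have "(\<integral>t. pker y E t * \<eta> t \<partial>lborel) = Im (\<integral>w. hresolvent n p x0 w ?z \<partial>M)"
    unfolding Im_eta_transform[OF y, symmetric] eta_density[OF z] ..
  ultimately have "\<bar>I j - (\<integral>t. pker y E t * \<eta> t \<partial>lborel)\<bar> \<le>
      cmod ((\<integral>w. gball x0 w ?z j x0 \<partial>M) - (\<integral>w. hresolvent n p x0 w ?z \<partial>M))"
    using abs_Im_le_cmod[of "(\<integral>w. gball x0 w ?z j x0 \<partial>M) - (\<integral>w. hresolvent n p x0 w ?z \<partial>M)"] by simp
  also have "\<dots> \<le> tail j / y\<^sup>2" using integral_gball_close[OF z, of j] by simp
  finally show "\<bar>I j - (\<integral>t. pker y E t * \<eta> t \<partial>lborel)\<bar> \<le> tail j / y\<^sup>2" .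
qed

section \<open>Rescaling around \<open>e\<close> and convergence of the expected counts\<close>

definition sc :: "nat \<Rightarrow> real set \<Rightarrow> real set" where
  "sc k A = {t. real n ^ k * (t - e) \<in> A}"

lemma sc_borel [measurable]: "A \<in> sets borel \<Longrightarrow> sc k A \<in> sets borel"
proof -
  assume "A \<in> sets borel"
  then have "(\<lambda>t. real n ^ k * (t - e)) -` A \<inter> space borel \<in> sets borel" by (intro measurable_sets) auto
  then show ?thesis by (simp add: sc_def vimage_def)
qed

lemma sc_Icc: "sc k {a..b} = {e + a / real n ^ k..e + b / real n ^ k}"
  by (auto simp: sc_def field_simps)

lemma emeasure_sc:
  assumes "A \<in> sets borel"
  shows "ennreal (real n ^ k) * emeasure lborel (sc k A) = emeasure lborel A"
proof -
  let ?f = "\<lambda>t. - (real n ^ k * e) + real n ^ k * t"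
  have "emeasure lborel A = emeasure (density (distr lborel borel ?f) (\<lambda>_. ennreal \<bar>real n ^ k\<bar>)) A"
    by (subst lborel_real_affine[of "real n ^ k" "- (real n ^ k * e)"]) auto
  also have "\<dots> = ennreal (real n ^ k) * emeasure (distr lborel borel ?f) A"
    using assms by (simp add: emeasure_density nn_integral_cmult_indicator)
  also have "emeasure (distr lborel borel ?f) A = emeasure lborel (?f -` A \<inter> space lborel)"
    using assms by (intro emeasure_distr) auto
  also have "?f -` A \<inter> space lborel = sc k A" by (auto simp: sc_def algebra_simps)
  finally show ?thesis by simp
qed

lemma sc_disjoint: "A \<inter> B = {} \<Longrightarrow> sc k A \<inter> sc k B = {}"
  by (auto simp: sc_def)

text \<open>The volume factor of Wegner's estimate cancels against the scaling of Lebesgue measure,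
  leaving a bound uniform in the volume and in the truncation level.\<close>

lemma wegner_sc:
  assumes A: "A \<in> sets borel"
  shows "(\<integral>\<^sup>+w. ennreal (real (cnt (n ^ k) (hker n p j) w (sc k A))) \<partial>M) \<le> ennreal Bd * emeasure lborel A"
proof -
  interpret K: anderson_kernel \<gamma> Bd "n ^ k" "hker n p j" by (rule kernel)
  have "(\<integral>\<^sup>+w. ennreal (real (cnt (n ^ k) (hker n p j) w (sc k A))) \<partial>M) \<le>
      ennreal (real (n ^ k) * Bd) * emeasure lborel (sc k A)"
    using A by (intro K.wegner_cnt sc_borel)
  also have "\<dots> = ennreal Bd * (ennreal (real n ^ k) * emeasure lborel (sc k A))"
    using Bd_nonneg by (simp add: ennreal_mult ac_simps)
  finally show ?thesis unfolding emeasure_sc[OF A] .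
qed

text \<open>The expected point process of the decoupled operator: each of the
  \<open>n ^ (k - l k)\<close> blocks contributes \<open>n ^ l k\<close> times the rescaled block
  density of states, hence the total mass \<open>n ^ k\<close>.\<close>

definition \<nu> :: "nat \<Rightarrow> real measure" where
  "\<nu> k = scale_measure (ennreal (real n ^ k)) (distr (\<mu> (l k)) borel (\<lambda>t. real n ^ k * (t - e)))"

lemma sets_\<mu>: "sets (\<mu> j) = sets borel"
proof -
  interpret K: anderson_kernel \<gamma> Bd "n ^ j" "hker n p j" by (rule kernel)
  show ?thesis unfolding \<mu>_def by simp
qed

lemma space_\<mu>: "space (\<mu> j) = UNIV"
  using sets_eq_imp_space_eq[OF sets_\<mu>] by simp

lemma prob_space_\<mu>: "prob_space (\<mu> j)"
proof -
  interpret K: anderson_kernel \<gamma> Bd "n ^ j" "hker n p j" by (rule kernel)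
  show ?thesis unfolding \<mu>_def by (rule K.prob_space_dos)
qed

lemma scale_measurable: "(\<lambda>t. real n ^ k * (t - e)) \<in> measurable (\<mu> j) borel"
  unfolding measurable_cong_sets[OF sets_\<mu> refl] by measurable

lemma sets_\<nu> [simp]: "sets (\<nu> k) = sets borel"
  by (simp add: \<nu>_def)

lemma emeasure_\<nu>: "A \<in> sets borel \<Longrightarrow> emeasure (\<nu> k) A = ennreal (real n ^ k) * emeasure (\<mu> (l k)) (sc k A)"
  unfolding \<nu>_def emeasure_scale_measure using scale_measurable
  by (subst emeasure_distr) (auto simp: space_\<mu> sc_def vimage_def)

lemma finite_\<nu>: "finite_measure (\<nu> k)"
proof
  interpret P: prob_space "\<mu> (l k)" by (rule prob_space_\<mu>)
  have "emeasure (\<nu> k) (space (\<nu> k)) \<le> ennreal (real n ^ k) * 1"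
    using emeasure_\<nu>[of UNIV k] P.emeasure_space_1 by (simp add: sets_eq_imp_space_eq[OF sets_\<nu>] sc_def space_\<mu>)
  also have "\<dots> < \<infinity>" by simp
  finally show "emeasure (\<nu> k) (space (\<nu> k)) \<noteq> \<infinity>" by simp
qed

lemma nn_integral_pker_\<nu>:
  "(\<integral>\<^sup>+s. ennreal (pker y x s) \<partial>\<nu> k) = (\<integral>\<^sup>+t. ennreal (pker (y / real n ^ k) (e + x / real n ^ k) t) \<partial>\<mu> (l k))"
proof -
  have m: "(\<lambda>t. ennreal (pker y x (real n ^ k * (t - e)))) \<in> borel_measurable (\<mu> (l k))"
    by (rule measurable_compose[OF scale_measurable]) measurable
  have "(\<integral>\<^sup>+s. ennreal (pker y x s) \<partial>\<nu> k) =
      ennreal (real n ^ k) * (\<integral>\<^sup>+s. ennreal (pker y x s) \<partial>distr (\<mu> (l k)) borel (\<lambda>t. real n ^ k * (t - e)))"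
    unfolding \<nu>_def by (rule nn_integral_scale_measure) measurable
  also have "(\<integral>\<^sup>+s. ennreal (pker y x s) \<partial>distr (\<mu> (l k)) borel (\<lambda>t. real n ^ k * (t - e))) =
      (\<integral>\<^sup>+t. ennreal (pker y x (real n ^ k * (t - e))) \<partial>\<mu> (l k))"
    by (rule nn_integral_distr[OF scale_measurable]) measurable
  also have "ennreal (real n ^ k) * \<dots> = (\<integral>\<^sup>+t. ennreal (real n ^ k) * ennreal (pker y x (real n ^ k * (t - e))) \<partial>\<mu> (l k))"
    by (rule nn_integral_cmult[OF m, symmetric])
  also have "\<dots> = (\<integral>\<^sup>+t. ennreal (pker (y / real n ^ k) (e + x / real n ^ k) t) \<partial>\<mu> (l k))"
    by (intro nn_integral_cong) (simp add: pker_scale ennreal_mult')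
  finally show ?thesis .
qed

lemma pker_\<nu>_le:
  assumes "y > 0"
  shows "(\<integral>\<^sup>+s. ennreal (pker y x s) \<partial>\<nu> k) \<le> ennreal (pi * Bd)"
proof -
  interpret K: anderson_kernel \<gamma> Bd "n ^ l k" "hker n p (l k)" by (rule kernel)
  show ?thesis unfolding nn_integral_pker_\<nu> unfolding \<mu>_def
    using assms by (intro K.nn_integral_pker_dos_le) simp
qed

lemma \<nu>_le: "A \<in> sets borel \<Longrightarrow> emeasure (\<nu> k) A \<le> ennreal Bd * emeasure lborel A"
  by (rule density_bound_of_poisson_bound) (use finite_\<nu> Bd_nonneg pker_\<nu>_le in auto)

text \<open>Rescaling moves the transform to the point \<open>e + (x + i y) / n ^ k\<close>. There
  it is exchanged for the transform of \<open>\<eta>\<close> at the cost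
  \<open>(n ^ k)^2 * tail (l k) / y^2\<close>, which \<open>l_tail\<close> sends to zero; the rest
  is \<open>eta_limit\<close> along \<open>\<epsilon> = 1 / n ^ k\<close>.\<close>

lemma pker_\<nu>_tendsto:
  assumes y: "y > 0"
  shows "(\<lambda>k. \<integral>\<^sup>+s. ennreal (pker y x s) \<partial>\<nu> k) \<longlonglongrightarrow> ennreal (pi * \<eta> e)"
proof -
  define yk where "yk = (\<lambda>k. y / real n ^ k)"
  define ek where "ek = (\<lambda>k. e + x / real n ^ k)"
  have yk: "yk k > 0" for k using y by (simp add: yk_def)
  define I where "I = (\<lambda>k. \<integral>w. Im (gball x0 w (Complex (ek k) (yk k)) (l k) x0) \<partial>M)"
  define J where "J = (\<lambda>k. \<integral>t. pker (yk k) (ek k) t * \<eta> t \<partial>lborel)"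
  have eq: "(\<integral>\<^sup>+s. ennreal (pker y x s) \<partial>\<nu> k) = ennreal (I k)" for k
    unfolding nn_integral_pker_\<nu> I_def yk_def ek_def by (rule poisson_\<mu>_close(1)) (use y in simp)
  have dIJ: "norm (I k - J k) \<le> ((real n ^ k)\<^sup>2 * tail (l k)) / y\<^sup>2" for k
  proof -
    have "\<bar>I k - J k\<bar> \<le> tail (l k) / (yk k)\<^sup>2" unfolding I_def J_def by (rule poisson_\<mu>_close(2)[OF yk])
    also have "\<dots> = ((real n ^ k)\<^sup>2 * tail (l k)) / y\<^sup>2" by (simp add: yk_def power_divide mult.commute)
    finally show ?thesis by simp
  qed
  have "(\<lambda>k. ((real n ^ k)\<^sup>2 * tail (l k)) / y\<^sup>2) \<longlonglongrightarrow> 0 / y\<^sup>2"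
    using y by (intro tendsto_intros l_tail) auto
  then have g0: "(\<lambda>k. ((real n ^ k)\<^sup>2 * tail (l k)) / y\<^sup>2) \<longlonglongrightarrow> 0" by simp
  have IJ: "(\<lambda>k. I k - J k) \<longlonglongrightarrow> 0"
    by (intro Lim_null_comparison[OF _ g0] always_eventually allI dIJ)
  have "filterlim (\<lambda>k. 1 / real n ^ k) (at_right 0) sequentially"
  proof -
    have "(\<lambda>k. (1 / real n) ^ k) \<longlonglongrightarrow> 0" using n2 by (intro LIMSEQ_realpow_zero) auto
    then have "(\<lambda>k. 1 / real n ^ k) \<longlonglongrightarrow> 0" by (simp add: power_divide)
    then show ?thesis by (auto simp: filterlim_at intro!: always_eventually)
  qed
  from filterlim_compose[OF eta_limit[of "Complex x y"] this]
  have "(\<lambda>k. \<integral>t. Im (1 / (complex_of_real (t - e) - complex_of_real (1 / real n ^ k) * Complex x y)) * \<eta> t \<partial>lborel) \<longlonglongrightarrow> pi * \<eta> e"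
    using y by simp
  moreover have "Im (1 / (complex_of_real (t - e) - complex_of_real (1 / real n ^ k) * Complex x y)) = pker (yk k) (ek k) t" for t k
  proof -
    have "complex_of_real (t - e) - complex_of_real (1 / real n ^ k) * Complex x y = complex_of_real t - Complex (ek k) (yk k)"
      by (simp add: complex_eq_iff ek_def yk_def)
    then show ?thesis by (simp only: Im_resolvent_kernel)
  qed
  ultimately have "J \<longlonglongrightarrow> pi * \<eta> e" unfolding J_def by simp
  from tendsto_add[OF IJ this] have "I \<longlonglongrightarrow> pi * \<eta> e" by simp
  then show ?thesis unfolding eq by (rule tendsto_ennrealI)
qed

lemma \<nu>_interval_tendsto:
  assumes "a \<le> b"
  shows "(\<lambda>k. measure (\<nu> k) {a..b}) \<longlonglongrightarrow> \<eta> e * (b - a)"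
  by (rule interval_mass_limit[where B = Bd])
    (use assms finite_\<nu> Bd_nonneg \<nu>_le pker_\<nu>_le pker_\<nu>_tendsto eta_nonneg in auto)

lemma finite_lborel_bounded: "A \<in> sets borel \<Longrightarrow> A \<subseteq> {a..b::real} \<Longrightarrow> emeasure lborel A < \<infinity>"
  by (rule le_less_trans[OF emeasure_mono[of _ "{a..b}"]]) (auto simp: emeasure_lborel_Icc_eq)

lemma emeasure_lborel_measure: "A \<in> sets borel \<Longrightarrow> A \<subseteq> {a..b::real} \<Longrightarrow> emeasure lborel A = ennreal (measure lborel A)"
  using finite_lborel_bounded by (metis emeasure_eq_ennreal_measure infinity_ennreal_def order_less_irrefl)

text \<open>The absolute deviation from the limiting measure is countably subadditive and, by
  Wegner, dominated by Lebesgue measure, so convergence on intervals spreads to bounded Borel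
  sets.\<close>

lemma \<nu>_tendsto:
  assumes A: "A \<in> sets borel" "A \<subseteq> {a..b}"
  shows "(\<lambda>k. measure (\<nu> k) A) \<longlonglongrightarrow> \<eta> e * measure lborel A"
proof -
  define F where "F = (\<lambda>k A. \<bar>measure (\<nu> k) A - \<eta> e * measure lborel A\<bar>)"
  have nu_le: "measure (\<nu> k) A \<le> Bd * measure lborel A" if "A \<in> sets borel" "A \<subseteq> {a..b}" for k A
  proof -
    interpret N: finite_measure "\<nu> k" by (rule finite_\<nu>)
    have "ennreal (measure (\<nu> k) A) \<le> ennreal (Bd * measure lborel A)"
      using \<nu>_le[OF that(1), of k] Bd_nonneg unfolding emeasure_lborel_measure[OF that] N.emeasure_eq_measure
      by (simp add: ennreal_mult)
    then show ?thesis using Bd_nonneg by (subst (asm) ennreal_le_iff) auto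
  qed
  have "(\<lambda>k. F k A) \<longlonglongrightarrow> 0"
  proof (rule vanishing_on_borel_sets[OF refl, where C = "Bd + \<eta> e" and F = F])
    show "Bd + \<eta> e \<ge> 0" using Bd_nonneg eta_nonneg by simp
    show "F k A \<ge> 0" for k A by (simp add: F_def)
    show "F k A \<le> (Bd + \<eta> e) * measure lborel A" if "A \<in> sets borel" "A \<subseteq> {a..b}" for k A
    proof -
      have "0 \<le> measure (\<nu> k) A" "0 \<le> \<eta> e * measure lborel A" using eta_nonneg[of e] by auto
      then have "F k A \<le> measure (\<nu> k) A + \<eta> e * measure lborel A" unfolding F_def by linarith
      then show ?thesis using nu_le[OF that, of k] by (simp add: algebra_simps)
    qed
    show "(\<lambda>k. F k {p..q}) \<longlonglongrightarrow> 0" if "p \<le> q" for p q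
    proof -
      have "(\<lambda>k. measure (\<nu> k) {p..q} - \<eta> e * (q - p)) \<longlonglongrightarrow> \<eta> e * (q - p) - \<eta> e * (q - p)"
        by (intro tendsto_intros \<nu>_interval_tendsto that)
      then show ?thesis unfolding F_def using that by (intro tendsto_rabs_zero) simp
    qed
    show "F k ({a..b} - A) \<le> F k {a..b} + F k A" if "A \<in> sets borel" "A \<subseteq> {a..b}" for k A
    proof -
      interpret N: finite_measure "\<nu> k" by (rule finite_\<nu>)
      have eq1: "measure (\<nu> k) ({a..b} - A) = measure (\<nu> k) {a..b} - measure (\<nu> k) A"
        using that by (intro N.finite_measure_Diff) auto
      have eq2: "measure lborel ({a..b} - A) = measure lborel {a..b} - measure lborel A"
        using that finite_lborel_bounded[OF that] by (intro measure_Diff) (auto simp: less_top emeasure_lborel_Icc_eq)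
      show ?thesis unfolding F_def eq1 eq2 right_diff_distrib by linarith
    qed
    show "F k (\<Union>i. A i) \<le> (\<Sum>i. F k (A i))"
      if "\<And>i. A i \<in> sets borel" "\<And>i. A i \<subseteq> {a..b}" "disjoint_family A" "summable (\<lambda>i. F k (A i))" for k and A :: "nat \<Rightarrow> real set"
    proof -
      interpret N: finite_measure "\<nu> k" by (rule finite_\<nu>)
      have "emeasure lborel (\<Union>i. A i) < \<infinity>" using that by (intro finite_lborel_bounded[of _ a b]) auto
      then have "(\<lambda>i. measure lborel (A i)) sums measure lborel (\<Union>i. A i)"
        using that by (intro measure_UNION) (auto simp: less_top)
      moreover have "(\<lambda>i. measure (\<nu> k) (A i)) sums measure (\<nu> k) (\<Union>i. A i)"
        using that by (intro N.finite_measure_UNION) auto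
      ultimately have "(\<lambda>i. measure (\<nu> k) (A i) - \<eta> e * measure lborel (A i)) sums
          (measure (\<nu> k) (\<Union>i. A i) - \<eta> e * measure lborel (\<Union>i. A i))"
        by (intro sums_diff sums_mult)
      then have "F k (\<Union>i. A i) = \<bar>\<Sum>i. measure (\<nu> k) (A i) - \<eta> e * measure lborel (A i)\<bar>"
        unfolding F_def by (simp add: sums_iff)
      also have "\<dots> \<le> (\<Sum>i. F k (A i))" using that(4) unfolding F_def by (rule summable_rabs)
      finally show ?thesis .
    qed
  qed (use A in auto)
  then have "(\<lambda>k. measure (\<nu> k) A - \<eta> e * measure lborel A) \<longlonglongrightarrow> 0"
    unfolding F_def by (rule tendsto_rabs_zero_cancel)
  then show ?thesis by (simp add: LIM_zero_iff)
qed

section \<open>Comparison of the full and the decoupled counts\<close>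

lemma measurable_cnt_sc:
  assumes "A \<in> sets borel"
  shows "(\<lambda>w. cnt (n ^ k) (hker n p j) w (sc i A)) \<in> measurable M (count_space UNIV)"
proof -
  interpret K: anderson_kernel \<gamma> Bd "n ^ k" "hker n p j" by (rule kernel)
  show ?thesis by (rule K.measurable_cnt[OF sc_borel[OF assms]])
qed

abbreviation \<xi> :: "nat \<Rightarrow> (nat \<Rightarrow> real) \<Rightarrow> real set \<Rightarrow> nat" where
  "\<xi> k w A \<equiv> cnt (n ^ k) (hker n p k) w (sc k A)"

abbreviation \<xi>' :: "nat \<Rightarrow> (nat \<Rightarrow> real) \<Rightarrow> real set \<Rightarrow> nat" where
  "\<xi>' k w A \<equiv> cnt (n ^ k) (hker n p (l k)) w (sc k A)"

definition L1 :: "nat \<Rightarrow> real set \<Rightarrow> real" where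
  "L1 k A = enn2real (\<integral>\<^sup>+w. ennreal \<bar>real (\<xi> k w A) - real (\<xi>' k w A)\<bar> \<partial>M)"

lemma L1_nonneg: "L1 k A \<ge> 0"
  by (simp add: L1_def)

lemma measurable_diff_cnt:
  assumes "A \<in> sets borel"
  shows "(\<lambda>w. ennreal \<bar>real (\<xi> k w A) - real (\<xi>' k w A)\<bar>) \<in> borel_measurable M"
proof -
  have [measurable]: "(\<lambda>w. real (\<xi> k w A)) \<in> borel_measurable M" "(\<lambda>w. real (\<xi>' k w A)) \<in> borel_measurable M"
    by (rule measurable_compose[OF measurable_cnt_sc[OF assms]], simp)+
  show ?thesis by measurable
qed

lemma L1_ennreal:
  assumes A: "A \<in> sets borel" "A \<subseteq> {a..b}"
  shows "(\<integral>\<^sup>+w. ennreal \<bar>real (\<xi> k w A) - real (\<xi>' k w A)\<bar> \<partial>M) \<le> ennreal (2 * Bd * measure lborel A)"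
    and "(\<integral>\<^sup>+w. ennreal \<bar>real (\<xi> k w A) - real (\<xi>' k w A)\<bar> \<partial>M) = ennreal (L1 k A)"
proof -
  have m: "(\<lambda>w. ennreal (real (\<xi> k w A))) \<in> borel_measurable M" "(\<lambda>w. ennreal (real (\<xi>' k w A))) \<in> borel_measurable M"
    by (rule measurable_compose[OF measurable_cnt_sc[OF A(1)]], simp)+
  have "(\<integral>\<^sup>+w. ennreal \<bar>real (\<xi> k w A) - real (\<xi>' k w A)\<bar> \<partial>M) \<le>
      (\<integral>\<^sup>+w. ennreal (real (\<xi> k w A)) + ennreal (real (\<xi>' k w A)) \<partial>M)"
    by (intro nn_integral_mono) (auto simp: abs_le_iff simp flip: ennreal_plus intro!: ennreal_leI)
  also have "\<dots> = (\<integral>\<^sup>+w. ennreal (real (\<xi> k w A)) \<partial>M) + (\<integral>\<^sup>+w. ennreal (real (\<xi>' k w A)) \<partial>M)"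
    by (rule nn_integral_add[OF m])
  also have "\<dots> \<le> ennreal Bd * emeasure lborel A + ennreal Bd * emeasure lborel A"
    by (intro add_mono wegner_sc A)
  also have "\<dots> = ennreal (2 * Bd * measure lborel A)"
    unfolding emeasure_lborel_measure[OF A] using Bd_nonneg by (simp flip: ennreal_mult ennreal_plus)
  finally show le: "(\<integral>\<^sup>+w. ennreal \<bar>real (\<xi> k w A) - real (\<xi>' k w A)\<bar> \<partial>M) \<le> ennreal (2 * Bd * measure lborel A)" .
  then have "(\<integral>\<^sup>+w. ennreal \<bar>real (\<xi> k w A) - real (\<xi>' k w A)\<bar> \<partial>M) < \<top>"
    by (rule le_less_trans) simp
  then show "(\<integral>\<^sup>+w. ennreal \<bar>real (\<xi> k w A) - real (\<xi>' k w A)\<bar> \<partial>M) = ennreal (L1 k A)"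
    unfolding L1_def by simp
qed

lemma cnt_UNION_sums:
  assumes "\<And>i. A i \<in> sets borel" "disjoint_family A"
  shows "(\<lambda>i. real (cnt (n ^ k) (hker n p j) w (sc k (A i)))) sums real (cnt (n ^ k) (hker n p j) w (sc k (\<Union>i::nat. A i)))"
proof -
  interpret K: anderson_kernel \<gamma> Bd "n ^ k" "hker n p j" by (rule kernel)
  interpret E: prob_space "esm (n ^ k) (hker n p j) w" by (rule prob_space_esm)
  have m: "measure (esm (n ^ k) (hker n p j) w) A = real (cnt (n ^ k) (hker n p j) w A) / real (n ^ k)" if "A \<in> sets borel" for A
    using K.esm_cnt[OF that, of w] by (simp add: measure_def)
  have "(\<lambda>i. measure (esm (n ^ k) (hker n p j) w) (sc k (A i))) sums measure (esm (n ^ k) (hker n p j) w) (\<Union>i. sc k (A i))"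
    using assms by (intro E.finite_measure_UNION) (auto simp: disjoint_family_on_def sc_def)
  moreover have "(\<Union>i. sc k (A i)) = sc k (\<Union>i. A i)" by (auto simp: sc_def)
  ultimately have "(\<lambda>i. real (cnt (n ^ k) (hker n p j) w (sc k (A i))) / real (n ^ k)) sums
      (real (cnt (n ^ k) (hker n p j) w (sc k (\<Union>i. A i))) / real (n ^ k))"
    using assms by (simp add: m sc_borel)
  from sums_mult[OF this, of "real (n ^ k)"] show ?thesis by simp
qed

lemma tail_scaled_tendsto: "(\<lambda>k. real n ^ k * tail (l k)) \<longlonglongrightarrow> 0"
proof (rule Lim_null_comparison[OF _ l_tail], intro always_eventually allI)
  fix k
  have "1 \<le> real n ^ k" using n2 by simp
  then have "1 * (real n ^ k * tail (l k)) \<le> real n ^ k * (real n ^ k * tail (l k))"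
    using tail_nonneg by (intro mult_right_mono) auto
  then show "norm (real n ^ k * tail (l k)) \<le> (real n ^ k)\<^sup>2 * tail (l k)"
    using tail_nonneg[of "l k"] by (simp add: power2_eq_square ac_simps)
qed

text \<open>By Weyl, each count of the interval is at most the other operator's count of the
  enlarged interval, so they can differ only through eigenvalues near an endpoint, which Wegner's
  estimate makes rare. The factor 4 counts two collars for each of the two operators.\<close>

lemma L1_interval_le:
  assumes "u \<le> v"
  shows "L1 k {u..v} \<le> 4 * Bd * (real n ^ k * tail (l k))"
proof -
  let ?d = "real n ^ k * tail (l k)"
  have d0: "?d \<ge> 0" using tail_nonneg by simp
  \<comment> \<open>The collars gained by the enlargement; the energy shift
    \<open>tail (l k)\<close> becomes \<open>?d\<close> after rescaling.\<close>
  let ?W = "{u - ?d..<u} \<union> {v<..v + ?d}"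
  have dsc: "?d / real n ^ k = tail (l k)" by simp
  have enl: "sc k {u - ?d..v + ?d} = {e + u / real n ^ k - tail (l k)..e + v / real n ^ k + tail (l k)}"
    unfolding sc_Icc by (simp add: diff_divide_distrib add_divide_distrib)
  have W: "{u - ?d..v + ?d} = {u..v} \<union> ?W" "{u..v} \<inter> ?W = {}" using assms d0 by auto
  have row': "(\<Sum>y<n ^ k. \<bar>hker n p k x y - hker n p (l k) x y\<bar>) \<le> tail (l k)" for x
    by (rule row_sum_diff_le[OF _ l_le]) simp
  have row: "(\<Sum>y<n ^ k. \<bar>hker n p (l k) x y - hker n p k x y\<bar>) \<le> tail (l k)" for x
    using row'[of x] by (simp add: abs_minus_commute)
  have split: "cnt (n ^ k) b w (sc k {u - ?d..v + ?d}) = cnt (n ^ k) b w (sc k {u..v}) + cnt (n ^ k) b w (sc k ?W)" for b w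
  proof -
    have "sc k {u - ?d..v + ?d} = sc k {u..v} \<union> sc k ?W" unfolding W(1) by (auto simp: sc_def)
    then show ?thesis using cnt_Un[OF sc_disjoint[OF W(2)]] by simp
  qed
  have "\<xi> k w {u..v} \<le> \<xi>' k w {u..v} + \<xi>' k w ?W" for w
  proof -
    have "\<xi> k w {u..v} \<le> \<xi>' k w {u - ?d..v + ?d}"
      unfolding enl sc_Icc[of k u v] by (rule cnt_weyl_kernel) (rule hker_sym row tail_nonneg)+
    then show ?thesis unfolding split .
  qed
  moreover have "\<xi>' k w {u..v} \<le> \<xi> k w {u..v} + \<xi> k w ?W" for w
  proof -
    have "\<xi>' k w {u..v} \<le> \<xi> k w {u - ?d..v + ?d}"
      unfolding enl sc_Icc[of k u v] by (rule cnt_weyl_kernel) (rule hker_sym row' tail_nonneg)+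
    then show ?thesis unfolding split .
  qed
  ultimately have le: "\<bar>real (\<xi> k w {u..v}) - real (\<xi>' k w {u..v})\<bar> \<le> real (\<xi> k w ?W) + real (\<xi>' k w ?W)" for w
  proof -
    assume a: "\<And>w. \<xi> k w {u..v} \<le> \<xi>' k w {u..v} + \<xi>' k w ?W" and b: "\<And>w. \<xi>' k w {u..v} \<le> \<xi> k w {u..v} + \<xi> k w ?W"
    have "real (\<xi> k w {u..v}) \<le> real (\<xi>' k w {u..v}) + real (\<xi>' k w ?W)" using a[of w] by linarith
    moreover have "real (\<xi>' k w {u..v}) \<le> real (\<xi> k w {u..v}) + real (\<xi> k w ?W)" using b[of w] by linarith
    ultimately show ?thesis by (simp add: abs_le_iff)
  qed
  have Wb: "?W \<in> sets borel" by simp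
  have Wm: "emeasure lborel ?W \<le> ennreal (2 * ?d)"
  proof -
    have "emeasure lborel ?W \<le> emeasure lborel {u - ?d..<u} + emeasure lborel {v<..v + ?d}"
      by (rule emeasure_subadditive) auto
    also have "\<dots> = ennreal (2 * ?d)" using d0 by (simp add: mult.commute flip: ennreal_plus)
    finally show ?thesis .
  qed
  have m: "(\<lambda>w. ennreal (real (\<xi> k w ?W))) \<in> borel_measurable M" "(\<lambda>w. ennreal (real (\<xi>' k w ?W))) \<in> borel_measurable M"
    by (rule measurable_compose[OF measurable_cnt_sc[OF Wb]], simp)+
  have "(\<integral>\<^sup>+w. ennreal \<bar>real (\<xi> k w {u..v}) - real (\<xi>' k w {u..v})\<bar> \<partial>M) \<le>
      (\<integral>\<^sup>+w. ennreal (real (\<xi> k w ?W)) + ennreal (real (\<xi>' k w ?W)) \<partial>M)"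
    using le by (intro nn_integral_mono) (auto simp flip: ennreal_plus intro!: ennreal_leI)
  also have "\<dots> = (\<integral>\<^sup>+w. ennreal (real (\<xi> k w ?W)) \<partial>M) + (\<integral>\<^sup>+w. ennreal (real (\<xi>' k w ?W)) \<partial>M)"
    by (rule nn_integral_add[OF m])
  also have "\<dots> \<le> ennreal Bd * emeasure lborel ?W + ennreal Bd * emeasure lborel ?W"
    by (intro add_mono wegner_sc Wb)
  also have "\<dots> \<le> ennreal Bd * ennreal (2 * ?d) + ennreal Bd * ennreal (2 * ?d)"
    by (intro add_mono mult_left_mono Wm) auto
  also have "\<dots> = ennreal (4 * Bd * ?d)"
    using Bd_nonneg d0 by (simp add: ac_simps flip: ennreal_mult ennreal_plus)
  finally show ?thesis unfolding L1_def using Bd_nonneg d0 by (intro enn2real_leI) auto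
qed

lemma L1_tendsto:
  assumes A: "A \<in> sets borel" "A \<subseteq> {a..b}"
  shows "(\<lambda>k. L1 k A) \<longlonglongrightarrow> 0"
proof (rule vanishing_on_borel_sets[OF refl, where C = "2 * Bd" and F = L1])
  show "2 * Bd \<ge> 0" using Bd_nonneg by simp
  show "L1 k A \<ge> 0" for k A by (rule L1_nonneg)
  show "L1 k A \<le> 2 * Bd * measure lborel A" if "A \<in> sets borel" "A \<subseteq> {a..b}" for k A
    unfolding L1_def using L1_ennreal(1)[OF that] Bd_nonneg by (intro enn2real_leI) auto
  show "(\<lambda>k. L1 k {u..v}) \<longlonglongrightarrow> 0" if "u \<le> v" for u v
  proof (rule Lim_null_comparison)
    show "\<forall>\<^sub>F k in sequentially. norm (L1 k {u..v}) \<le> 4 * Bd * (real n ^ k * tail (l k))"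
      using L1_interval_le[OF that] L1_nonneg by (auto intro!: always_eventually)
    have "(\<lambda>k. 4 * Bd * (real n ^ k * tail (l k))) \<longlonglongrightarrow> 4 * Bd * 0" by (intro tendsto_intros tail_scaled_tendsto)
    then show "(\<lambda>k. 4 * Bd * (real n ^ k * tail (l k))) \<longlonglongrightarrow> 0" by simp
  qed
  show "L1 k ({a..b} - A) \<le> L1 k {a..b} + L1 k A" if A: "A \<in> sets borel" "A \<subseteq> {a..b}" for k A
  proof -
    have dec: "cnt (n ^ k) c w (sc k {a..b}) = cnt (n ^ k) c w (sc k A) + cnt (n ^ k) c w (sc k ({a..b} - A))" for c w
    proof -
      have "sc k {a..b} = sc k A \<union> sc k ({a..b} - A)" using A by (auto simp: sc_def)
      then show ?thesis using cnt_Un[OF sc_disjoint[of A "{a..b} - A"]] by simp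
    qed
    have "ennreal (L1 k ({a..b} - A)) = (\<integral>\<^sup>+w. ennreal \<bar>real (\<xi> k w ({a..b} - A)) - real (\<xi>' k w ({a..b} - A))\<bar> \<partial>M)"
      using A by (intro L1_ennreal(2)[symmetric, of _ a b]) auto
    also have "\<dots> \<le> (\<integral>\<^sup>+w. ennreal \<bar>real (\<xi> k w {a..b}) - real (\<xi>' k w {a..b})\<bar> + ennreal \<bar>real (\<xi> k w A) - real (\<xi>' k w A)\<bar> \<partial>M)"
      unfolding dec by (intro nn_integral_mono) (auto simp flip: ennreal_plus intro!: ennreal_leI)
    also have "\<dots> = (\<integral>\<^sup>+w. ennreal \<bar>real (\<xi> k w {a..b}) - real (\<xi>' k w {a..b})\<bar> \<partial>M) + (\<integral>\<^sup>+w. ennreal \<bar>real (\<xi> k w A) - real (\<xi>' k w A)\<bar> \<partial>M)"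
      using A by (intro nn_integral_add measurable_diff_cnt) auto
    also have "\<dots> = ennreal (L1 k {a..b}) + ennreal (L1 k A)"
      using A by (intro arg_cong2[where f = "(+)"] L1_ennreal(2)[of _ a b]) auto
    also have "\<dots> = ennreal (L1 k {a..b} + L1 k A)" by (rule ennreal_plus[symmetric]) (rule L1_nonneg)+
    finally have le: "ennreal (L1 k ({a..b} - A)) \<le> ennreal (L1 k {a..b} + L1 k A)" .
    show ?thesis by (rule ennreal_le_iff[THEN iffD1, OF _ le]) (rule add_nonneg_nonneg[OF L1_nonneg L1_nonneg])
  qed
  show "L1 k (\<Union>i. A i) \<le> (\<Sum>i. L1 k (A i))"
    if A: "\<And>i. A i \<in> sets borel" "\<And>i. A i \<subseteq> {a..b}" "disjoint_family A" and s: "summable (\<lambda>i. L1 k (A i))" for k and A :: "nat \<Rightarrow> real set"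
  proof -
    have "ennreal (L1 k (\<Union>i. A i)) = (\<integral>\<^sup>+w. ennreal \<bar>real (\<xi> k w (\<Union>i. A i)) - real (\<xi>' k w (\<Union>i. A i))\<bar> \<partial>M)"
      using A by (intro L1_ennreal(2)[symmetric, of _ a b]) auto
    also have "\<dots> \<le> (\<integral>\<^sup>+w. (\<Sum>i. ennreal \<bar>real (\<xi> k w (A i)) - real (\<xi>' k w (A i))\<bar>) \<partial>M)"
    proof (rule nn_integral_mono)
      fix w
      have s1: "(\<lambda>i. real (\<xi> k w (A i))) sums real (\<xi> k w (\<Union>i. A i))" by (rule cnt_UNION_sums[OF A(1,3)])
      have s2: "(\<lambda>i. real (\<xi>' k w (A i))) sums real (\<xi>' k w (\<Union>i. A i))" by (rule cnt_UNION_sums[OF A(1,3)])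
      have sd: "summable (\<lambda>i. \<bar>real (\<xi> k w (A i)) - real (\<xi>' k w (A i))\<bar>)"
        by (rule summable_comparison_test'[OF sums_summable[OF sums_add[OF s1 s2]], of 0]) (auto simp: abs_le_iff)
      have "\<bar>real (\<xi> k w (\<Union>i. A i)) - real (\<xi>' k w (\<Union>i. A i))\<bar> = \<bar>\<Sum>i. real (\<xi> k w (A i)) - real (\<xi>' k w (A i))\<bar>"
        using sums_diff[OF s1 s2] by (simp add: sums_iff)
      also have "\<dots> \<le> (\<Sum>i. \<bar>real (\<xi> k w (A i)) - real (\<xi>' k w (A i))\<bar>)" by (rule summable_rabs[OF sd])
      finally have "ennreal \<bar>real (\<xi> k w (\<Union>i. A i)) - real (\<xi>' k w (\<Union>i. A i))\<bar> \<le>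
          ennreal (\<Sum>i. \<bar>real (\<xi> k w (A i)) - real (\<xi>' k w (A i))\<bar>)" by (rule ennreal_leI)
      also have "\<dots> = (\<Sum>i. ennreal \<bar>real (\<xi> k w (A i)) - real (\<xi>' k w (A i))\<bar>)"
        by (rule suminf_ennreal2[OF _ sd, symmetric]) simp
      finally show "ennreal \<bar>real (\<xi> k w (\<Union>i. A i)) - real (\<xi>' k w (\<Union>i. A i))\<bar> \<le>
          (\<Sum>i. ennreal \<bar>real (\<xi> k w (A i)) - real (\<xi>' k w (A i))\<bar>)" .
    qed
    also have "\<dots> = (\<Sum>i. \<integral>\<^sup>+w. ennreal \<bar>real (\<xi> k w (A i)) - real (\<xi>' k w (A i))\<bar> \<partial>M)"
      by (rule nn_integral_suminf) (rule measurable_diff_cnt[OF A(1)])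
    also have "\<dots> = (\<Sum>i. ennreal (L1 k (A i)))"
      by (intro suminf_cong L1_ennreal(2)[OF A(1,2)])
    also have "\<dots> = ennreal (\<Sum>i. L1 k (A i))" by (rule suminf_ennreal2[OF L1_nonneg s])
    finally have le: "ennreal (L1 k (\<Union>i. A i)) \<le> ennreal (\<Sum>i. L1 k (A i))" .
    show ?thesis by (rule ennreal_le_iff[THEN iffD1, OF _ le]) (rule suminf_nonneg[OF s L1_nonneg])
  qed
qed (use A in auto)

end

section \<open>First-order expansion of the law of a rare vector\<close>

definition lin :: "nat \<Rightarrow> (nat \<Rightarrow> nat) \<Rightarrow> (nat \<Rightarrow> real) \<Rightarrow> real" where
  "lin m q v = (if (\<Sum>s<m. q s) = 0 then - (\<Sum>s<m. v s) else if (\<Sum>s<m. q s) = 1 then (\<Sum>s<m. real (q s) * v s) else 0)"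

lemma sum_nat_eq_1:
  fixes q :: "nat \<Rightarrow> nat"
  assumes "(\<Sum>s<m. q s) = 1"
  shows "\<exists>a<m. q a = 1 \<and> (\<forall>b<m. a \<noteq> b \<longrightarrow> q b = 0)"
  using assms sum_eq_1_iff[of "{..<m}" q] by (metis finite_lessThan lessThan_iff)

text \<open>Up to the Minami term, the indicator of a vector of counts is affine in the counts.\<close>
lemma indicator_near_affine:
  fixes q v :: "nat \<Rightarrow> nat"
  assumes TZ: "(\<Sum>s<m. v s) \<le> Z"
  shows "\<bar>of_bool (\<forall>s<m. v s = q s) - of_bool ((\<Sum>s<m. q s) = 0) - lin m q (\<lambda>s. real (v s))\<bar> \<le> real (Z * (Z - 1))"
proof -
  define T where "T = (\<Sum>s<m. v s)"
  define Q where "Q = (\<Sum>s<m. q s)"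
  define L where "L = (\<Sum>s<m. real (q s) * real (v s))"
  define b where "b \<longleftrightarrow> (\<forall>s<m. v s = q s)"
  have Tq: "T = Q" if b using that by (simp add: T_def Q_def b_def)
  have L0: "0 \<le> L" unfolding L_def by (intro sum_nonneg) auto
  have lin: "lin m q (\<lambda>s. real (v s)) = (if Q = 0 then - real T else if Q = 1 then L else 0)"
    unfolding lin_def Q_def[symmetric] L_def T_def by simp
  have LT: "L \<le> real T" if "Q = 1"
  proof -
    have "real (q s) * real (v s) \<le> real (v s)" if "s \<in> {..<m}" for s
    proof -
      have "q s \<le> 1" using member_le_sum[of s "{..<m}" q] that \<open>Q = 1\<close> by (simp add: Q_def)
      then have "q s * v s \<le> 1 * v s" by (intro mult_le_mono1)
      then show ?thesis by (metis mult_1 of_nat_le_iff of_nat_mult)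
    qed
    then have "L \<le> (\<Sum>s<m. real (v s))" unfolding L_def by (intro sum_mono)
    then show ?thesis by (simp add: T_def)
  qed
  have L1: "L = of_bool b" if T1: "T = 1" and Q1: "Q = 1"
  proof -
    obtain a where a: "a < m" "v a = 1" "\<And>i. i < m \<Longrightarrow> a \<noteq> i \<Longrightarrow> v i = 0"
      using sum_nat_eq_1[where q = v and m = m] T1 unfolding T_def by blast
    obtain c where c: "c < m" "q c = 1" "\<And>i. i < m \<Longrightarrow> c \<noteq> i \<Longrightarrow> q i = 0"
      using sum_nat_eq_1[where q = q and m = m] Q1 unfolding Q_def by blast
    have "L = (\<Sum>s<m. if s = a then real (q a) else 0)"
      unfolding L_def using a by (intro sum.cong refl) auto
    then have L: "L = real (q a)" using a(1) by simp
    show ?thesis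
    proof (cases "a = c")
      case True
      then have b unfolding b_def using a c by metis
      then show ?thesis using True c L by simp
    next
      case False
      then have qa: "q a = 0" using c(3)[OF a(1)] by simp
      then have "\<not> b" unfolding b_def using a(1,2) by force
      then show ?thesis using qa L by simp
    qed
  qed
  have b0: b if "T = 0" "Q = 0" using that by (auto simp: b_def T_def Q_def)
  have ZZ: "real T \<le> real (Z * (Z - 1))" if "2 \<le> T"
  proof -
    have "2 \<le> Z" using that TZ by (simp add: T_def)
    then have "Z * 1 \<le> Z * (Z - 1)" by (intro mult_le_mono2) auto
    then show ?thesis using TZ unfolding T_def[symmetric]
      by (metis (no_types) mult.right_neutral of_nat_le_iff order.trans)
  qed
  \<comment> \<open>The affine expression is exact when the total \<open>T\<close> is 0 or 1; from 2
    on the error is at most \<open>T\<close>, which the product \<open>Z * (Z - 1)\<close>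
    dominates.\<close>
  have "\<bar>of_bool b - of_bool (Q = 0) - lin m q (\<lambda>s. real (v s))\<bar> \<le> (if 2 \<le> T then real T else 0)"
  proof (cases b)
    case True
    then show ?thesis using Tq L0 LT L1 unfolding lin by (cases "Q = 0"; cases "Q = 1") auto
  next
    case False
    have "L = 0" if "T = 0" "Q = 1" using LT[OF that(2)] L0 that(1) by simp
    moreover have "T = 0 \<or> T = 1 \<or> 2 \<le> T" by linarith
    ultimately show ?thesis using False b0 L0 LT L1 unfolding lin by (cases "Q = 0"; cases "Q = 1") auto
  qed
  also have "\<dots> \<le> real (Z * (Z - 1))" using ZZ by auto
  finally show ?thesis unfolding b_def Q_def .
qed

lemma vpois_expand:
  "vpois m \<Lambda> t q = exp (- (t * (\<Sum>s<m. \<Lambda> s))) * t ^ (\<Sum>s<m. q s) * (\<Prod>s<m. \<Lambda> s ^ q s / fact (q s))"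
proof -
  have "vpois m \<Lambda> t q = (\<Prod>s<m. exp (- (t * \<Lambda> s)) * t ^ q s * (\<Lambda> s ^ q s / fact (q s)))"
    unfolding vpois_def pois_def by (simp add: power_mult_distrib mult.assoc)
  also have "\<dots> = (\<Prod>s<m. exp (- (t * \<Lambda> s))) * (\<Prod>s<m. t ^ q s) * (\<Prod>s<m. \<Lambda> s ^ q s / fact (q s))"
    by (simp only: prod.distrib)
  also have "(\<Prod>s<m. exp (- (t * \<Lambda> s))) = exp (- (t * (\<Sum>s<m. \<Lambda> s)))"
    by (simp add: exp_sum[symmetric] sum_negf sum_distrib_left)
  also have "(\<Prod>s<m. t ^ q s) = t ^ (\<Sum>s<m. q s)" by (rule power_sum[symmetric])
  finally show ?thesis .
qed

text \<open>This derivative is the origin of \<open>lin\<close>: at short times the zero vector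
  loses the total rate, each unit vector gains its own rate, and larger vectors appear only at
  second order. Linearity in the rates lets \<open>lin\<close> commute with expectations.\<close>

lemma vpois_deriv_zero:
  "((\<lambda>t. vpois m \<Lambda> t q) has_real_derivative lin m q \<Lambda>) (at 0)"
proof -
  define S where "S = (\<Sum>s<m. \<Lambda> s)"
  define c where "c = (\<Prod>s<m. \<Lambda> s ^ q s / fact (q s))"
  define j where "j = (\<Sum>s<m. q s)"
  have d: "((\<lambda>t. exp (- (t * S)) * t ^ j * c) has_real_derivative
      ((exp (- (0 * S)) * (- S)) * 0 ^ j + exp (- (0 * S)) * (real j * 0 ^ (j - 1))) * c) (at 0)"
    by (auto intro!: derivative_eq_intros simp: algebra_simps)
  have "((exp (- (0 * S)) * (- S)) * 0 ^ j + exp (- (0 * S)) * (real j * 0 ^ (j - 1))) * c = lin m q \<Lambda>"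
  proof -
    consider "j = 0" | "j = 1" | "j \<ge> 2" by linarith
    then show ?thesis
    proof cases
      case 1
      then have "q s = 0" if "s < m" for s using that by (simp add: j_def)
      then have "c = 1" by (simp add: c_def)
      then show ?thesis using 1 by (simp add: lin_def j_def[symmetric] S_def)
    next
      case 2
      then obtain a where a: "a < m" "q a = 1" "\<And>b. b < m \<Longrightarrow> a \<noteq> b \<Longrightarrow> q b = 0"
        using sum_nat_eq_1[where q = q and m = m] unfolding j_def by blast
      have "c = (\<Prod>s<m. if s = a then \<Lambda> a else 1)" unfolding c_def using a by (intro prod.cong refl) auto
      then have "c = \<Lambda> a" using a(1) by simp
      moreover have "(\<Sum>s<m. real (q s) * \<Lambda> s) = (\<Sum>s<m. if s = a then \<Lambda> a else 0)"
        using a by (intro sum.cong refl) auto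
      ultimately show ?thesis using 2 a(1) by (simp add: lin_def j_def[symmetric])
    next
      case 3
      then have "(0::real) ^ j = 0" "(0::real) ^ (j - 1) = 0" by (auto simp: power_0_left)
      moreover have "lin m q \<Lambda> = 0" using 3 by (simp add: lin_def j_def[symmetric])
      ultimately show ?thesis by (simp add: power_0_left)
    qed
  qed
  then show ?thesis using d unfolding vpois_expand S_def[symmetric] c_def[symmetric] j_def[symmetric] by simp
qed

lemma vpois_zero: "vpois m \<Lambda> 0 q = of_bool ((\<Sum>s<m. q s) = 0)"
  unfolding vpois_expand by (auto simp: power_0_left)

lemma vpois_rate:
  assumes "filterlim b at_top sequentially"
  shows "(\<lambda>k. b k * (vpois m \<Lambda> (1 / b k) q - of_bool ((\<Sum>s<m. q s) = 0))) \<longlonglongrightarrow> lin m q \<Lambda>"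
proof -
  have "(\<lambda>k. inverse (b k)) \<longlonglongrightarrow> 0" by (rule tendsto_inverse_0_at_top[OF assms])
  moreover have "\<forall>\<^sub>F k in sequentially. inverse (b k) \<noteq> 0"
    using filterlim_at_top_dense[THEN iffD1, OF assms, rule_format, of 0] by eventually_elim auto
  ultimately have f: "filterlim (\<lambda>k. inverse (b k)) (at 0) sequentially" by (simp add: filterlim_at)
  have "((\<lambda>h. (vpois m \<Lambda> (0 + h) q - vpois m \<Lambda> 0 q) / h) \<longlongrightarrow> lin m q \<Lambda>) (at 0)"
    using vpois_deriv_zero unfolding DERIV_def .
  from filterlim_compose[OF this f] show ?thesis
    unfolding vpois_zero by (simp add: divide_inverse mult.commute)
qed

section \<open>Laws of single blocks and the Poisson limit\<close>

context hmodel
begin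

text \<open>Counts are integers, so where two of them differ they differ by at least one; the L1
  distance therefore bounds the probability of disagreement.\<close>

lemma prob_close:
  fixes m :: nat
  assumes A: "\<And>s. s < m \<Longrightarrow> A s \<in> sets borel" "\<And>s. s < m \<Longrightarrow> A s \<subseteq> {a..b}"
  shows "\<bar>measure M {w. \<forall>s<m. \<xi> k w (A s) = r s} - measure M {w. \<forall>s<m. \<xi>' k w (A s) = r s}\<bar> \<le> (\<Sum>s<m. L1 k (A s))"
proof -
  define E where "E = {w. \<forall>s<m. \<xi> k w (A s) = r s}"
  define E' where "E' = {w. \<forall>s<m. \<xi>' k w (A s) = r s}"
  define N where "N = (\<lambda>s. {w. \<xi> k w (A s) \<noteq> \<xi>' k w (A s)})"
  have E: "E \<in> sets M" unfolding E_def by (rule sets_nat_vector) (rule measurable_cnt_sc[OF A(1)])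
  have E': "E' \<in> sets M" unfolding E'_def by (rule sets_nat_vector) (rule measurable_cnt_sc[OF A(1)])
  have N: "N s \<in> sets M" if s: "s < m" for s
  proof -
    have m: "(\<lambda>w. ennreal \<bar>real (\<xi> k w (A s)) - real (\<xi>' k w (A s))\<bar>) \<in> borel_measurable M"
      by (rule measurable_diff_cnt[OF A(1)[OF s]])
    have "(\<lambda>w. ennreal \<bar>real (\<xi> k w (A s)) - real (\<xi>' k w (A s))\<bar>) -` (- {0}) \<inter> space M \<in> sets M"
      by (rule measurable_sets[OF m]) simp
    also have "(\<lambda>w. ennreal \<bar>real (\<xi> k w (A s)) - real (\<xi>' k w (A s))\<bar>) -` (- {0}) \<inter> space M = N s"
      by (auto simp: N_def)
    finally show ?thesis .
  qed
  have Nle: "measure M (N s) \<le> L1 k (A s)" if s: "s < m" for s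
  proof -
    have "emeasure M (N s) = (\<integral>\<^sup>+w. indicator (N s) w \<partial>M)" using N[OF s] by simp
    also have "\<dots> \<le> (\<integral>\<^sup>+w. ennreal \<bar>real (\<xi> k w (A s)) - real (\<xi>' k w (A s))\<bar> \<partial>M)"
    proof (rule nn_integral_mono)
      fix w
      have "1 \<le> \<bar>real i - real j\<bar>" if "i \<noteq> j" for i j :: nat using that by linarith
      then show "indicator (N s) w \<le> ennreal \<bar>real (\<xi> k w (A s)) - real (\<xi>' k w (A s))\<bar>"
        by (auto simp: N_def indicator_def ennreal_leI simp flip: ennreal_1)
    qed
    also have "\<dots> = ennreal (L1 k (A s))" by (rule L1_ennreal(2)[OF A(1)[OF s] A(2)[OF s]])
    finally show ?thesis unfolding M.emeasure_eq_measure using L1_nonneg by simp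
  qed
  have U: "measure M (\<Union>s\<in>{..<m}. N s) \<le> (\<Sum>s<m. L1 k (A s))"
  proof -
    have "measure M (\<Union>s\<in>{..<m}. N s) \<le> (\<Sum>s<m. measure M (N s))"
      using N by (intro measure_UNION_le) auto
    also have "\<dots> \<le> (\<Sum>s<m. L1 k (A s))" using Nle by (intro sum_mono) auto
    finally show ?thesis .
  qed
  have UM: "(\<Union>s\<in>{..<m}. N s) \<in> sets M" using N by auto
  have sub: "measure M X \<le> measure M Y + measure M (\<Union>s\<in>{..<m}. N s)"
    if "X \<subseteq> Y \<union> (\<Union>s\<in>{..<m}. N s)" "Y \<in> sets M" for X Y
  proof -
    have "measure M X \<le> measure M (Y \<union> (\<Union>s\<in>{..<m}. N s))" using that UM by (intro M.finite_measure_mono) auto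
    also have "\<dots> \<le> measure M Y + measure M (\<Union>s\<in>{..<m}. N s)" using that UM by (intro measure_Un_le) auto
    finally show ?thesis .
  qed
  have "E \<subseteq> E' \<union> (\<Union>s\<in>{..<m}. N s)" "E' \<subseteq> E \<union> (\<Union>s\<in>{..<m}. N s)"
    by (auto simp: E_def E'_def N_def)
  from sub[OF this(1) E'] sub[OF this(2) E] U show ?thesis unfolding E_def[symmetric] E'_def[symmetric] by linarith
qed

definition nb :: "nat \<Rightarrow> nat" where "nb k = n ^ (k - l k)"

lemma nb_mult: "nb k * n ^ l k = n ^ k"
  unfolding nb_def using l_le[of k] by (simp add: power_add[symmetric])

lemma nb_pos: "nb k > 0"
  by (simp add: nb_def)

lemma nb_at_top: "filterlim (\<lambda>k. real (nb k)) at_top sequentially"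
proof -
  have le: "real (k - l k) \<le> real (nb k)" for k
  proof -
    have "k - l k < 2 ^ (k - l k)" by (rule less_exp)
    also have "\<dots> \<le> n ^ (k - l k)" using n2 by (intro power_mono) auto
    finally show ?thesis by (simp add: nb_def)
  qed
  have "filterlim (\<lambda>k. real (k - l k)) at_top sequentially"
    by (rule filterlim_compose[OF filterlim_real_sequentially l_gap])
  then show ?thesis by (rule filterlim_at_top_mono[OF _ always_eventually]) (rule allI, rule le)
qed

text \<open>The block has \<open>n ^ l k\<close> sites, but the window is scaled with the full
  volume \<open>n ^ k\<close>; this mismatch is what makes a hit rare.\<close>

definition blk :: "nat \<Rightarrow> (nat \<Rightarrow> real) \<Rightarrow> real set \<Rightarrow> nat" where
  "blk k w A = cnt (n ^ l k) (hker n p (l k)) w (sc k A)"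

lemma measurable_blk: "A \<in> sets borel \<Longrightarrow> (\<lambda>w. blk k w A) \<in> measurable M (count_space UNIV)"
  unfolding blk_def by (rule measurable_cnt_sc)

lemma \<xi>'_blocks: "\<xi>' k w A = (\<Sum>j<nb k. blk k (\<lambda>i. w (j * n ^ l k + i)) A)"
  unfolding nb_mult[of k, symmetric] blk_def by (rule cnt_hker_blocks) simp

lemma expectation_blk:
  assumes A: "A \<in> sets borel"
  shows "(\<integral>\<^sup>+w. ennreal (real (blk k w A)) \<partial>M) = ennreal (measure (\<nu> k) A / real (nb k))"
    and "integrable M (\<lambda>w. real (blk k w A))"
    and "(\<integral>w. real (blk k w A) \<partial>M) = measure (\<nu> k) A / real (nb k)"
proof -
  interpret K: anderson_kernel \<gamma> Bd "n ^ l k" "hker n p (l k)" by (rule kernel)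
  interpret N: finite_measure "\<nu> k" by (rule finite_\<nu>)
  have m: "(\<lambda>w. real (blk k w A)) \<in> borel_measurable M"
    by (rule measurable_compose[OF measurable_blk[OF A]]) simp
  have nn: "(\<integral>\<^sup>+w. ennreal (real (blk k w A)) \<partial>M) = ennreal (real (n ^ l k)) * emeasure (\<mu> (l k)) (sc k A)"
    unfolding blk_def \<mu>_def by (rule K.nn_integral_cnt[OF sc_borel[OF A]])
  have "ennreal (real (nb k)) * (\<integral>\<^sup>+w. ennreal (real (blk k w A)) \<partial>M) = emeasure (\<nu> k) A"
    unfolding nn emeasure_\<nu>[OF A] mult.assoc[symmetric]
    by (simp add: ennreal_mult[symmetric] nb_mult of_nat_mult[symmetric] del: of_nat_mult flip: of_nat_power)
  then have "(\<integral>\<^sup>+w. ennreal (real (blk k w A)) \<partial>M) * ennreal (real (nb k)) / ennreal (real (nb k)) = ennreal (measure (\<nu> k) A) / ennreal (real (nb k))"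
    by (simp add: N.emeasure_eq_measure mult.commute)
  then show e: "(\<integral>\<^sup>+w. ennreal (real (blk k w A)) \<partial>M) = ennreal (measure (\<nu> k) A / real (nb k))"
    using nb_pos[of k] by (simp add: ennreal_mult_divide_eq divide_ennreal)
  show "integrable M (\<lambda>w. real (blk k w A))" using m e by (intro integrableI_nonneg) auto
  show "(\<integral>w. real (blk k w A) \<partial>M) = measure (\<nu> k) A / real (nb k)"
    using m e by (intro integral_eq_nn_integral[THEN trans]) auto
qed

definition law1 :: "nat \<Rightarrow> nat \<Rightarrow> (nat \<Rightarrow> real set) \<Rightarrow> (nat \<Rightarrow> nat) \<Rightarrow> real" where
  "law1 k m A q = measure M {w. \<forall>s<m. blk k w (A s) = q s}"

text \<open>The expectation of \<open>indicator_near_affine\<close>, with \<open>Z\<close> the count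
  of \<open>[-R, R]\<close>. The affine part turns into mean counts. The error is Minami's bound at
  half-width \<open>R / n ^ k\<close> for \<open>n ^ l k\<close> sites, and the ratio of the two
  volumes is \<open>nb k\<close>, whence the order \<open>nb k\<close> to the power -2.\<close>

lemma law1_close:
  fixes m :: nat
  assumes A: "\<And>s. s < m \<Longrightarrow> A s \<in> sets borel" "\<And>s. s < m \<Longrightarrow> A s \<subseteq> {- R..R}" and R: "R > 0"
    and dis: "disjoint_family_on A {..<m}"
  shows "\<bar>law1 k m A q - of_bool ((\<Sum>s<m. q s) = 0) - lin m q (\<lambda>s. measure (\<nu> k) (A s) / real (nb k))\<bar>
    \<le> pi * (2 * R * Bd)\<^sup>2 / (real (nb k))\<^sup>2"
proof -
  interpret K: anderson_kernel \<gamma> Bd "n ^ l k" "hker n p (l k)" by (rule kernel)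
  define Z where "Z = (\<lambda>w. blk k w {- R..R})"
  define E where "E = {w. \<forall>s<m. blk k w (A s) = q s}"
  define f where "f = (\<lambda>w. of_bool (\<forall>s<m. blk k w (A s) = q s) - of_bool ((\<Sum>s<m. q s) = 0) - lin m q (\<lambda>s. real (blk k w (A s))))"
  have E: "E \<in> sets M" unfolding E_def by (rule sets_nat_vector) (rule measurable_blk[OF A(1)])
  \<comment> \<open>Disjointness of the windows puts their total count below that of one interval,
    as Minami's estimate requires.\<close>
  have TZ: "(\<Sum>s<m. blk k w (A s)) \<le> Z w" for w
  proof -
    have "(\<Sum>s\<in>T. blk k w (A s)) = blk k w (\<Union>s\<in>T. A s)" if "finite T" "T \<subseteq> {..<m}" for T
      using that
    proof (induction T rule: finite_induct)
      case empty
      then show ?case by (simp add: blk_def sc_def)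
    next
      case (insert t T)
      have "A t \<inter> A s = {}" if "s \<in> T" for s
        using insert that by (intro disjoint_family_onD[OF dis]) auto
      then have "A t \<inter> (\<Union>s\<in>T. A s) = {}" by blast
      from cnt_Un[OF sc_disjoint[OF this]]
      have "blk k w (A t \<union> (\<Union>s\<in>T. A s)) = blk k w (A t) + blk k w (\<Union>s\<in>T. A s)"
        unfolding blk_def by (simp add: sc_def Collect_disj_eq)
      then show ?case using insert by simp
    qed
    from this[of "{..<m}"] have "(\<Sum>s<m. blk k w (A s)) = blk k w (\<Union>s\<in>{..<m}. A s)" by simp
    also have "\<dots> \<le> Z w"
    proof -
      have "(\<Union>s\<in>{..<m}. A s) \<subseteq> {- R..R}" using A(2) by blast
      then show ?thesis unfolding Z_def blk_def by (intro cnt_mono) (auto simp: sc_def)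
    qed
    finally show ?thesis .
  qed
  have int_lin: "integrable M (\<lambda>w. lin m q (\<lambda>s. real (blk k w (A s))))"
    and lin_int: "(\<integral>w. lin m q (\<lambda>s. real (blk k w (A s))) \<partial>M) = lin m q (\<lambda>s. measure (\<nu> k) (A s) / real (nb k))"
  proof -
    define j where "j = (\<Sum>s<m. q s)"
    have i: "integrable M (\<lambda>w. real (blk k w (A s)))" "(\<integral>w. real (blk k w (A s)) \<partial>M) = measure (\<nu> k) (A s) / real (nb k)" if "s \<in> {..<m}" for s
      using expectation_blk(2,3)[OF A(1)] that by auto
    show "integrable M (\<lambda>w. lin m q (\<lambda>s. real (blk k w (A s))))"
      unfolding lin_def j_def[symmetric]
      by (cases "j = 0"; cases "j = 1")
        (auto intro!: Bochner_Integration.integrable_sum Bochner_Integration.integrable_minus integrable_mult_right i)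
    have "(\<integral>w. (\<Sum>s<m. c s * real (blk k w (A s))) \<partial>M) = (\<Sum>s<m. c s * (measure (\<nu> k) (A s) / real (nb k)))" for c :: "nat \<Rightarrow> real"
      using i by (subst Bochner_Integration.integral_sum) auto
    from this[of "\<lambda>s. real (q s)"] this[of "\<lambda>_. 1"]
    show "(\<integral>w. lin m q (\<lambda>s. real (blk k w (A s))) \<partial>M) = lin m q (\<lambda>s. measure (\<nu> k) (A s) / real (nb k))"
      unfolding lin_def j_def[symmetric] by (cases "j = 0"; cases "j = 1") auto
  qed
  have int_E: "integrable M (\<lambda>w. of_bool (\<forall>s<m. blk k w (A s) = q s) :: real)"
  proof -
    have "(\<lambda>w. of_bool (\<forall>s<m. blk k w (A s) = q s) :: real) = indicator E" by (auto simp: E_def indicator_def)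
    then show ?thesis using integrable_real_indicator[OF E] M.emeasure_eq_measure[of E] by simp
  qed
  have E_int: "(\<integral>w. of_bool (\<forall>s<m. blk k w (A s) = q s) \<partial>M) = law1 k m A q"
  proof -
    have "(\<lambda>w. of_bool (\<forall>s<m. blk k w (A s) = q s) :: real) = indicator E" by (auto simp: E_def indicator_def)
    then show ?thesis using E by (simp add: law1_def E_def)
  qed
  have f_int: "integrable M f" unfolding f_def using int_E int_lin by auto
  have "(\<integral>w. f w \<partial>M) = law1 k m A q - of_bool ((\<Sum>s<m. q s) = 0) - lin m q (\<lambda>s. measure (\<nu> k) (A s) / real (nb k))"
    unfolding f_def using int_E int_lin M.prob_space by (simp add: E_int lin_int)
  then have "\<bar>law1 k m A q - of_bool ((\<Sum>s<m. q s) = 0) - lin m q (\<lambda>s. measure (\<nu> k) (A s) / real (nb k))\<bar> \<le> (\<integral>w. \<bar>f w\<bar> \<partial>M)"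
    using integral_abs_bound[of M f] by simp
  also have "ennreal (\<integral>w. \<bar>f w\<bar> \<partial>M) = (\<integral>\<^sup>+w. ennreal \<bar>f w\<bar> \<partial>M)"
    using f_int by (intro nn_integral_eq_integral[symmetric]) auto
  finally have "ennreal \<bar>law1 k m A q - of_bool ((\<Sum>s<m. q s) = 0) - lin m q (\<lambda>s. measure (\<nu> k) (A s) / real (nb k))\<bar>
      \<le> (\<integral>\<^sup>+w. ennreal \<bar>f w\<bar> \<partial>M)"
    using ennreal_leI by metis
  also have "\<dots> \<le> (\<integral>\<^sup>+w. ennreal (real (Z w * (Z w - 1))) \<partial>M)"
    unfolding f_def by (intro nn_integral_mono ennreal_leI indicator_near_affine TZ)
  also have "\<dots> \<le> ennreal (pi * (2 * (R / real n ^ k) * Bd * real (n ^ l k))\<^sup>2)"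
  proof -
    have "sc k {- R..R} = {e - R / real n ^ k..e + R / real n ^ k}" unfolding sc_Icc by simp
    then show ?thesis unfolding Z_def blk_def using K.minami[of "R / real n ^ k" e] R by simp
  qed
  also have "pi * (2 * (R / real n ^ k) * Bd * real (n ^ l k))\<^sup>2 = pi * (2 * R * Bd)\<^sup>2 / (real (nb k))\<^sup>2"
  proof -
    have "real n ^ k = real (nb k) * real (n ^ l k)" using nb_mult[of k] by (metis of_nat_mult of_nat_power)
    then have "2 * (R / real n ^ k) * Bd * real (n ^ l k) = 2 * R * Bd / real (nb k)" by simp
    then show ?thesis by (simp add: power_divide)
  qed
  finally show ?thesis by (subst (asm) ennreal_le_iff) auto
qed

lemma lin_scale: "c * lin m q v = lin m q (\<lambda>s. c * v s)"
  by (simp add: lin_def sum_distrib_left ac_simps)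

lemma lin_tendsto:
  assumes "\<And>s. s < m \<Longrightarrow> (\<lambda>k. v k s) \<longlonglongrightarrow> V s"
  shows "(\<lambda>k. lin m q (v k)) \<longlonglongrightarrow> lin m q V"
proof -
  define j where "j = (\<Sum>s<m. q s)"
  show ?thesis unfolding lin_def j_def[symmetric] using assms by (auto intro!: tendsto_intros)
qed

text \<open>Multiplied by the number of blocks, the Minami error is still of order
  \<open>1 / nb k\<close>, while \<open>nb k\<close> times the mean block count is the mass under
  \<open>\<nu> k\<close>, which converges.\<close>

lemma law1_rate:
  fixes m :: nat
  assumes A: "\<And>s. s < m \<Longrightarrow> A s \<in> sets borel" "\<And>s. s < m \<Longrightarrow> A s \<subseteq> {- R..R}" and R: "R > 0"
    and dis: "disjoint_family_on A {..<m}"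
  shows "(\<lambda>k. real (nb k) * (law1 k m A q - of_bool ((\<Sum>s<m. q s) = 0))) \<longlonglongrightarrow> lin m q (\<lambda>s. \<eta> e * measure lborel (A s))"
proof -
  define c where "c = (\<lambda>k. real (nb k) * (law1 k m A q - of_bool ((\<Sum>s<m. q s) = 0)))"
  define v where "v = (\<lambda>k s. measure (\<nu> k) (A s))"
  have "(\<lambda>k. lin m q (v k)) \<longlonglongrightarrow> lin m q (\<lambda>s. \<eta> e * measure lborel (A s))"
    unfolding v_def using A by (intro lin_tendsto \<nu>_tendsto) auto
  moreover have "(\<lambda>k. c k - lin m q (v k)) \<longlonglongrightarrow> 0"
  proof (rule Lim_null_comparison[OF always_eventually])
    show "\<forall>k. norm (c k - lin m q (v k)) \<le> pi * (2 * R * Bd)\<^sup>2 * inverse (real (nb k))"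
    proof
      fix k
      let ?b = "real (nb k)"
      have b: "?b > 0" using nb_pos by simp
      have "lin m q (v k) = ?b * lin m q (\<lambda>s. v k s / ?b)" unfolding lin_scale using b by simp
      then have "c k - lin m q (v k) = ?b * (law1 k m A q - of_bool ((\<Sum>s<m. q s) = 0) - lin m q (\<lambda>s. v k s / ?b))"
        by (simp add: c_def algebra_simps)
      then have "norm (c k - lin m q (v k)) = ?b * \<bar>law1 k m A q - of_bool ((\<Sum>s<m. q s) = 0) - lin m q (\<lambda>s. v k s / ?b)\<bar>"
        using b by (simp add: abs_mult)
      also have "\<dots> \<le> ?b * (pi * (2 * R * Bd)\<^sup>2 / ?b\<^sup>2)"
        unfolding v_def using b by (intro mult_left_mono law1_close A R dis) auto
      also have "\<dots> = pi * (2 * R * Bd)\<^sup>2 * inverse ?b" using b by (simp add: power2_eq_square field_simps)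
      finally show "norm (c k - lin m q (v k)) \<le> pi * (2 * R * Bd)\<^sup>2 * inverse ?b" .
    qed
    have "(\<lambda>k. pi * (2 * R * Bd)\<^sup>2 * inverse (real (nb k))) \<longlonglongrightarrow> pi * (2 * R * Bd)\<^sup>2 * 0"
      by (intro tendsto_intros tendsto_inverse_0_at_top nb_at_top)
    then show "(\<lambda>k. pi * (2 * R * Bd)\<^sup>2 * inverse (real (nb k))) \<longlonglongrightarrow> 0" by simp
  qed
  ultimately have "(\<lambda>k. lin m q (v k) + (c k - lin m q (v k))) \<longlonglongrightarrow> lin m q (\<lambda>s. \<eta> e * measure lborel (A s)) + 0"
    by (intro tendsto_add)
  then show ?thesis by (simp add: c_def)
qed

lemma block_law_bound:
  fixes m :: nat
  assumes A: "\<And>s. s < m \<Longrightarrow> A s \<in> sets borel"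
  defines "\<Lambda> \<equiv> \<lambda>s. \<eta> e * measure lborel (A s)"
  shows "\<bar>measure M {w. \<forall>s<m. \<xi>' k w (A s) = r s} - vpois m \<Lambda> 1 r\<bar> \<le>
    (\<Sum>q\<in>vbox m r. real (nb k) * \<bar>law1 k m A q - vpois m \<Lambda> (1 / real (nb k)) q\<bar>)"
proof -
  let ?Y = "\<lambda>w s. blk k w (A s)"
  interpret B: block_sum \<gamma> Bd "n ^ l k" m ?Y
  proof
    show "(\<lambda>w. blk k w (A s)) \<in> measurable M (count_space UNIV)" if "s < m" for s
      by (rule measurable_blk[OF A[OF that]])
    show "(\<lambda>s. blk k w (A s)) = (\<lambda>s. blk k w' (A s))" if "\<And>i. i < n ^ l k \<Longrightarrow> w i = w' i" for w w'
      unfolding blk_def using that by (intro ext cnt_cong) auto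
  qed
  \<comment> \<open>The values of \<open>r\<close> beyond \<open>m\<close> are arbitrary;
    restriction supplies the extensional vector asked for by
    \<open>law_poisson_bound\<close>.\<close>
  define R where "R = restrict r {..<m}"
  have box: "vbox m r = vbox m R" unfolding vbox_def R_def by (intro PiE_cong) auto
  have bs: "\<xi>' k w (A s) = B.bsum (nb k) w s" for w s unfolding B.bsum_def by (rule \<xi>'_blocks)
  have "measure M {w. \<forall>s<m. \<xi>' k w (A s) = r s} = B.law (nb k) R"
    unfolding B.law_def bs R_def by (auto intro!: arg_cong[where f = "measure M"])
  moreover have "vpois m \<Lambda> 1 r = vpois m \<Lambda> 1 R" unfolding vpois_def R_def by (intro prod.cong) auto
  moreover have "B.law1 q = law1 k m A q" for q unfolding B.law1_def law1_def ..
  moreover have "R \<in> vbox m R" by (auto simp: R_def vbox_def)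
  moreover have "\<Lambda> s \<ge> 0" for s unfolding \<Lambda>_def using eta_nonneg by simp
  ultimately show ?thesis
    using B.law_poisson_bound[OF nb_pos[of k], of \<Lambda> R] by (simp add: box sum_distrib_left)
qed

theorem poisson_limit:
  fixes m :: nat
  assumes A: "\<And>s. s < m \<Longrightarrow> A s \<in> sets borel" "\<And>s. s < m \<Longrightarrow> bounded (A s)"
    and dis: "disjoint_family_on A {..<m}"
  shows "(\<lambda>k. measure M {w. \<forall>s<m. \<xi> k w (A s) = r s}) \<longlonglongrightarrow> vpois m (\<lambda>s. \<eta> e * measure lborel (A s)) 1 r"
proof -
  let ?\<Lambda> = "\<lambda>s. \<eta> e * measure lborel (A s)"
  have "bounded (\<Union>s\<in>{..<m}. A s)" using A(2) by (intro bounded_UN) auto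
  then obtain R where R: "R > 0" "\<And>x. x \<in> (\<Union>s\<in>{..<m}. A s) \<Longrightarrow> norm x \<le> R"
    unfolding bounded_pos by blast
  have AR: "A s \<subseteq> {- R..R}" if "s < m" for s
  proof
    fix x assume "x \<in> A s"
    then have "norm x \<le> R" using that by (intro R(2)) auto
    then show "x \<in> {- R..R}" by (simp add: abs_le_iff)
  qed
  have "(\<lambda>k. \<Sum>q\<in>vbox m r. real (nb k) * \<bar>law1 k m A q - vpois m ?\<Lambda> (1 / real (nb k)) q\<bar>) \<longlonglongrightarrow> (\<Sum>q\<in>vbox m r. 0)"
  proof (rule tendsto_sum)
    fix q :: "nat \<Rightarrow> nat"
    let ?b = "of_bool ((\<Sum>s<m. q s) = 0) :: real"
    \<comment> \<open>Block law and short-time Poisson law have the same first-order term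
      \<open>lin m q\<close>, so they differ by \<open>o(1 / nb k)\<close>; this is what survives
      the \<open>nb k\<close> replacements.\<close>
    have "(\<lambda>k. real (nb k) * (law1 k m A q - ?b) - real (nb k) * (vpois m ?\<Lambda> (1 / real (nb k)) q - ?b)) \<longlonglongrightarrow> lin m q ?\<Lambda> - lin m q ?\<Lambda>"
      by (intro tendsto_diff law1_rate[OF A(1) AR R(1) dis] vpois_rate nb_at_top)
    then have "(\<lambda>k. real (nb k) * (law1 k m A q - vpois m ?\<Lambda> (1 / real (nb k)) q)) \<longlonglongrightarrow> 0"
      by (simp add: algebra_simps)
    then have "(\<lambda>k. \<bar>real (nb k) * (law1 k m A q - vpois m ?\<Lambda> (1 / real (nb k)) q)\<bar>) \<longlonglongrightarrow> 0"
      by (rule tendsto_rabs_zero)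
    then show "(\<lambda>k. real (nb k) * \<bar>law1 k m A q - vpois m ?\<Lambda> (1 / real (nb k)) q\<bar>) \<longlonglongrightarrow> 0"
      by (simp add: abs_mult)
  qed
  then have s0: "(\<lambda>k. \<Sum>q\<in>vbox m r. real (nb k) * \<bar>law1 k m A q - vpois m ?\<Lambda> (1 / real (nb k)) q\<bar>) \<longlonglongrightarrow> 0" by simp
  have b: "(\<lambda>k. measure M {w. \<forall>s<m. \<xi>' k w (A s) = r s} - vpois m ?\<Lambda> 1 r) \<longlonglongrightarrow> 0"
    by (rule Lim_null_comparison[OF always_eventually s0]) (use block_law_bound[OF A(1)] in auto)
  have "(\<lambda>k. \<Sum>s<m. L1 k (A s)) \<longlonglongrightarrow> (\<Sum>s<m. 0)"
    using A(1) AR by (intro tendsto_sum L1_tendsto) auto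
  then have l0: "(\<lambda>k. \<Sum>s<m. L1 k (A s)) \<longlonglongrightarrow> 0" by simp
  have c: "(\<lambda>k. measure M {w. \<forall>s<m. \<xi> k w (A s) = r s} - measure M {w. \<forall>s<m. \<xi>' k w (A s) = r s}) \<longlonglongrightarrow> 0"
    by (rule Lim_null_comparison[OF always_eventually l0]) (use prob_close[OF A(1) AR] in auto)
  from tendsto_add[OF tendsto_add[OF b c] tendsto_const[of "vpois m ?\<Lambda> 1 r"]] show ?thesis by simp
qed

lemma hxi_eq: "hxi n p x0 e k w A = \<xi> k (\<lambda>i. w (x0 div n ^ k * n ^ k + i)) A"
  unfolding hxi_def cnt_def hHk_mat_eq_Hm[OF n_pos] by (simp add: sc_def)

text \<open>Carrying the ball around \<open>x0\<close> to the origin shifts the potential, and the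
  shifted potential has the same law.\<close>

lemma prob_hxi:
  fixes m :: nat
  assumes A: "\<And>s. s < m \<Longrightarrow> A s \<in> sets borel"
  shows "measure M {w. \<forall>s<m. hxi n p x0 e k w (A s) = r s} = measure M {w. \<forall>s<m. \<xi> k w (A s) = r s}"
proof -
  let ?E = "{w. \<forall>s<m. \<xi> k w (A s) = r s}"
  let ?f = "\<lambda>i. x0 div n ^ k * n ^ k + i"
  have E: "?E \<in> sets M" by (rule sets_nat_vector) (rule measurable_cnt_sc[OF A])
  have "measure M ?E = measure (distr M M (\<lambda>w i. w (?f i))) ?E" by (subst distr_reindex) (auto simp: inj_def)
  also have "\<dots> = measure M ((\<lambda>w i. w (?f i)) -` ?E \<inter> space M)" by (rule measure_distr[OF measurable_reindex E])
  also have "(\<lambda>w i. w (?f i)) -` ?E \<inter> space M = {w. \<forall>s<m. hxi n p x0 e k w (A s) = r s}"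
    by (auto simp: hxi_eq)
  finally show ?thesis by simp
qed

end

section \<open>The decoupling scale and the Poisson limit theorem\<close>

lemma (in hierarchy) tail_le_geometric:
  assumes rho: "\<rho> > 1" and C2: "C2 \<ge> 0" and p: "\<And>s. s \<ge> 1 \<Longrightarrow> p s \<le> C2 * \<rho> powr (- real s)"
  shows "tail j \<le> C2 / (\<rho> - 1) * (1 / \<rho>) ^ j"
proof (rule sums_le[OF _ tail_sums])
  show "p (Suc (r + j)) \<le> C2 * (1 / \<rho>) ^ Suc j * (1 / \<rho>) ^ r" for r
  proof -
    have "\<rho> powr (- real (Suc (r + j))) = (1 / \<rho>) ^ Suc (r + j)"
      using rho by (simp add: powr_minus powr_realpow power_one_over inverse_eq_divide del: of_nat_Suc power_Suc)
    then show ?thesis using p[of "Suc (r + j)"] by (simp add: power_add ac_simps del: of_nat_Suc)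
  qed
  have "(\<lambda>r. (1 / \<rho>) ^ r) sums (1 / (1 - 1 / \<rho>))" using rho by (intro geometric_sums) auto
  from sums_mult[OF this, of "C2 * (1 / \<rho>) ^ Suc j"]
  have "(\<lambda>r. C2 * (1 / \<rho>) ^ Suc j * (1 / \<rho>) ^ r) sums (C2 * (1 / \<rho>) ^ Suc j * (1 / (1 - 1 / \<rho>)))" .
  \<comment> \<open>The first discarded level is \<open>Suc j\<close>; its extra factor
    \<open>1 / \<rho>\<close> turns the geometric sum into \<open>1 / (\<rho> - 1)\<close>.\<close>
  also have "C2 * (1 / \<rho>) ^ Suc j * (1 / (1 - 1 / \<rho>)) = C2 / (\<rho> - 1) * (1 / \<rho>) ^ j"
    using rho by (simp add: field_simps)
  finally show "(\<lambda>r. C2 * (1 / \<rho>) ^ Suc j * (1 / \<rho>) ^ r) sums (C2 / (\<rho> - 1) * (1 / \<rho>) ^ j)" .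
qed

text \<open>The spectral dimension being less than one means \<open>n\<^sup>2 < \<rho>\<close>, which leaves room for a decoupling
  scale \<open>\<lceil>\<alpha> k\<rceil>\<close> with \<open>\<alpha> < 1\<close> such that \<open>n\<^sup>2\<^sup>k \<rho>\<^sup>-\<^sup>\<alpha>\<^sup>k\<close> still tends to zero.\<close>
lemma (in hierarchy) decoupling_scale:
  assumes rho: "\<rho> > 1" and C2: "C2 \<ge> 0" and p: "\<And>s. s \<ge> 1 \<Longrightarrow> p s \<le> C2 * \<rho> powr (- real s)"
    and dim: "2 * ln (real n) / ln \<rho> < 1"
  obtains l where "\<And>k. l k \<le> k" "filterlim (\<lambda>k. k - l k) at_top sequentially"
    "(\<lambda>k. (real n ^ k)\<^sup>2 * tail (l k)) \<longlonglongrightarrow> 0"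
proof -
  define \<theta> where "\<theta> = 2 * ln (real n) / ln \<rho>"
  \<comment> \<open>The midpoint between the spectral dimension and 1: above \<open>\<theta>\<close>
    for the decay of \<open>x ^ k\<close>, below 1 for a growing number of blocks.\<close>
  define \<alpha> where "\<alpha> = (\<theta> + 1) / 2"
  have lnr: "ln \<rho> > 0" using rho by simp
  have th: "0 \<le> \<theta>" "\<theta> < 1" using n2 lnr dim by (auto simp: \<theta>_def)
  then have al: "\<theta> < \<alpha>" "\<alpha> < 1" "0 < \<alpha>" by (auto simp: \<alpha>_def)
  define l where "l = (\<lambda>k::nat. nat \<lceil>\<alpha> * real k\<rceil>)"
  have l_ge: "\<alpha> * real k \<le> real (l k)" for k unfolding l_def by (rule real_nat_ceiling_ge)
  have l_up: "real (l k) \<le> \<alpha> * real k + 1" for k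
    unfolding l_def using al(3) by (simp add: of_nat_nat ceiling_mono[of 0, simplified])
  have l_le: "l k \<le> k" for k
  proof -
    have "\<alpha> * real k \<le> 1 * real k" using al by (intro mult_right_mono) auto
    then show ?thesis by (simp add: l_def nat_le_iff ceiling_le_iff)
  qed
  have gap: "filterlim (\<lambda>k. k - l k) at_top sequentially"
    unfolding filterlim_at_top
  proof
    fix Z :: nat
    \<comment> \<open>The \<open>+ 1\<close> pays for rounding up in \<open>l\<close>.\<close>
    have "\<forall>\<^sub>F k in sequentially. (real Z + 1) / (1 - \<alpha>) \<le> real k"
      using filterlim_real_sequentially by (simp add: filterlim_at_top)
    then show "\<forall>\<^sub>F k in sequentially. Z \<le> k - l k"
    proof eventually_elim
      case (elim k)
      then have "real Z + 1 \<le> (1 - \<alpha>) * real k" using al by (simp add: field_simps)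
      then have "real Z \<le> real k - real (l k)" using l_up[of k] by (simp add: algebra_simps)
      then show ?case by linarith
    qed
  qed
  define K where "K = C2 / (\<rho> - 1)"
  \<comment> \<open>This is \<open>n^2 * \<rho>^(-\<alpha>)\<close>, less than one because
    \<open>2 * ln n\<close> equals \<open>\<theta> * ln \<rho>\<close> and
    \<open>\<theta> < \<alpha>\<close>.\<close>
  define x where "x = exp (2 * ln (real n) - \<alpha> * ln \<rho>)"
  have x: "0 < x" "x < 1"
  proof -
    have "2 * ln (real n) = \<theta> * ln \<rho>" using lnr by (simp add: \<theta>_def)
    then have "2 * ln (real n) - \<alpha> * ln \<rho> < 0" using al(1) lnr by (simp add: mult_strict_right_mono)
    then show "0 < x" "x < 1" by (auto simp: x_def)
  qed
  have bound: "(real n ^ k)\<^sup>2 * tail (l k) \<le> K * x ^ k" for k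
  proof -
    have e1: "(real n ^ k)\<^sup>2 = exp (real k * (2 * ln (real n)))"
    proof -
      have "real k * (2 * ln (real n)) = real (k * 2) * ln (real n)" by simp
      then have "exp (real k * (2 * ln (real n))) = exp (ln (real n)) ^ (k * 2)"
        by (simp only: exp_of_nat_mult)
      moreover have "exp (ln (real n)) = real n" using n2 by simp
      ultimately show ?thesis by (simp add: power_mult)
    qed
    have "(1 / \<rho>) ^ l k = exp (- (real (l k) * ln \<rho>))"
    proof -
      have "exp (- (real (l k) * ln \<rho>)) = exp (- ln \<rho>) ^ l k" by (simp add: exp_of_nat_mult[symmetric])
      then show ?thesis using rho by (simp add: exp_minus inverse_eq_divide)
    qed
    also have "\<dots> \<le> exp (- (\<alpha> * real k * ln \<rho>))" using l_ge[of k] lnr by simp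
    finally have e2: "(1 / \<rho>) ^ l k \<le> exp (- (\<alpha> * real k * ln \<rho>))" .
    have K0: "K \<ge> 0" using C2 rho by (simp add: K_def)
    have "tail (l k) \<le> K * (1 / \<rho>) ^ l k" unfolding K_def by (rule tail_le_geometric[OF rho C2 p])
    also have "\<dots> \<le> K * exp (- (\<alpha> * real k * ln \<rho>))" using e2 K0 by (intro mult_left_mono)
    finally have "(real n ^ k)\<^sup>2 * tail (l k) \<le> exp (real k * (2 * ln (real n))) * (K * exp (- (\<alpha> * real k * ln \<rho>)))"
      unfolding e1 by (intro mult_left_mono) auto
    also have "\<dots> = K * exp (real k * (2 * ln (real n) - \<alpha> * ln \<rho>))"
      by (simp add: exp_diff exp_minus algebra_simps divide_inverse)
    also have "\<dots> = K * x ^ k" by (simp add: x_def exp_of_nat_mult)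
    finally show ?thesis .
  qed
  have "(\<lambda>k. (real n ^ k)\<^sup>2 * tail (l k)) \<longlonglongrightarrow> 0"
  proof (rule Lim_null_comparison[OF always_eventually])
    show "\<forall>k. norm ((real n ^ k)\<^sup>2 * tail (l k)) \<le> K * x ^ k"
      using bound tail_nonneg by simp
    have "(\<lambda>k. K * x ^ k) \<longlonglongrightarrow> K * 0" using x by (intro tendsto_intros LIMSEQ_realpow_zero) auto
    then show "(\<lambda>k. K * x ^ k) \<longlonglongrightarrow> 0" by simp
  qed
  with l_le gap show thesis by (rule that)
qed

theorem theorem3p7:
  fixes n :: nat and \<rho> C1 C2 e :: real and p :: "nat \<Rightarrow> real" and x0 :: nat
    and \<gamma> \<eta> :: "real \<Rightarrow> real"
  defines "M \<equiv> PiM (UNIV :: nat set) (\<lambda>_. density lborel (\<lambda>t. ennreal (\<gamma> t)))"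
  assumes n2: "n \<ge> 2" and rho: "\<rho> > 1"
    and p_pos: "\<forall>r\<ge>1. p r > 0"
    and p_sum: "(\<lambda>r. p (Suc r)) sums 1"
    and C_pos: "C1 > 0" "C2 > 0"
    and p_bounds: "\<forall>r\<ge>1. C1 * \<rho> powr (- real r) \<le> p r \<and> p r \<le> C2 * \<rho> powr (- real r)"
    and dim: "2 * ln (real n) / ln \<rho> < 1"
    and gamma_meas: "\<gamma> \<in> borel_measurable borel"
    and gamma_nonneg: "\<forall>t. \<gamma> t \<ge> 0"
    and gamma_bdd: "\<exists>B. \<forall>t. \<gamma> t \<le> B"
    and gamma_prob: "(\<integral>\<^sup>+ t. ennreal (\<gamma> t) \<partial>lborel) = 1"
    and eta_meas: "\<eta> \<in> borel_measurable borel"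
    and eta_nonneg: "\<forall>t. \<eta> t \<ge> 0"
    and eta_prob: "(\<integral>\<^sup>+ t. ennreal (\<eta> t) \<partial>lborel) = 1"
    and eta_density: "\<forall>z. Im z > 0 \<longrightarrow>
        (\<integral> t. complex_of_real (\<eta> t) / (complex_of_real t - z) \<partial>lborel)
          = (\<integral> \<omega>. hresolvent n p x0 \<omega> z \<partial>M)"
    and eta_pos: "\<eta> e > 0"
    and eta_limit: "\<forall>z. Im z > 0 \<longrightarrow>
        ((\<lambda>\<epsilon>. \<integral> t. Im (1 / (complex_of_real (t - e) - complex_of_real \<epsilon> * z)) * \<eta> t \<partial>lborel)
          \<longlongrightarrow> pi * \<eta> e) (at_right 0)"
  shows "\<forall>(m :: nat) (A :: nat \<Rightarrow> real set) (r :: nat \<Rightarrow> nat).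
     (\<forall>s<m. A s \<in> sets borel \<and> bounded (A s)) \<and> disjoint_family_on A {..<m} \<longrightarrow>
     ((\<lambda>k. measure M {\<omega> \<in> space M. \<forall>s<m. hxi n p x0 e k \<omega> (A s) = r s})
       \<longlonglongrightarrow> (\<Prod>s<m. exp (- \<eta> e * measure lborel (A s)) *
                      (\<eta> e * measure lborel (A s)) ^ r s / fact (r s)))"
proof -
  obtain B where B: "\<forall>t. \<gamma> t \<le> B" using gamma_bdd by blast
  interpret And: anderson \<gamma> B
    using gamma_meas gamma_nonneg gamma_prob B by unfold_locales auto
  have M: "M = And.M" unfolding M_def And.M_def And.D_def ..
  interpret H: hierarchy n p using n2 p_pos p_sum by unfold_locales auto
  obtain l where l: "\<And>k. l k \<le> k" "filterlim (\<lambda>k. k - l k) at_top sequentially"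
    "(\<lambda>k. (real n ^ k)\<^sup>2 * H.tail (l k)) \<longlonglongrightarrow> 0"
    using H.decoupling_scale[of \<rho> C2] rho C_pos p_bounds dim by (metis less_imp_le)
  interpret hmodel \<gamma> B n p x0 e \<eta> l
    using l eta_meas eta_nonneg eta_prob eta_density eta_limit unfolding M by unfold_locales auto
  show ?thesis
  proof (intro allI impI)
    fix m :: nat and A :: "nat \<Rightarrow> real set" and r :: "nat \<Rightarrow> nat"
    assume *: "(\<forall>s<m. A s \<in> sets borel \<and> bounded (A s)) \<and> disjoint_family_on A {..<m}"
    then have A: "\<And>s. s < m \<Longrightarrow> A s \<in> sets borel" "\<And>s. s < m \<Longrightarrow> bounded (A s)"
      and dis: "disjoint_family_on A {..<m}" by auto
    have "(\<lambda>k. measure M {\<omega> \<in> space M. \<forall>s<m. hxi n p x0 e k \<omega> (A s) = r s})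
        \<longlonglongrightarrow> vpois m (\<lambda>s. \<eta> e * measure lborel (A s)) 1 r"
      using poisson_limit[OF A dis, of r] prob_hxi[OF A(1)] unfolding M by simp
    also have "vpois m (\<lambda>s. \<eta> e * measure lborel (A s)) 1 r =
        (\<Prod>s<m. exp (- \<eta> e * measure lborel (A s)) * (\<eta> e * measure lborel (A s)) ^ r s / fact (r s))"
      by (simp add: vpois_def pois_def)
    finally show "(\<lambda>k. measure M {\<omega> \<in> space M. \<forall>s<m. hxi n p x0 e k \<omega> (A s) = r s})
       \<longlonglongrightarrow> (\<Prod>s<m. exp (- \<eta> e * measure lborel (A s)) *
                      (\<eta> e * measure lborel (A s)) ^ r s / fact (r s))" .
  qed
qed

end
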